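(* Let $\mu$ be a $\sigma$-finite Borel measure on $\mathbb{R}$, let $F$ be a probability distribution on $\mathbb{R}$ such that $\int_{\mathbb{R}}\sqrt{F(1-F)}\,|d\mu|<\infty$, and let $X_1,\dots,X_n$ be i.i.d. with distribution $F$. Let $\xi_1,\dots,\xi_n$ be i.i.d. random variables with mean $0$, variance $1$, and $\|\xi\|_{2,1}<\infty$, independent of $X_1,\dots,X_n$. Then the process $\mathbb{Z}_n'(x)=n^{-1/2}\sum_{i=1}^n\xi_i[\mathbf{1}\{X_i\le x\}-F(x)]$ satisfies $$\sup_{h\in\mathrm{BL}_1(\mathbb{L}_\mu)}\bigl|\mathbb{E}_\xi h(\mathbb{Z}_n')-\mathbb{E}h(\mathbb{Z})\bigr|\to0$$ in outer probability, and the sequence $\mathbb{Z}_n'$ is asymptotically measurable.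
   Context: $\mathbb{L}_\mu$ is the space of bounded and $\mu$-integrable functions $z:\mathbb{R}\to\mathbb{R}$ with norm $\|z\|_{\mathbb{L}_\mu}=\bigl(\sup_x|z(x)|\bigr)\vee\bigl(\int|z|\,|d\mu|\bigr)$, with $|d\mu|$ denoting integration with respect to the total variation measure. $\mathbb{Z}$ is the weak limit in $\mathbb{L}_\mu$ of $\mathbb{Z}_n=\sqrt{n}(\mathbb{F}_n-F)$, $\mathbb{F}_n(x)=\frac1n\sum_i\mathbf{1}\{X_i\le x\}$; that is, the mean-zero Gaussian process with covariance $F(x\wedge y)-F(x)F(y)$. $\|\xi\|_{2,1}=\int_0^\infty\sqrt{\Pr(|\xi|>t)}\,dt$. $\mathrm{BL}_1(\mathbb{L}_\mu)$ is the set of functions $h:\mathbb{L}_\mu\to\mathbb{R}$ bounded by $1$ and Lipschitz with constant at most $1$. $\mathbb{E}_\xi$ is expectation over $\xi_1,\dots,\xi_n$ with $X_1,\dots,X_n$ held fixed. Asymptotically measurable means $\mathbb{E}^*h(\mathbb{Z}_n')-\mathbb{E}_*h(\mathbb{Z}_n')\to0$ for every bounded continuous $h:\mathbb{L}_\mu\to\mathbb{R}$ (outer and inner expectations). *)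

theory Defs
  imports "HOL-Probability.Probability"
begin

section \<open>Signed Borel measures and their total variation\<close>

text \<open>
  A measure with values in the extended reals that omits at least one of the two infinite values.
  Only the values on Borel sets matter.
\<close>

definition signed_borel_measure :: "(real set \<Rightarrow> ereal) \<Rightarrow> bool" where
  "signed_borel_measure \<mu> \<longleftrightarrow>
     \<mu> {} = 0 \<and>
     ((\<forall>A\<in>sets borel. \<mu> A \<noteq> \<infinity>) \<or> (\<forall>A\<in>sets borel. \<mu> A \<noteq> -\<infinity>)) \<and>
     (\<forall>A :: nat \<Rightarrow> real set. range A \<subseteq> sets borel \<longrightarrow> disjoint_family A \<longrightarrow>
        (\<lambda>i. \<mu> (A i)) sums \<mu> (\<Union>i. A i))"

definition variation :: "(real set \<Rightarrow> ereal) \<Rightarrow> real set \<Rightarrow> ennreal" where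
  "variation \<mu> A =
     (SUP P\<in>{P. partition_on A P \<and> finite P \<and> P \<subseteq> sets borel}. \<Sum>B\<in>P. e2ennreal \<bar>\<mu> B\<bar>)"

definition total_variation :: "(real set \<Rightarrow> ereal) \<Rightarrow> real measure" where
  "total_variation \<mu> = measure_of UNIV (sets borel) (variation \<mu>)"

lemma sets_total_variation [simp, measurable_cong]: "sets (total_variation \<mu>) = sets borel"
  and space_total_variation [simp]: "space (total_variation \<mu>) = UNIV"
  using sets.sigma_sets_eq[of "borel :: real measure"]
  by (simp_all add: total_variation_def)

lemma variation_upper:
  assumes "\<mu> {} = 0" "finite P" "P \<subseteq> sets borel" "disjoint P" "\<Union>P = A"
  shows "(\<Sum>B\<in>P. e2ennreal \<bar>\<mu> B\<bar>) \<le> variation \<mu> A"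
proof -
  have "(\<Sum>B\<in>P. e2ennreal \<bar>\<mu> B\<bar>) = (\<Sum>B\<in>P - {{}}. e2ennreal \<bar>\<mu> B\<bar>)"
    using assms by (intro sum.mono_neutral_right) (auto simp: zero_ennreal.abs_eq[symmetric])
  also have "\<dots> \<le> variation \<mu> A"
    unfolding variation_def
    using assms by (intro SUP_upper) (auto simp: partition_on_def disjoint_def)
  finally show ?thesis .
qed

lemma variation_empty [simp]: "variation \<mu> {} = 0"
proof -
  have "{P. partition_on {} P \<and> finite P \<and> P \<subseteq> sets (borel :: real measure)} = {{}}"
    by (auto simp: partition_on_def)
  then show ?thesis
    by (simp add: variation_def)
qed

lemma variation_superadditive:
  assumes "\<mu> {} = 0" "A \<inter> B = {}" "A \<in> sets borel" "B \<in> sets borel"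
  shows "variation \<mu> A + variation \<mu> B \<le> variation \<mu> (A \<union> B)"
proof -
  let ?Q = "\<lambda>A. {P. partition_on A P \<and> finite P \<and> P \<subseteq> sets (borel :: real measure)}"
  let ?f = "\<lambda>P. \<Sum>B\<in>P. e2ennreal \<bar>\<mu> B\<bar>"
  have *: "?f P + ?f Q \<le> variation \<mu> (A \<union> B)" if P: "P \<in> ?Q A" and Q: "Q \<in> ?Q B" for P Q
  proof -
    have disj: "C \<inter> D = {}" if "C \<in> P" "D \<in> Q" for C D
      using P Q assms(2) that unfolding partition_on_def by blast
    have "P \<inter> Q = {}"
      using disj P by (fastforce simp: partition_on_def)
    then have "?f P + ?f Q = ?f (P \<union> Q)"
      using P Q by (simp add: sum.union_disjoint)
    also have "\<dots> \<le> variation \<mu> (A \<union> B)"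
    proof (rule variation_upper)
      show "disjoint (P \<union> Q)"
      proof (rule disjointI)
        fix C D assume "C \<in> P \<union> Q" "D \<in> P \<union> Q" "C \<noteq> D"
        moreover have "disjoint P" "disjoint Q"
          using P Q by (auto simp: partition_on_def)
        ultimately show "C \<inter> D = {}"
          using disj[of C D] disj[of D C] by (auto dest: disjointD)
      qed
    qed (use P Q assms in \<open>auto simp: partition_on_def\<close>)
    finally show ?thesis .
  qed
  have "?Q C \<noteq> {}" if "C \<in> sets borel" for C
  proof -
    have "(if C = {} then {} else {C}) \<in> ?Q C"
      using that by (auto simp: partition_on_def)
    then show ?thesis by blast
  qed
  then have ne: "?Q A \<noteq> {}" "?Q B \<noteq> {}"
    using assms by blast+
  have "variation \<mu> A + variation \<mu> B = (SUP Q\<in>?Q B. SUP P\<in>?Q A. ?f P + ?f Q)"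
    unfolding variation_def
    by (subst ennreal_SUP_add_left[OF ne(1)], subst ennreal_SUP_add_right[OF ne(2)]) (rule refl)
  also have "\<dots> \<le> variation \<mu> (A \<union> B)"
    using * by (intro SUP_least) blast
  finally show ?thesis .
qed

lemma variation_mono:
  assumes "\<mu> {} = 0" "A \<subseteq> B" "A \<in> sets borel" "B \<in> sets borel"
  shows "variation \<mu> A \<le> variation \<mu> B"
proof -
  have "variation \<mu> A \<le> variation \<mu> A + variation \<mu> (B - A)"
    by simp
  also have "\<dots> \<le> variation \<mu> (A \<union> (B - A))"
    using assms by (intro variation_superadditive) auto
  also have "A \<union> (B - A) = B"
    using assms by auto
  finally show ?thesis .
qed

lemma e2ennreal_abs_sums_le:
  fixes f :: "nat \<Rightarrow> ereal"
  assumes "f sums s"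
  shows "e2ennreal \<bar>s\<bar> \<le> (\<Sum>i. e2ennreal \<bar>f i\<bar>)"
proof -
  define T where "T = (\<Sum>i. e2ennreal \<bar>f i\<bar>)"
  have add: "\<bar>a + b\<bar> \<le> \<bar>a\<bar> + \<bar>b\<bar>" for a b :: ereal
    by (cases a; cases b) auto
  have abs: "\<bar>\<Sum>i<n. f i\<bar> \<le> (\<Sum>i<n. \<bar>f i\<bar>)" for n
  proof (induction n)
    case (Suc n)
    have "\<bar>\<Sum>i<Suc n. f i\<bar> \<le> \<bar>\<Sum>i<n. f i\<bar> + \<bar>f n\<bar>"
      using add by simp
    also have "\<dots> \<le> (\<Sum>i<n. \<bar>f i\<bar>) + \<bar>f n\<bar>"
      using Suc by (intro add_right_mono)
    finally show ?case by simp
  qed simp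
  have eq: "(\<Sum>i<n. \<bar>f i\<bar>) = enn2ereal (\<Sum>i<n. e2ennreal \<bar>f i\<bar>)" for n
    by (induction n) (simp_all add: zero_ennreal.rep_eq plus_ennreal.rep_eq enn2ereal_e2ennreal)
  have le: "\<bar>\<Sum>i<n. f i\<bar> \<le> enn2ereal T" for n
  proof -
    have "(\<Sum>i<n. e2ennreal \<bar>f i\<bar>) \<le> T"
      unfolding T_def by (rule sum_le_suminf) auto
    then have "(\<Sum>i<n. \<bar>f i\<bar>) \<le> enn2ereal T"
      by (simp add: eq less_eq_ennreal.rep_eq)
    then show ?thesis
      by (rule order_trans[OF abs])
  qed
  have lim: "(\<lambda>n. \<Sum>i<n. f i) \<longlonglongrightarrow> s"
    using assms by (simp add: sums_def)
  have bnd: "- t \<le> x" "x \<le> t" if "\<bar>x\<bar> \<le> t" for x t :: ereal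
    using that by (cases x; cases t; auto)+
  have upper: "s \<le> enn2ereal T"
    by (rule LIMSEQ_le_const2[OF lim]) (use bnd(2)[OF le] in blast)
  have lower: "- enn2ereal T \<le> s"
    by (rule LIMSEQ_le_const[OF lim]) (use bnd(1)[OF le] in blast)
  have "\<bar>s\<bar> \<le> enn2ereal T"
  proof (cases "0 \<le> s")
    case False
    then have "\<bar>s\<bar> = - s" by (cases s) auto
    then show ?thesis using lower by (simp add: ereal_uminus_le_reorder)
  qed (use upper in simp)
  then have "e2ennreal \<bar>s\<bar> \<le> e2ennreal (enn2ereal T)"
    by (rule e2ennreal_mono)
  then show ?thesis
    by (simp add: T_def)
qed

lemma emeasure_total_variation:
  assumes "signed_borel_measure \<mu>" "A \<in> sets borel"
  shows "emeasure (total_variation \<mu>) A = variation \<mu> A"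
  unfolding total_variation_def
proof (rule emeasure_measure_of_sigma)
  have 0: "\<mu> {} = 0" and add: "\<And>A :: nat \<Rightarrow> real set. range A \<subseteq> sets borel \<Longrightarrow> disjoint_family A \<Longrightarrow>
      (\<lambda>i. \<mu> (A i)) sums \<mu> (\<Union>i. A i)"
    using assms by (auto simp: signed_borel_measure_def)
  show "sigma_algebra UNIV (sets (borel :: real measure))"
    using sets.sigma_algebra_axioms[of "borel :: real measure"] by simp
  show "positive (sets borel) (variation \<mu>)"
    by (simp add: positive_def)
  show "countably_additive (sets borel) (variation \<mu>)"
  proof (rule countably_additiveI)
    fix A :: "nat \<Rightarrow> real set"
    assume A: "range A \<subseteq> sets borel" "disjoint_family A" "\<Union>(range A) \<in> sets borel"
    have fin: "(\<Sum>i<n. variation \<mu> (A i)) \<le> variation \<mu> (\<Union>i<n. A i)" for n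
    proof (induction n)
      case (Suc n)
      have "(\<Sum>i<Suc n. variation \<mu> (A i)) \<le> variation \<mu> (\<Union>i<n. A i) + variation \<mu> (A n)"
        using Suc by (auto intro: add_right_mono)
      also have "\<dots> \<le> variation \<mu> ((\<Union>i<n. A i) \<union> A n)"
      proof (rule variation_superadditive)
        have "A i \<inter> A n = {}" if "i < n" for i
          using A(2) that by (auto simp: disjoint_family_on_def)
        then show "(\<Union>i<n. A i) \<inter> A n = {}"
          by blast
      qed (use A 0 in auto)
      also have "(\<Union>i<n. A i) \<union> A n = (\<Union>i<Suc n. A i)"
        by (auto simp: less_Suc_eq)
      finally show ?case .
    qed simp
    show "(\<Sum>i. variation \<mu> (A i)) = variation \<mu> (\<Union>(range A))"
    proof (rule antisym)
      show "(\<Sum>i. variation \<mu> (A i)) \<le> variation \<mu> (\<Union>(range A))"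
      proof (rule suminf_le_const)
        fix n
        have "(\<Sum>i<n. variation \<mu> (A i)) \<le> variation \<mu> (\<Union>i<n. A i)"
          by (rule fin)
        also have "\<dots> \<le> variation \<mu> (\<Union>(range A))"
          using A 0 by (intro variation_mono) auto
        finally show "(\<Sum>i<n. variation \<mu> (A i)) \<le> variation \<mu> (\<Union>(range A))" .
      qed simp
    next
      show "variation \<mu> (\<Union>(range A)) \<le> (\<Sum>i. variation \<mu> (A i))"
        unfolding variation_def[of \<mu> "\<Union>(range A)"]
      proof (rule SUP_least, clarify)
        fix P assume P: "partition_on (\<Union>(range A)) P" "finite P" "P \<subseteq> sets borel"
        have "(\<Sum>B\<in>P. e2ennreal \<bar>\<mu> B\<bar>) \<le> (\<Sum>B\<in>P. \<Sum>i. e2ennreal \<bar>\<mu> (A i \<inter> B)\<bar>)"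
        proof (rule sum_mono)
          fix B assume B: "B \<in> P"
          have "(\<lambda>i. \<mu> (A i \<inter> B)) sums \<mu> (\<Union>i. A i \<inter> B)"
            using A P B by (intro add) (auto simp: disjoint_family_on_def)
          moreover have "(\<Union>i. A i \<inter> B) = B"
            using P B by (auto simp: partition_on_def)
          ultimately show "e2ennreal \<bar>\<mu> B\<bar> \<le> (\<Sum>i. e2ennreal \<bar>\<mu> (A i \<inter> B)\<bar>)"
            by (intro e2ennreal_abs_sums_le) simp
        qed
        also have "\<dots> = (\<Sum>i. \<Sum>B\<in>P. e2ennreal \<bar>\<mu> (A i \<inter> B)\<bar>)"
          by (rule suminf_sum[symmetric]) simp
        also have "\<dots> \<le> (\<Sum>i. variation \<mu> (A i))"
        proof (rule suminf_le)
          fix i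
          have "(\<Sum>B\<in>P. e2ennreal \<bar>\<mu> (A i \<inter> B)\<bar>) = (\<Sum>C\<in>(\<inter>) (A i) ` P. e2ennreal \<bar>\<mu> C\<bar>)"
          proof (subst sum.reindex_nontrivial)
            fix B C assume "B \<in> P" "C \<in> P" "B \<noteq> C" "A i \<inter> B = A i \<inter> C"
            moreover from this have "B \<inter> C = {}"
              using P by (auto simp: partition_on_def dest: disjointD)
            ultimately have "A i \<inter> B = {}"
              by blast
            then show "e2ennreal \<bar>\<mu> (A i \<inter> B)\<bar> = 0"
              using 0 by (simp add: zero_ennreal.abs_eq[symmetric])
          qed (use P in \<open>auto simp: o_def\<close>)
          also have "\<dots> \<le> variation \<mu> (A i)"
          proof (rule variation_upper)
            have "B \<inter> C = {}" if "B \<in> P" "C \<in> P" "B \<noteq> C" for B C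
              using P that by (auto simp: partition_on_def dest: disjointD)
            then show "disjoint ((\<inter>) (A i) ` P)"
              by (intro disjointI) blast
            show "\<Union>((\<inter>) (A i) ` P) = A i"
              using P by (auto simp: partition_on_def)
          qed (use P A 0 in auto)
          finally show "(\<Sum>B\<in>P. e2ennreal \<bar>\<mu> (A i \<inter> B)\<bar>) \<le> variation \<mu> (A i)" .
        qed auto
        finally show "(\<Sum>B\<in>P. e2ennreal \<bar>\<mu> B\<bar>) \<le> (\<Sum>i. variation \<mu> (A i))" .
      qed
    qed
  qed
qed (use assms in simp)

text \<open>Ordinary (nonnegative) Borel measures are signed measures and are their own total variation.\<close>

lemma signed_borel_measure_emeasure:
  assumes "sets M = sets borel"
  shows "signed_borel_measure (\<lambda>A. enn2ereal (emeasure M A))"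
  unfolding signed_borel_measure_def
proof (intro conjI allI impI)
  have "enn2ereal (emeasure M A) \<noteq> -\<infinity>" for A
    using enn2ereal_nonneg[of "emeasure M A"] by auto
  then show "(\<forall>A\<in>sets borel. enn2ereal (emeasure M A) \<noteq> \<infinity>) \<or>
      (\<forall>A\<in>sets borel. enn2ereal (emeasure M A) \<noteq> -\<infinity>)"
    by blast
next
  fix A :: "nat \<Rightarrow> real set"
  assume A: "range A \<subseteq> sets borel" "disjoint_family A"
  have "(\<lambda>i. emeasure M (A i)) sums emeasure M (\<Union>i. A i)"
    using A assms by (simp add: sums_iff suminf_emeasure)
  then have "(\<lambda>n. enn2ereal (\<Sum>i<n. emeasure M (A i))) \<longlonglongrightarrow> enn2ereal (emeasure M (\<Union>i. A i))"
    unfolding sums_def by simp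
  moreover have "enn2ereal (\<Sum>i<n. emeasure M (A i)) = (\<Sum>i<n. enn2ereal (emeasure M (A i)))" for n
    by (induction n) (simp_all add: zero_ennreal.rep_eq plus_ennreal.rep_eq)
  ultimately show "(\<lambda>i. enn2ereal (emeasure M (A i))) sums enn2ereal (emeasure M (\<Union>i. A i))"
    unfolding sums_def by (simp only:)
qed (simp add: zero_ennreal.rep_eq)

lemma total_variation_emeasure:
  assumes "sets M = sets borel"
  shows "total_variation (\<lambda>A. enn2ereal (emeasure M A)) = M"
proof (rule measure_eqI)
  fix A assume "A \<in> sets (total_variation (\<lambda>A. enn2ereal (emeasure M A)))"
  then have A: "A \<in> sets borel" by simp
  let ?Q = "{P. partition_on A P \<and> finite P \<and> P \<subseteq> sets (borel :: real measure)}"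
  have "(\<Sum>B\<in>P. e2ennreal \<bar>enn2ereal (emeasure M B)\<bar>) = emeasure M A" if "P \<in> ?Q" for P
  proof -
    have "(\<Sum>B\<in>P. emeasure M B) = emeasure M (\<Union>B\<in>P. B)"
      using that assms
      by (intro sum_emeasure) (auto simp: partition_on_def disjoint_family_on_def disjoint_def)
    then show ?thesis
      using that by (simp add: partition_on_def)
  qed
  moreover have "(if A = {} then {} else {A}) \<in> ?Q"
    using A by (auto simp: partition_on_def)
  then have "?Q \<noteq> {}" by blast
  ultimately have "variation (\<lambda>A. enn2ereal (emeasure M A)) A = emeasure M A"
    unfolding variation_def by simp
  then show "emeasure (total_variation (\<lambda>A. enn2ereal (emeasure M A))) A = emeasure M A"
    using emeasure_total_variation[OF signed_borel_measure_emeasure[OF assms] A] by simp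
qed (simp add: assms)


section \<open>The space of bounded integrable functions\<close>

text \<open>
  The first argument below is the measure \<open>|d\<mu>|\<close>, that is \<open>total_variation \<mu>\<close>.
  Elements are functions, not equivalence classes.
\<close>

definition L_space :: "real measure \<Rightarrow> (real \<Rightarrow> real) set" where
  "L_space m = {z. bounded (range z) \<and> integrable m z}"

definition L_norm :: "real measure \<Rightarrow> (real \<Rightarrow> real) \<Rightarrow> real" where
  "L_norm m z = max (SUP x. \<bar>z x\<bar>) (\<integral>x. \<bar>z x\<bar> \<partial>m)"

definition L_dist :: "real measure \<Rightarrow> (real \<Rightarrow> real) \<Rightarrow> (real \<Rightarrow> real) \<Rightarrow> real" where
  "L_dist m z w = L_norm m (\<lambda>x. z x - w x)"

lemma L_space_diff:
  assumes "z \<in> L_space m" "w \<in> L_space m"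
  shows "(\<lambda>x. z x - w x) \<in> L_space m"
proof -
  have "bounded (range (\<lambda>x. z x - w x))"
    using assms by (intro bounded_minus_comp) (simp_all add: L_space_def)
  then show ?thesis
    using assms by (simp add: L_space_def)
qed

lemma L_space_abs_le_SUP:
  assumes "z \<in> L_space m"
  shows "\<bar>z x\<bar> \<le> (SUP x. \<bar>z x\<bar>)"
proof (rule cSUP_upper)
  obtain B where "\<And>x. \<bar>z x\<bar> \<le> B"
    using assms unfolding L_space_def bounded_iff by auto
  then show "bdd_above (range (\<lambda>x. \<bar>z x\<bar>))" by (intro bdd_aboveI2)
qed simp

lemma Metric_space_L: "Metric_space (L_space m) (L_dist m)"
proof
  fix z w :: "real \<Rightarrow> real"
  have "0 \<le> (\<integral>x. \<bar>z x - w x\<bar> \<partial>m)" by simp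
  then show "0 \<le> L_dist m z w" unfolding L_dist_def L_norm_def by linarith
  show "L_dist m z w = L_dist m w z"
    by (simp add: L_dist_def L_norm_def abs_minus_commute)
next
  fix z w assume zw: "z \<in> L_space m" "w \<in> L_space m"
  show "L_dist m z w = 0 \<longleftrightarrow> z = w"
  proof
    assume "L_dist m z w = 0"
    then have "\<bar>z x - w x\<bar> \<le> 0" for x
      using L_space_abs_le_SUP[OF L_space_diff[OF zw], of x]
      unfolding L_dist_def L_norm_def by linarith
    then show "z = w" by (intro ext) simp
  qed (simp add: L_dist_def L_norm_def)
next
  fix u v w assume uvw: "u \<in> L_space m" "v \<in> L_space m" "w \<in> L_space m"
  note uv = L_space_diff[OF uvw(1,2)] and vw = L_space_diff[OF uvw(2,3)] and uw = L_space_diff[OF uvw(1,3)]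
  have "(SUP x. \<bar>u x - w x\<bar>) \<le> (SUP x. \<bar>u x - v x\<bar>) + (SUP x. \<bar>v x - w x\<bar>)"
  proof (rule cSUP_least)
    fix x
    show "\<bar>u x - w x\<bar> \<le> (SUP x. \<bar>u x - v x\<bar>) + (SUP x. \<bar>v x - w x\<bar>)"
      using L_space_abs_le_SUP[OF uv, of x] L_space_abs_le_SUP[OF vw, of x] by linarith
  qed simp
  moreover have "(\<integral>x. \<bar>u x - w x\<bar> \<partial>m) \<le> (\<integral>x. \<bar>u x - v x\<bar> + \<bar>v x - w x\<bar> \<partial>m)"
    using uv vw uw unfolding L_space_def by (intro integral_mono) auto
  moreover have "\<dots> = (\<integral>x. \<bar>u x - v x\<bar> \<partial>m) + (\<integral>x. \<bar>v x - w x\<bar> \<partial>m)"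
    using uv vw unfolding L_space_def by (intro Bochner_Integration.integral_add) auto
  ultimately show "L_dist m u w \<le> L_dist m u v + L_dist m v w"
    unfolding L_dist_def L_norm_def by linarith
qed

definition L_topology :: "real measure \<Rightarrow> (real \<Rightarrow> real) topology" where
  "L_topology m = Metric_space.mtopology (L_space m) (L_dist m)"

definition L_borel :: "real measure \<Rightarrow> (real \<Rightarrow> real) measure" where
  "L_borel m = sigma (L_space m) {U. openin (L_topology m) U}"

text \<open>
  Real functions on \<open>L_space m\<close> are represented by their extension by 0 to all functions
  \<open>real \<Rightarrow> real\<close>.
\<close>

definition Cb_L :: "real measure \<Rightarrow> ((real \<Rightarrow> real) \<Rightarrow> real) set" where
  "Cb_L m = {h. continuous_map (L_topology m) euclideanreal h \<and> bounded (h ` L_space m) \<and>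
                (\<forall>z. z \<notin> L_space m \<longrightarrow> h z = 0)}"

definition BL1_L :: "real measure \<Rightarrow> ((real \<Rightarrow> real) \<Rightarrow> real) set" where
  "BL1_L m = {h. (\<forall>z\<in>L_space m. \<bar>h z\<bar> \<le> 1) \<and>
                 (\<forall>z\<in>L_space m. \<forall>w\<in>L_space m. \<bar>h z - h w\<bar> \<le> L_dist m z w) \<and>
                 (\<forall>z. z \<notin> L_space m \<longrightarrow> h z = 0)}"


section \<open>Outer expectations and weak convergence\<close>

text \<open>These are used for bounded, possibly non-measurable \<open>f\<close> on a probability space only.\<close>

definition outer_expectation :: "'a measure \<Rightarrow> ('a \<Rightarrow> real) \<Rightarrow> real" where
  "outer_expectation M f = Inf {(\<integral>\<omega>. U \<omega> \<partial>M) |U. integrable M U \<and> (\<forall>\<omega>\<in>space M. f \<omega> \<le> U \<omega>)}"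

definition inner_expectation :: "'a measure \<Rightarrow> ('a \<Rightarrow> real) \<Rightarrow> real" where
  "inner_expectation M f = Sup {(\<integral>\<omega>. U \<omega> \<partial>M) |U. integrable M U \<and> (\<forall>\<omega>\<in>space M. U \<omega> \<le> f \<omega>)}"

definition tendsto_zero_in_outer_probability :: "'a measure \<Rightarrow> (nat \<Rightarrow> 'a \<Rightarrow> real) \<Rightarrow> bool" where
  "tendsto_zero_in_outer_probability M Y \<longleftrightarrow>
     (\<forall>\<epsilon>>0. (\<lambda>n. outer_measure_of M {\<omega>\<in>space M. \<epsilon> < \<bar>Y n \<omega>\<bar>}) \<longlonglongrightarrow> 0)"

definition asymptotically_measurable ::
    "real measure \<Rightarrow> 'a measure \<Rightarrow> (nat \<Rightarrow> 'a \<Rightarrow> real \<Rightarrow> real) \<Rightarrow> bool" where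
  "asymptotically_measurable m M W \<longleftrightarrow>
     (\<forall>h\<in>Cb_L m. (\<lambda>n. outer_expectation M (\<lambda>\<omega>. h (W n \<omega>)) - inner_expectation M (\<lambda>\<omega>. h (W n \<omega>)))
        \<longlonglongrightarrow> 0)"

definition weak_limit ::
    "real measure \<Rightarrow> 'a measure \<Rightarrow> (nat \<Rightarrow> 'a \<Rightarrow> real \<Rightarrow> real) \<Rightarrow>
     'b measure \<Rightarrow> ('b \<Rightarrow> real \<Rightarrow> real) \<Rightarrow> bool" where
  "weak_limit m M W N Z \<longleftrightarrow>
     Z \<in> measurable N (L_borel m) \<and>
     (\<forall>h\<in>Cb_L m. (\<lambda>n. outer_expectation M (\<lambda>\<omega>. h (W n \<omega>))) \<longlonglongrightarrow> (\<integral>\<omega>. h (Z \<omega>) \<partial>N))"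


section \<open>Gaussian processes\<close>

text \<open>The standard deviation 0 is allowed and gives a point mass.\<close>

definition normal_law :: "real \<Rightarrow> real \<Rightarrow> real measure" where
  "normal_law a \<sigma> = (if \<sigma> = 0 then return borel a else density lborel (normal_density a \<sigma>))"

definition gaussian_process :: "'b measure \<Rightarrow> ('b \<Rightarrow> real \<Rightarrow> real) \<Rightarrow> bool" where
  "gaussian_process N Z \<longleftrightarrow>
     (\<forall>x. (\<lambda>\<omega>. Z \<omega> x) \<in> borel_measurable N) \<and>
     (\<forall>A c. finite A \<longrightarrow> (\<exists>a. \<exists>\<sigma>\<ge>0. distr N borel (\<lambda>\<omega>. \<Sum>x\<in>A. c x * Z \<omega> x) = normal_law a \<sigma>))"

definition mean_zero_gaussian_process ::
    "'b measure \<Rightarrow> ('b \<Rightarrow> real \<Rightarrow> real) \<Rightarrow> (real \<Rightarrow> real \<Rightarrow> real) \<Rightarrow> bool" where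
  "mean_zero_gaussian_process N Z K \<longleftrightarrow>
     gaussian_process N Z \<and>
     (\<forall>x. (\<integral>\<omega>. Z \<omega> x \<partial>N) = 0) \<and>
     (\<forall>x y. (\<integral>\<omega>. Z \<omega> x * Z \<omega> y \<partial>N) = K x y)"


section \<open>Empirical and multiplier processes\<close>

text \<open>Samples are indexed from 0, so that the sample of size \<open>n\<close> is \<open>X 0, \<dots>, X (n - 1)\<close>.\<close>

definition empirical_cdf :: "(nat \<Rightarrow> real) \<Rightarrow> nat \<Rightarrow> real \<Rightarrow> real" where
  "empirical_cdf X n x = (1 / real n) * (\<Sum>i<n. indicator {..x} (X i))"

definition empirical_process :: "(real \<Rightarrow> real) \<Rightarrow> (nat \<Rightarrow> real) \<Rightarrow> nat \<Rightarrow> real \<Rightarrow> real" where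
  "empirical_process F X n x = sqrt (real n) * (empirical_cdf X n x - F x)"

definition multiplier_process ::
    "(real \<Rightarrow> real) \<Rightarrow> (nat \<Rightarrow> real) \<Rightarrow> (nat \<Rightarrow> real) \<Rightarrow> nat \<Rightarrow> real \<Rightarrow> real" where
  "multiplier_process F X \<xi> n x = (1 / sqrt (real n)) * (\<Sum>i<n. \<xi> i * (indicator {..x} (X i) - F x))"

definition norm_2_1 :: "'a measure \<Rightarrow> ('a \<Rightarrow> real) \<Rightarrow> ennreal" where
  "norm_2_1 M Y = (\<integral>\<^sup>+t\<in>{0..}. ennreal (sqrt (measure M {\<omega>\<in>space M. t < \<bar>Y \<omega>\<bar>})) \<partial>lborel)"

end

theory Submission
  imports Defs
begin

text \<open>
  Fix a level \<open>k\<close> and cut the line into the cells on which \<open>\<lfloor>k F\<rfloor>\<close> is constant; \<open>proj k z\<close> is the step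
  function with the values of \<open>z\<close> at the left end points of the cells, and 0 on the two extreme cells.
  A Lipschitz functional of the process differs from its value at the projection by the distance
  between the process and its projection, and at the projection it is a Lipschitz function of finitely many coordinates.

  The distance is small for large \<open>k\<close>, uniformly in large \<open>n\<close>. For the integral part this is a second moment
  computation and dominated convergence. For the uniform part, given the sample, the increments
  over a cell are sums of the multipliers over a chain of index sets. A maximal inequality of
  Kolmogorov and Doob type with fourth moments (after truncating the multipliers) bounds the
  oscillation over a cell by the square of its relative frequency, so the sum over the cells is of order \<open>1 / k\<close>.

  The coordinates are handled by conditional characteristic functions, which converge because the
  conditional variance obeys a law of large numbers. Uniformity over Lipschitz functions comes from an
  explicit approximation by trigonometric polynomials whose coefficients are values of the function:
  Bernstein polynomials in \<open>(1 + sin (y / L)) / 2\<close>, where \<open>L sin (y / L)\<close> is close to \<open>y\<close>.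

  The limit process inherits the approximation by its projections: its finite-dimensional laws are limits of
  those of the multiplier process, and its paths are right continuous. For a merely continuous functional,
  asymptotic measurability follows by squeezing it between Lipschitz functionals.
\<close>

section \<open>Trigonometric approximation of Lipschitz functions of finitely many coordinates\<close>

text \<open>The supremum over all Lipschitz functionals sits inside the probability, so convergence
  for each functional is not enough, and the supremum need not be measurable. Every bound is
  arranged so that the functional disappears from it: the remainder is a measurable function of the
  sample that knows the functional only through its bound and Lipschitz constant, and Markov's
  inequality is applied to that remainder. This is why the approximating polynomials are explicit:
  for a fixed degree one finite list of cosines serves all functionals, and only the coefficients
  vary, within the bound of the functional. Sample and multipliers are evaluated at separate points
  \<open>\<omega>\<close> and \<open>\<omega>'\<close>, so that conditioning on the sample is a
  plain integral over \<open>\<omega>'\<close>; independence leads back to the diagonal. Second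
  moments alone would not control the oscillation, since the relative frequencies of the cells may
  add up to one; fourth moments square them. Cells are cut by quantiles, and an atom may carry more
  mass than a cell should have; only observations strictly to the right of a left end point are
  counted, which removes the atom there.\<close>

lemma sum_Bernstein_square_deviation:
  assumes "0 < n"
  shows "(\<Sum>k\<le>n. (x - real k / real n)\<^sup>2 * Bernstein n k x) = x * (1 - x) / real n"
proof -
  have *: "(a - b * x)\<^sup>2 * c = a * (a - 1) * c + (1 - 2 * b * x) * a * c + b * b * x * x * c"
    for a b c :: real
    by (simp add: algebra_simps power2_eq_square)
  have "(\<Sum>k\<le>n. (real k - real n * x)\<^sup>2 * Bernstein n k x) = real n * x * (1 - x)"
    apply (simp add: * sum.distrib)
    apply (simp flip: sum_distrib_left add: mult.assoc)
    apply (simp add: algebra_simps power2_eq_square)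
    done
  then have "(\<Sum>k\<le>n. (real k - real n * x)\<^sup>2 * Bernstein n k x) / (real n)\<^sup>2 = x * (1 - x) / real n"
    by (simp add: power2_eq_square)
  moreover have "(real k - real n * x)\<^sup>2 * Bernstein n k x / (real n)\<^sup>2 = (x - real k / real n)\<^sup>2 * Bernstein n k x" for k
    using assms by (simp add: field_simps power2_eq_square)
  ultimately show ?thesis
    by (simp add: sum_divide_distrib)
qed

text \<open>Cauchy-Schwarz against the binomial variance, in additive form: a pointwise Young
  inequality leaves only the variance sum and the total weight 1.\<close>

lemma sum_Bernstein_abs_deviation:
  assumes "0 < n" "0 \<le> x" "x \<le> 1"
  shows "(\<Sum>k\<le>n. \<bar>x - real k / real n\<bar> * Bernstein n k x) \<le> 1 / sqrt (real n)"
proof -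
  \<comment> \<open>The square \<open>(sqrt n * \<bar>d\<bar> - 1)\<^sup>2\<close>, expanded; the
    weight \<open>sqrt n\<close> balances a variance of order \<open>1 / n\<close> against the
    constant.\<close>
  have abs: "\<bar>d\<bar> \<le> (sqrt (real n) * d\<^sup>2 + 1 / sqrt (real n)) / 2" for d :: real
  proof -
    have "0 \<le> (sqrt (real n) * \<bar>d\<bar> - 1)\<^sup>2 / sqrt (real n)"
      by simp
    also have "\<dots> = sqrt (real n) * d\<^sup>2 - 2 * \<bar>d\<bar> + 1 / sqrt (real n)"
      using assms by (simp add: power2_diff power_mult_distrib field_simps)
    finally show ?thesis by simp
  qed
  have "(\<Sum>k\<le>n. \<bar>x - real k / real n\<bar> * Bernstein n k x)
      \<le> (\<Sum>k\<le>n. (sqrt (real n) * (x - real k / real n)\<^sup>2 + 1 / sqrt (real n)) / 2 * Bernstein n k x)"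
    by (intro sum_mono mult_right_mono abs Bernstein_nonneg assms)
  also have "\<dots> = sqrt (real n) / 2 * (\<Sum>k\<le>n. (x - real k / real n)\<^sup>2 * Bernstein n k x)
      + 1 / (2 * sqrt (real n)) * (\<Sum>k\<le>n. Bernstein n k x)"
    by (simp only: sum_distrib_left flip: sum.distrib) (intro sum.cong, auto simp: field_simps)
  also have "\<dots> = (x * (1 - x) + 1) / (2 * sqrt (real n))"
    unfolding sum_Bernstein_square_deviation[OF assms(1)] sum_Bernstein
    using assms by (simp add: field_simps)
  also have "\<dots> \<le> 2 / (2 * sqrt (real n))"
    using assms mult_le_one[of x "1 - x"] by (intro divide_right_mono) auto
  finally show ?thesis by simp
qed

text \<open>The argument lies in the unit interval for every real \<open>y\<close>. Bernstein
  weights thus become a partition of unity on the whole line that is also a trigonometric polynomial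
  in \<open>y\<close>.\<close>

definition sin_bernstein :: "real \<Rightarrow> nat \<Rightarrow> nat \<Rightarrow> real \<Rightarrow> real" where
  "sin_bernstein L m k y = Bernstein m k ((1 + sin (y / L)) / 2)"

text \<open>The value of \<open>L * sin (y / L)\<close> at which the Bernstein variable
  \<open>(1 + sin (y / L)) / 2\<close> equals \<open>k / m\<close>.\<close>

definition sin_node :: "real \<Rightarrow> nat \<Rightarrow> nat \<Rightarrow> real" where
  "sin_node L m k = L * (2 * real k / real m - 1)"

lemma half_one_plus_sin:
  fixes t :: real
  shows "0 \<le> (1 + sin t) / 2" and "(1 + sin t) / 2 \<le> 1"
proof -
  have "0 \<le> (1 + s) / 2 \<and> (1 + s) / 2 \<le> 1" if "- 1 \<le> s" "s \<le> 1" for s :: real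
    using that by auto
  then show "0 \<le> (1 + sin t) / 2" and "(1 + sin t) / 2 \<le> 1"
    using sin_ge_minus_one[of t] sin_le_one[of t] by blast+
qed

lemma sin_bernstein_nonneg: "0 \<le> sin_bernstein L m k y"
  unfolding sin_bernstein_def by (intro Bernstein_nonneg half_one_plus_sin)

lemma sum_sin_bernstein [simp]: "(\<Sum>k\<le>m. sin_bernstein L m k y) = 1"
  by (simp add: sin_bernstein_def)

text \<open>The triangle inequality through \<open>L * sin (y / L)\<close>: replacing
  \<open>y\<close> by it costs at most \<open>y\<^sup>2 / L\<close> by Taylor, and the Bernstein
  deviation, stretched by \<open>2 * L\<close>, covers the distance to the node. The first term is
  kept quadratic because second moments of the coordinates are what is controlled later.\<close>

lemma sum_sin_bernstein_deviation:
  assumes "0 < L" "0 < m"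
  shows "(\<Sum>k\<le>m. sin_bernstein L m k y * \<bar>y - sin_node L m k\<bar>) \<le> y\<^sup>2 / L + 2 * L / sqrt (real m)"
proof -
  define p where "p = (1 + sin (y / L)) / 2"
  have p: "0 \<le> p" "p \<le> 1"
    unfolding p_def by (fact half_one_plus_sin)+
  have "\<bar>sin (y / L) - y / L\<bar> \<le> (y / L)\<^sup>2"
  proof -
    have "\<bar>sin (y / L) - y / L\<bar> \<le> (y / L)\<^sup>2 / 2"
      using Maclaurin_sin_bound[of "y / L" 2] by (simp add: numeral_2_eq_2 sin_coeff_def)
    then show ?thesis by (smt (verit) zero_le_power2 field_sum_of_halves)
  qed
  then have "L * \<bar>sin (y / L) - y / L\<bar> \<le> L * (y / L)\<^sup>2"
    using assms by (intro mult_left_mono) auto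
  moreover have "L * \<bar>sin (y / L) - y / L\<bar> = \<bar>y - L * sin (y / L)\<bar>"
    using assms by (simp add: abs_mult_pos' right_diff_distrib abs_minus_commute)
  ultimately have "\<bar>y - L * sin (y / L)\<bar> \<le> y\<^sup>2 / L"
    using assms by (simp add: power2_eq_square)
  moreover have "\<bar>L * sin (y / L) - sin_node L m k\<bar> = 2 * L * \<bar>p - real k / real m\<bar>" for k
  proof -
    have "L * sin (y / L) - sin_node L m k = 2 * L * (p - real k / real m)"
      by (simp add: p_def sin_node_def field_simps)
    then show ?thesis using assms by (simp add: abs_mult)
  qed
  moreover have "\<bar>y - sin_node L m k\<bar> \<le> \<bar>y - L * sin (y / L)\<bar> + \<bar>L * sin (y / L) - sin_node L m k\<bar>" for k
    by linarith
  ultimately have "\<bar>y - sin_node L m k\<bar> \<le> y\<^sup>2 / L + 2 * L * \<bar>p - real k / real m\<bar>" for k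
    by (metis add_right_mono order_trans)
  then have "(\<Sum>k\<le>m. sin_bernstein L m k y * \<bar>y - sin_node L m k\<bar>)
      \<le> (\<Sum>k\<le>m. sin_bernstein L m k y * (y\<^sup>2 / L + 2 * L * \<bar>p - real k / real m\<bar>))"
    by (intro sum_mono mult_left_mono sin_bernstein_nonneg) auto
  also have "\<dots> = y\<^sup>2 / L * (\<Sum>k\<le>m. sin_bernstein L m k y) + 2 * L * (\<Sum>k\<le>m. \<bar>p - real k / real m\<bar> * Bernstein m k p)"
    by (simp only: sum_distrib_left flip: sum.distrib)
       (intro sum.cong, auto simp: sin_bernstein_def p_def algebra_simps)
  also have "\<dots> \<le> y\<^sup>2 / L * 1 + 2 * L * (1 / sqrt (real m))"
    using assms p by (intro add_mono mult_left_mono sum_Bernstein_abs_deviation) auto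
  finally show ?thesis by simp
qed

definition sin_bernstein_prod :: "real \<Rightarrow> nat \<Rightarrow> 'i set \<Rightarrow> ('i \<Rightarrow> nat) \<Rightarrow> ('i \<Rightarrow> real) \<Rightarrow> real" where
  "sin_bernstein_prod L m T f y = (\<Prod>x\<in>T. sin_bernstein L m (f x) (y x))"

text \<open>The product weights have the one-dimensional weights as marginals: putting
  \<open>c\<close> into the factor of \<open>x\<close> and exchanging product and sum leaves 1 in
  all other factors.\<close>

lemma sum_sin_bernstein_prod_coordinate:
  assumes "finite T" "x \<in> T"
  shows "(\<Sum>f\<in>T \<rightarrow>\<^sub>E {..m}. sin_bernstein_prod L m T f y * c (f x)) = (\<Sum>k\<le>m. sin_bernstein L m k (y x) * c k)"
proof -
  have "sin_bernstein_prod L m T f y * c (f x)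
      = (\<Prod>x'\<in>T. sin_bernstein L m (f x') (y x') * (if x' = x then c (f x') else 1))" for f
    using assms by (simp add: sin_bernstein_prod_def prod.distrib)
  then have "(\<Sum>f\<in>T \<rightarrow>\<^sub>E {..m}. sin_bernstein_prod L m T f y * c (f x))
      = (\<Prod>x'\<in>T. \<Sum>k\<le>m. sin_bernstein L m k (y x') * (if x' = x then c k else 1))"
    using assms by (simp add: prod_sum_PiE)
  also have "\<dots> = (\<Prod>x'\<in>T. if x' = x then (\<Sum>k\<le>m. sin_bernstein L m k (y x') * c k) else 1)"
    by (intro prod.cong) auto
  finally show ?thesis
    using assms by simp
qed

lemma sum_sin_bernstein_prod:
  assumes "finite T"
  shows "(\<Sum>f\<in>T \<rightarrow>\<^sub>E {..m}. sin_bernstein_prod L m T f y) = 1"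
  using prod_sum_PiE[OF assms, of "\<lambda>_. {..m}" "\<lambda>x k. sin_bernstein L m k (y x)"]
  by (simp add: sin_bernstein_prod_def)

lemma sin_bernstein_prod_nonneg: "0 \<le> sin_bernstein_prod L m T f y"
  unfolding sin_bernstein_prod_def by (intro prod_nonneg ballI sin_bernstein_nonneg)

text \<open>The weights sum to one, so the error is a weighted average of differences between
  \<open>g y\<close> and values at nodes, and the marginals reduce it to one coordinate at a time.
  The right-hand side sees \<open>g\<close> through \<open>K\<close> only, which is the source of
  the later uniformity.\<close>

lemma lipschitz_sin_bernstein_approx:
  fixes g :: "('i \<Rightarrow> real) \<Rightarrow> real"
  assumes "finite T" "0 < L" "0 < m" "0 \<le> K"
    and g: "\<And>y y'. \<bar>g y - g y'\<bar> \<le> K * (\<Sum>x\<in>T. \<bar>y x - y' x\<bar>)"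
  shows "\<bar>g y - (\<Sum>f\<in>T \<rightarrow>\<^sub>E {..m}. g (\<lambda>x. sin_node L m (f x)) * sin_bernstein_prod L m T f y)\<bar>
    \<le> K * (\<Sum>x\<in>T. (y x)\<^sup>2 / L + 2 * L / sqrt (real m))"
proof -
  let ?P = "T \<rightarrow>\<^sub>E {..m}" and ?\<psi> = "\<lambda>f. sin_bernstein_prod L m T f y"
  have "g y - (\<Sum>f\<in>?P. g (\<lambda>x. sin_node L m (f x)) * ?\<psi> f)
      = (\<Sum>f\<in>?P. (g y - g (\<lambda>x. sin_node L m (f x))) * ?\<psi> f)"
    using sum_sin_bernstein_prod[OF assms(1), of L m y]
    by (simp add: left_diff_distrib sum_subtractf flip: sum_distrib_left)
  also have "\<bar>\<dots>\<bar> \<le> (\<Sum>f\<in>?P. \<bar>g y - g (\<lambda>x. sin_node L m (f x))\<bar> * ?\<psi> f)"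
    by (intro order_trans[OF sum_abs]) (simp add: abs_mult sin_bernstein_prod_nonneg)
  also have "\<dots> \<le> (\<Sum>f\<in>?P. K * (\<Sum>x\<in>T. \<bar>y x - sin_node L m (f x)\<bar>) * ?\<psi> f)"
    by (intro sum_mono mult_right_mono g sin_bernstein_prod_nonneg)
  also have "\<dots> = (\<Sum>f\<in>?P. \<Sum>x\<in>T. K * (?\<psi> f * \<bar>y x - sin_node L m (f x)\<bar>))"
    by (simp add: sum_distrib_left sum_distrib_right mult_ac)
  also have "\<dots> = K * (\<Sum>x\<in>T. \<Sum>f\<in>?P. ?\<psi> f * \<bar>y x - sin_node L m (f x)\<bar>)"
    by (subst sum.swap) (simp add: sum_distrib_left)
  also have "\<dots> = K * (\<Sum>x\<in>T. \<Sum>k\<le>m. sin_bernstein L m k (y x) * \<bar>y x - sin_node L m k\<bar>)"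
    by (intro arg_cong[where f = "\<lambda>c. K * c"] sum.cong refl
          sum_sin_bernstein_prod_coordinate[where c = "\<lambda>k. \<bar>y _ - sin_node L m k\<bar>"] assms(1))
  also have "\<dots> \<le> K * (\<Sum>x\<in>T. (y x)\<^sup>2 / L + 2 * L / sqrt (real m))"
    using assms by (intro mult_left_mono sum_mono sum_sin_bernstein_deviation) auto
  finally show ?thesis .
qed

section \<open>Finite sums of cosines of linear forms\<close>

text \<open>The free phase \<open>b\<close> covers sines and constants, and product-to-sum formulas
  make the class an algebra, so that a limit has to be computed only for a single cosine of a linear
  form.\<close>

inductive trig_sum :: "'i set \<Rightarrow> (('i \<Rightarrow> real) \<Rightarrow> real) \<Rightarrow> bool" for T where
  trig_sum_cos: "trig_sum T (\<lambda>y. cos ((\<Sum>x\<in>T. s x * y x) + b))"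
| trig_sum_add: "trig_sum T \<phi> \<Longrightarrow> trig_sum T \<psi> \<Longrightarrow> trig_sum T (\<lambda>y. \<phi> y + \<psi> y)"
| trig_sum_scale: "trig_sum T \<phi> \<Longrightarrow> trig_sum T (\<lambda>y. c * \<phi> y)"

lemma trig_sum_const: "trig_sum T (\<lambda>_. c)"
  using trig_sum_scale[OF trig_sum_cos[of T "\<lambda>_. 0" 0], of c] by simp

lemma trig_sum_mult:
  assumes "trig_sum T \<phi>" "trig_sum T \<psi>"
  shows "trig_sum T (\<lambda>y. \<phi> y * \<psi> y)"
  using assms(1)
proof induction
  case (trig_sum_cos s b)
  show ?case
    using assms(2)
  proof induction
    case (trig_sum_cos r a)
    have "cos ((\<Sum>x\<in>T. s x * y x) + b) * cos ((\<Sum>x\<in>T. r x * y x) + a)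
      = 1/2 * cos ((\<Sum>x\<in>T. (s x - r x) * y x) + (b - a)) + 1/2 * cos ((\<Sum>x\<in>T. (s x + r x) * y x) + (b + a))" for y
    proof -
      have "(\<Sum>x\<in>T. (s x - r x) * y x) + (b - a) = ((\<Sum>x\<in>T. s x * y x) + b) - ((\<Sum>x\<in>T. r x * y x) + a)"
        and "(\<Sum>x\<in>T. (s x + r x) * y x) + (b + a) = ((\<Sum>x\<in>T. s x * y x) + b) + ((\<Sum>x\<in>T. r x * y x) + a)"
        by (simp_all add: left_diff_distrib distrib_right sum_subtractf sum.distrib)
      then show ?thesis
        by (simp only: cos_times_cos) simp
    qed
    then show ?case
      by (simp only:) (intro trig_sum.intros)
  next
    case (trig_sum_add \<phi> \<psi>)
    then show ?case by (simp only: distrib_left) (intro trig_sum.intros)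
  next
    case (trig_sum_scale \<phi> c)
    then show ?case by (simp only: mult.left_commute[of _ c]) (intro trig_sum.intros)
  qed
next
  case (trig_sum_add \<phi> \<psi>)
  then show ?case by (simp only: distrib_right) (intro trig_sum.intros)
next
  case (trig_sum_scale \<phi> c)
  then show ?case by (simp only: mult.assoc) (intro trig_sum.intros)
qed

lemma trig_sum_power: "trig_sum T \<phi> \<Longrightarrow> trig_sum T (\<lambda>y. \<phi> y ^ k)"
  by (induction k) (simp_all add: trig_sum_const trig_sum_mult)

lemma trig_sum_prod: "(\<And>x. x \<in> A \<Longrightarrow> trig_sum T (\<phi> x)) \<Longrightarrow> trig_sum T (\<lambda>y. \<Prod>x\<in>A. \<phi> x y)"
  by (induction A rule: infinite_finite_induct) (simp_all add: trig_sum_const trig_sum_mult)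

lemma trig_sum_sin_bernstein_prod:
  assumes "finite T"
  shows "trig_sum T (sin_bernstein_prod L m T f)"
  unfolding sin_bernstein_prod_def
proof (rule trig_sum_prod)
  fix x assume x: "x \<in> T"
  \<comment> \<open>The coordinate as a linear form over \<open>T\<close>, with a phase that turns
    the cosine into a sine.\<close>
  have "sin (y x / L) = cos ((\<Sum>x'\<in>T. (if x' = x then 1 / L else 0) * y x') + - (pi / 2))" for y :: "'a \<Rightarrow> real"
    using assms x by (simp add: if_distrib[of "\<lambda>c. c * _"] cos_diff cong: if_cong)
  then have s: "trig_sum T (\<lambda>y. sin (y x / L))"
    by (simp only:) (rule trig_sum_cos)
  have "trig_sum T (\<lambda>y. real (m choose f x) * (1 / 2 + 1 / 2 * sin (y x / L)) ^ f x
      * (1 / 2 + (- 1 / 2) * sin (y x / L)) ^ (m - f x))"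
    by (intro trig_sum_mult trig_sum_power trig_sum_add trig_sum_const trig_sum_scale s)
  then show "trig_sum T (\<lambda>y. sin_bernstein L m (f x) (y x))"
    by (simp add: sin_bernstein_def Bernstein_def add_divide_distrib diff_divide_distrib)
qed

lemma trig_sum_bounded: "trig_sum T \<phi> \<Longrightarrow> \<exists>B. \<forall>y. \<bar>\<phi> y\<bar> \<le> B"
proof (induction rule: trig_sum.induct)
  case (trig_sum_add \<phi> \<psi>)
  then obtain B C where "\<forall>y. \<bar>\<phi> y\<bar> \<le> B" "\<forall>y. \<bar>\<psi> y\<bar> \<le> C" by blast
  then have "\<bar>\<phi> y + \<psi> y\<bar> \<le> B + C" for y
    using abs_triangle_ineq[of "\<phi> y" "\<psi> y"] by (meson add_mono order_trans)
  then show ?case by blast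
next
  case (trig_sum_scale \<phi> c)
  then obtain B where "\<forall>y. \<bar>\<phi> y\<bar> \<le> B" by blast
  then have "\<bar>c * \<phi> y\<bar> \<le> \<bar>c\<bar> * B" for y
    by (simp add: abs_mult mult_left_mono)
  then show ?case by blast
qed (use abs_cos_le_one in blast)

lemma trig_sum_measurable:
  assumes "trig_sum T \<phi>" "\<And>x. x \<in> T \<Longrightarrow> (\<lambda>\<omega>. V \<omega> x) \<in> borel_measurable M"
  shows "(\<lambda>\<omega>. \<phi> (V \<omega>)) \<in> borel_measurable M"
  using assms(1)
proof induction
  case (trig_sum_cos s b)
  have "(\<lambda>\<omega>. \<Sum>x\<in>T. s x * V \<omega> x) \<in> borel_measurable M"
    using assms(2) by (intro borel_measurable_sum borel_measurable_times) auto
  then show ?case by measurable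
qed simp_all

text \<open>With \<open>L = j + 1\<close> and \<open>m = L ^ 4\<close> one has
  \<open>sqrt m = L\<^sup>2\<close>, so both error terms are of order \<open>1 / L\<close>. The
  convergence is pointwise in \<open>y\<close> and serves measurability.\<close>

lemma lipschitz_approx_converges:
  fixes g :: "('i \<Rightarrow> real) \<Rightarrow> real"
  assumes "finite T" "0 \<le> K"
    and g: "\<And>y y'. \<bar>g y - g y'\<bar> \<le> K * (\<Sum>x\<in>T. \<bar>y x - y' x\<bar>)"
  defines "L j \<equiv> real (Suc j)" and "m j \<equiv> (Suc j) ^ 4"
  shows "(\<lambda>j. \<Sum>f\<in>T \<rightarrow>\<^sub>E {..m j}. g (\<lambda>x. sin_node (L j) (m j) (f x)) * sin_bernstein_prod (L j) (m j) T f y) \<longlonglongrightarrow> g y"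
    (is "?G \<longlonglongrightarrow> _")
proof (rule LIMSEQ_I)
  fix e :: real assume "0 < e"
  have "sqrt (real (m j)) = L j * L j" for j
    unfolding m_def L_def of_nat_power
    by (rule real_sqrt_unique) (simp_all only: power4_eq_xxxx power2_eq_square mult.assoc zero_le_mult_iff of_nat_0_le_iff simp_thms)
  then have "(y x)\<^sup>2 / L j + 2 * L j / sqrt (real (m j)) = ((y x)\<^sup>2 + 2) / L j" for j x
    by (simp only: add_divide_distrib) (simp add: L_def del: of_nat_Suc)
  then have "\<bar>?G j - g y\<bar> \<le> K * (\<Sum>x\<in>T. ((y x)\<^sup>2 + 2) / L j)" for j
    using lipschitz_sin_bernstein_approx[OF assms(1) _ _ assms(2) g, of "L j" "m j" y]
    by (simp add: abs_minus_commute) (simp add: L_def m_def)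
  then have b: "\<bar>?G j - g y\<bar> \<le> (K * (\<Sum>x\<in>T. (y x)\<^sup>2 + 2)) / real (Suc j)" for j
    by (simp add: L_def flip: sum_divide_distrib)
  have "(\<lambda>j. (K * (\<Sum>x\<in>T. (y x)\<^sup>2 + 2)) / real (Suc j)) \<longlonglongrightarrow> 0"
    by (rule LIMSEQ_Suc[OF lim_const_over_n])
  from order_tendstoD(2)[OF this \<open>0 < e\<close>]
  obtain j0 where j0: "\<And>j. j0 \<le> j \<Longrightarrow> (K * (\<Sum>x\<in>T. (y x)\<^sup>2 + 2)) / real (Suc j) < e"
    unfolding eventually_sequentially by blast
  have "norm (?G j - g y) < e" if "j0 \<le> j" for j
    using order_le_less_trans[OF b j0[OF that]] by simp
  then show "\<exists>j0. \<forall>j\<ge>j0. norm (?G j - g y) < e" by blast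
qed

text \<open>A pointwise limit of trigonometric polynomials in the coordinates from \<open>T\<close>.
  The domain of \<open>g\<close> is a full function space, so measurability is stated along
  \<open>V\<close> and no sigma-algebra on that space has to be chosen.\<close>

lemma lipschitz_borel_measurable:
  fixes g :: "('i \<Rightarrow> real) \<Rightarrow> real"
  assumes "finite T" "0 \<le> K"
    and g: "\<And>y y'. \<bar>g y - g y'\<bar> \<le> K * (\<Sum>x\<in>T. \<bar>y x - y' x\<bar>)"
    and V: "\<And>x. x \<in> T \<Longrightarrow> (\<lambda>\<omega>. V \<omega> x) \<in> borel_measurable M"
  shows "(\<lambda>\<omega>. g (V \<omega>)) \<in> borel_measurable M"
  by (rule borel_measurable_LIMSEQ_real[OF lipschitz_approx_converges[OF assms(1,2) g]])
     (intro borel_measurable_sum borel_measurable_times borel_measurable_const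
        trig_sum_measurable[OF trig_sum_sin_bernstein_prod] assms)

section \<open>A maximal inequality along chains of index sets\<close>

text \<open>The tangent line of a convex power lies below it; for \<open>p = 4\<close> the remainder
  is exhibited as a square times a sum of squares.\<close>

lemma even_power_tangent:
  fixes s r :: real
  assumes "p \<in> {2, 4 :: nat}"
  shows "s ^ p + real p * s ^ (p - 1) * r \<le> (s + r) ^ p"
proof -
  have "(s + r)\<^sup>2 = s\<^sup>2 + 2 * s * r + r\<^sup>2"
    by (simp add: power2_eq_square algebra_simps)
  moreover have "(s + r) ^ 4 = s ^ 4 + 4 * s ^ 3 * r + r\<^sup>2 * (2 * s\<^sup>2 + (2 * s + r)\<^sup>2)"
    by (simp add: power2_eq_square power4_eq_xxxx power3_eq_cube algebra_simps)
  moreover have "0 \<le> r\<^sup>2 * (2 * s\<^sup>2 + (2 * s + r)\<^sup>2)" "0 \<le> r\<^sup>2"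
    by simp_all
  ultimately show ?thesis
    using assms by auto
qed

text \<open>
  First passage decomposition: \<open>A C\<close> is the event that \<open>C\<close> is the first set of the chain whose sum is
  large; on it the sum over the rest of \<open>U\<close> is independent of the past and has mean 0, so
  convexity bounds the \<open>p\<close>-th moment over \<open>C\<close> by that over \<open>U\<close>.
\<close>

lemma (in prob_space) chain_maximal_inequality:
  fixes \<eta> :: "nat \<Rightarrow> 'a \<Rightarrow> real"
  assumes indep: "indep_vars (\<lambda>_. borel) \<eta> UNIV"
    and int: "\<And>i. integrable M (\<eta> i)" and mean: "\<And>i. expectation (\<eta> i) = 0"
    and p: "p \<in> {2, 4 :: nat}"
    and intp: "\<And>C. C \<subseteq> U \<Longrightarrow> integrable M (\<lambda>\<omega>. (\<Sum>i\<in>C. \<eta> i \<omega>) ^ p)"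
    and U: "finite U" and CU: "\<C> \<subseteq> Pow U" and chain: "\<And>C D. C \<in> \<C> \<Longrightarrow> D \<in> \<C> \<Longrightarrow> C \<subseteq> D \<or> D \<subseteq> C"
    and "0 < c"
  shows "prob {\<omega>\<in>space M. \<exists>C\<in>\<C>. c < \<bar>\<Sum>i\<in>C. \<eta> i \<omega>\<bar>} \<le> expectation (\<lambda>\<omega>. (\<Sum>i\<in>U. \<eta> i \<omega>) ^ p) / c ^ p"
proof -
  define S where "S C \<omega> = (\<Sum>i\<in>C. \<eta> i \<omega>)" for C \<omega>
  define A where "A C = {\<omega>\<in>space M. c < \<bar>S C \<omega>\<bar> \<and> (\<forall>D\<in>\<C>. D \<subset> C \<longrightarrow> \<bar>S D \<omega>\<bar> \<le> c)}" for C
  have [measurable]: "\<eta> i \<in> borel_measurable M" for i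
    using int by auto
  have [measurable]: "S C \<in> borel_measurable M" for C
    unfolding S_def by measurable
  have fin: "finite \<C>"
    using CU U finite_subset by blast
  then have [measurable]: "A C \<in> sets M" for C
    unfolding A_def by (measurable, auto simp: countable_finite)
  have even: "even p" "p \<noteq> 0" "even (p - 2)" "1 \<le> p"
    using p by auto
  have cover: "{\<omega>\<in>space M. \<exists>C\<in>\<C>. c < \<bar>S C \<omega>\<bar>} = (\<Union>C\<in>\<C>. A C)"
  proof (intro equalityI subsetI)
    fix \<omega> assume "\<omega> \<in> {\<omega>\<in>space M. \<exists>C\<in>\<C>. c < \<bar>S C \<omega>\<bar>}"
    then have \<omega>: "\<omega> \<in> space M" and ne: "{C\<in>\<C>. c < \<bar>S C \<omega>\<bar>} \<noteq> {}"
      by auto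
    \<comment> \<open>A minimal set among those with a large sum; along the chain it is the first
      passage.\<close>
    obtain C where C: "C \<in> {C\<in>\<C>. c < \<bar>S C \<omega>\<bar>}" and min: "\<And>D. D \<in> {C\<in>\<C>. c < \<bar>S C \<omega>\<bar>} \<Longrightarrow> D \<subseteq> C \<Longrightarrow> C = D"
      using finite_has_minimal[OF _ ne] fin by auto
    have "\<omega> \<in> A C"
      unfolding A_def using \<omega> C min by (auto simp: not_less[symmetric])
    then show "\<omega> \<in> (\<Union>C\<in>\<C>. A C)"
      using C by auto
  qed (auto simp: A_def)
  have disj: "disjoint_family_on A \<C>"
    unfolding disjoint_family_on_def
  proof (intro ballI impI)
    fix C D assume "C \<in> \<C>" "D \<in> \<C>" "C \<noteq> D"
    \<comment> \<open>If both were first passage events, the sum over the smaller set would be large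
      and small at once.\<close>
    then show "A C \<inter> A D = {}"
      using chain[of C D] by (fastforce simp: A_def)
  qed
  have step: "c ^ p * prob (A C) \<le> expectation (\<lambda>\<omega>. S U \<omega> ^ p * indicator (A C) \<omega>)" if C: "C \<in> \<C>" for C
  proof -
    \<comment> \<open>Up to the factor \<open>p\<close>, the slope of the tangent at
      \<open>S C\<close>, restricted to the first passage event. The event is spelled out with
      \<open>of_bool\<close>: without reference to \<open>space M\<close> it is a function of the
      variables with index in \<open>C\<close> alone.\<close>
    define q where "q \<omega> = S C \<omega> ^ (p - 1) * of_bool (c < \<bar>S C \<omega>\<bar> \<and> (\<forall>D\<in>\<C>. D \<subset> C \<longrightarrow> \<bar>S D \<omega>\<bar> \<le> c))" for \<omega>
    have q_eq: "q \<omega> = S C \<omega> ^ (p - 1) * indicator (A C) \<omega>" if "\<omega> \<in> space M" for \<omega>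
      using that by (auto simp: q_def A_def indicator_def)
    have CU': "C \<subseteq> U" using C CU by auto
    have SU: "S U \<omega> = S C \<omega> + S (U - C) \<omega>" for \<omega>
      unfolding S_def using CU' U by (simp add: sum.subset_diff[of C U] add.commute)
    have intS: "integrable M (\<lambda>\<omega>. S D \<omega> ^ p)" if "D \<subseteq> U" for D
      using intp[OF that] by (simp add: S_def)
    have intR: "integrable M (S (U - C))"
      unfolding S_def using int by auto
    have meanR: "expectation (S (U - C)) = 0"
      unfolding S_def using int mean by simp
    have [measurable]: "q \<in> borel_measurable M"
      by (subst measurable_cong[OF q_eq]) measurable
    have "integrable M (\<lambda>\<omega>. 1 + S C \<omega> ^ p)"
      using intS[OF CU'] by simp
    then have intq: "integrable M q"
    proof (rule Bochner_Integration.integrable_bound)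
      \<comment> \<open>The power \<open>p - 1\<close> is dominated by \<open>1 + s ^ p\<close>, so
        \<open>q\<close> inherits integrability from the \<open>p\<close>-th moment.\<close>
      have b: "\<bar>s ^ (p - 1)\<bar> \<le> 1 + s ^ p" for s :: real
      proof (cases "\<bar>s\<bar> \<le> 1")
        case True
        then have "\<bar>s\<bar> ^ (p - 1) \<le> 1" by (intro power_le_one) auto
        then show ?thesis using zero_le_even_power[OF even(1), of s] by (simp add: power_abs)
      next
        case False
        then have "\<bar>s\<bar> ^ (p - 1) \<le> \<bar>s\<bar> ^ p" by (intro power_increasing) auto
        then show ?thesis using even by (simp add: power_abs power_even_abs)
      qed
      have "norm (q \<omega>) \<le> norm (1 + S C \<omega> ^ p)" for \<omega>
        using b[of "S C \<omega>"] zero_le_even_power[OF even(1), of "S C \<omega>"]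
        by (auto simp: q_def indicator_def)
      then show "AE \<omega> in M. norm (q \<omega>) \<le> norm (1 + S C \<omega> ^ p)" by simp
    qed simp
    have "indep_var borel q borel (S (U - C))"
    proof -
      define T where "T D y = (\<Sum>i\<in>D. y i)" for D and y :: "nat \<Rightarrow> real"
      \<comment> \<open>\<open>q\<close> as a function of the coordinates in \<open>C\<close>. The
        remaining sum uses the coordinates in \<open>U - C\<close>, which gives the
        independence.\<close>
      define Q where "Q y = T C y ^ (p - 1) * of_bool (c < \<bar>T C y\<bar> \<and> (\<forall>D\<in>\<C>. D \<subset> C \<longrightarrow> \<bar>T D y\<bar> \<le> c))" for y
      have T: "T D \<in> borel_measurable (PiM C (\<lambda>_. borel))" if "D \<subseteq> C" for D C
        unfolding T_def using that by (intro borel_measurable_sum measurable_component_singleton) auto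
      note [measurable] = T[OF subset_refl]
      have "Measurable.pred (PiM C (\<lambda>_. borel)) (\<lambda>y. \<forall>D\<in>{D\<in>\<C>. D \<subset> C}. \<bar>T D y\<bar> \<le> c)"
      proof (rule pred_intros_finite)
        show "finite {D \<in> \<C>. D \<subset> C}" using fin by simp
        fix D assume "D \<in> {D \<in> \<C>. D \<subset> C}"
        then have [measurable]: "T D \<in> borel_measurable (PiM C (\<lambda>_. borel))"
          by (intro T) auto
        show "Measurable.pred (PiM C (\<lambda>_. borel)) (\<lambda>y. \<bar>T D y\<bar> \<le> c)"
          by measurable
      qed
      moreover have "(\<lambda>y. \<forall>D\<in>{D\<in>\<C>. D \<subset> C}. \<bar>T D y\<bar> \<le> c) = (\<lambda>y. \<forall>D\<in>\<C>. D \<subset> C \<longrightarrow> \<bar>T D y\<bar> \<le> c)"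
        by auto
      ultimately have [measurable]: "Measurable.pred (PiM C (\<lambda>_. borel)) (\<lambda>y. \<forall>D\<in>\<C>. D \<subset> C \<longrightarrow> \<bar>T D y\<bar> \<le> c)"
        by simp
      have Q: "Q \<in> borel_measurable (PiM C (\<lambda>_. borel))"
        unfolding Q_def by measurable
      have "indep_var borel (Q \<circ> (\<lambda>\<omega>. restrict (\<lambda>i. \<eta> i \<omega>) C)) borel (T (U - C) \<circ> (\<lambda>\<omega>. restrict (\<lambda>i. \<eta> i \<omega>) (U - C)))"
        by (rule indep_var_compose[OF indep_var_restrict[OF indep] Q T]) auto
      moreover have res: "T D (restrict (\<lambda>i. \<eta> i \<omega>) E) = S D \<omega>" if "D \<subseteq> E" for D E \<omega>
        unfolding T_def S_def using that by (intro sum.cong) auto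
      have "(T (U - C) \<circ> (\<lambda>\<omega>. restrict (\<lambda>i. \<eta> i \<omega>) (U - C))) = S (U - C)"
        by (simp add: fun_eq_iff res)
      moreover have "(Q \<circ> (\<lambda>\<omega>. restrict (\<lambda>i. \<eta> i \<omega>) C)) = q"
        by (auto simp: fun_eq_iff Q_def q_def res psubset_eq)
      ultimately show ?thesis by simp
    qed
    then have "expectation (\<lambda>\<omega>. q \<omega> * S (U - C) \<omega>) = 0" "integrable M (\<lambda>\<omega>. q \<omega> * S (U - C) \<omega>)"
      using indep_var_lebesgue_integral[OF _ intq intR] indep_var_integrable[OF _ intq intR] meanR by auto
    note q0 = this
    have ind: "integrable M (\<lambda>\<omega>. S D \<omega> ^ p * indicator (A C) \<omega>)" if "D \<subseteq> U" for D
      using intS[OF that] by (intro integrable_real_mult_indicator) auto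
    have "c ^ p * prob (A C) = expectation (\<lambda>\<omega>. c ^ p * indicator (A C) \<omega>)"
      by simp
    also have "\<dots> \<le> expectation (\<lambda>\<omega>. S C \<omega> ^ p * indicator (A C) \<omega>)"
    proof (rule integral_mono)
      fix \<omega> assume "\<omega> \<in> space M"
      show "c ^ p * indicator (A C) \<omega> \<le> S C \<omega> ^ p * indicator (A C) \<omega>"
      proof (cases "\<omega> \<in> A C")
        case True
        then have "c ^ p \<le> \<bar>S C \<omega>\<bar> ^ p"
          using \<open>0 < c\<close> by (intro power_mono) (auto simp: A_def)
        then show ?thesis using True even by (simp add: power_even_abs)
      qed simp
    next
      have "integrable M (indicat_real (A C))"
        by (rule integrable_const_bound[where B = 1]) auto
      then show "integrable M (\<lambda>\<omega>. c ^ p * indicat_real (A C) \<omega>)" by simp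
    qed (use ind CU' in auto)
    \<comment> \<open>The added term has mean zero; it completes the integrand to the tangent at
      \<open>S C\<close>, evaluated at \<open>S U\<close>.\<close>
    also have "\<dots> = expectation (\<lambda>\<omega>. S C \<omega> ^ p * indicator (A C) \<omega> + real p * (q \<omega> * S (U - C) \<omega>))"
      using ind CU' q0 by simp
    also have "\<dots> \<le> expectation (\<lambda>\<omega>. S U \<omega> ^ p * indicator (A C) \<omega>)"
    proof (rule integral_mono)
      fix \<omega> assume "\<omega> \<in> space M"
      show "S C \<omega> ^ p * indicator (A C) \<omega> + real p * (q \<omega> * S (U - C) \<omega>) \<le> S U \<omega> ^ p * indicator (A C) \<omega>"
        using even_power_tangent[OF p, of "S C \<omega>" "S (U - C) \<omega>"]
        \<open>\<omega> \<in> space M\<close>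
        by (simp add: q_eq SU indicator_def mult_ac)
    qed (use ind CU' q0 in auto)
    finally show ?thesis .
  qed
  have SUp: "integrable M (\<lambda>\<omega>. S U \<omega> ^ p)"
    using intp[of U] by (simp add: S_def)
  have "c ^ p * prob (\<Union>C\<in>\<C>. A C) = (\<Sum>C\<in>\<C>. c ^ p * prob (A C))"
    using fin disj by (subst finite_measure_finite_Union) (auto simp: sum_distrib_left)
  also have "\<dots> \<le> (\<Sum>C\<in>\<C>. expectation (\<lambda>\<omega>. S U \<omega> ^ p * indicator (A C) \<omega>))"
    by (intro sum_mono step)
  also have "\<dots> = expectation (\<lambda>\<omega>. \<Sum>C\<in>\<C>. S U \<omega> ^ p * indicator (A C) \<omega>)"
    by (rule Bochner_Integration.integral_sum[symmetric])
       (use integrable_mult_indicator[OF _ SUp] in \<open>simp add: mult.commute\<close>)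
  also have "\<dots> \<le> expectation (\<lambda>\<omega>. S U \<omega> ^ p)"
  proof (rule integral_mono)
    fix \<omega> assume "\<omega> \<in> space M"
    have "(\<Sum>C\<in>\<C>. S U \<omega> ^ p * indicator (A C) \<omega>) = S U \<omega> ^ p * indicator (\<Union>C\<in>\<C>. A C) \<omega>"
      unfolding indicator_UN_disjoint[OF fin disj] by (simp add: sum_distrib_left)
    also have "\<dots> \<le> S U \<omega> ^ p"
      using zero_le_even_power[OF even(1), of "S U \<omega>"] by (simp add: indicator_def)
    finally show "(\<Sum>C\<in>\<C>. S U \<omega> ^ p * indicator (A C) \<omega>) \<le> S U \<omega> ^ p" .
  qed (use SUp integrable_mult_indicator[OF _ SUp] in \<open>auto simp: mult.commute\<close>)
  finally show ?thesis
    using \<open>0 < c\<close> unfolding cover[unfolded S_def] by (simp add: S_def field_simps)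
qed

section \<open>Second and fourth moments of independent sums\<close>

lemma (in prob_space) second_moment_indep_sum:
  fixes \<eta> :: "nat \<Rightarrow> 'a \<Rightarrow> real"
  assumes indep: "indep_vars (\<lambda>_. borel) \<eta> UNIV"
    and int: "\<And>i. integrable M (\<eta> i)" and mean: "\<And>i. expectation (\<eta> i) = 0"
    and int2: "\<And>i. integrable M (\<lambda>\<omega>. (\<eta> i \<omega>)\<^sup>2)"
    and "finite C"
  shows "integrable M (\<lambda>\<omega>. (\<Sum>i\<in>C. \<eta> i \<omega>)\<^sup>2) \<and>
    expectation (\<lambda>\<omega>. (\<Sum>i\<in>C. \<eta> i \<omega>)\<^sup>2) = (\<Sum>i\<in>C. expectation (\<lambda>\<omega>. (\<eta> i \<omega>)\<^sup>2))"
  using \<open>finite C\<close>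
proof induction
  case (insert j C)
  let ?S = "\<lambda>\<omega>. \<Sum>i\<in>C. \<eta> i \<omega>"
  have ind: "indep_var borel (\<eta> j) borel ?S"
    using insert by (intro indep_vars_sum indep_vars_subset[OF indep]) auto
  have S: "integrable M ?S"
    using int by auto
  note p = indep_var_lebesgue_integral[OF ind int S] indep_var_integrable[OF ind int S]
  have eq: "(\<Sum>i\<in>insert j C. \<eta> i \<omega>)\<^sup>2 = (\<eta> j \<omega>)\<^sup>2 + (?S \<omega>)\<^sup>2 + 2 * (\<eta> j \<omega> * ?S \<omega>)" for \<omega>
    using insert by (simp add: power2_eq_square algebra_simps)
  show ?case
    unfolding eq using insert p int2 mean by simp
qed simp

text \<open>Mixed terms containing a first power vanish by independence and mean zero. Passing from
  \<open>k\<close> to \<open>k + 1\<close> indices thus adds at most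
  \<open>6 * B ^ 4 * k + B ^ 4\<close>, which fits into the increase
  \<open>6 * B ^ 4 * k + 3 * B ^ 4\<close> of the bound.\<close>

lemma (in prob_space) fourth_moment_indep_sum:
  fixes \<eta> :: "nat \<Rightarrow> 'a \<Rightarrow> real"
  assumes indep: "indep_vars (\<lambda>_. borel) \<eta> UNIV"
    and bnd: "\<And>i \<omega>. \<bar>\<eta> i \<omega>\<bar> \<le> B" and mean: "\<And>i. expectation (\<eta> i) = 0"
    and "finite C"
  shows "expectation (\<lambda>\<omega>. (\<Sum>i\<in>C. \<eta> i \<omega>) ^ 4) \<le> 3 * B ^ 4 * (real (card C))\<^sup>2"
  using \<open>finite C\<close>
proof induction
  case (insert j C)
  define S where "S \<omega> = (\<Sum>i\<in>C. \<eta> i \<omega>)" for \<omega>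
  have rv [measurable]: "\<eta> i \<in> borel_measurable M" for i
    using indep by (simp add: indep_vars_def2)
  have [measurable]: "S \<in> borel_measurable M"
    unfolding S_def by measurable
  have B0: "0 \<le> B" using bnd[of 0 undefined] by linarith
  have ind: "indep_var borel (\<eta> j) borel S"
    unfolding S_def using insert by (intro indep_vars_sum indep_vars_subset[OF indep]) auto
  have Sb: "\<bar>S \<omega>\<bar> \<le> real (card C) * B" for \<omega>
    unfolding S_def using bnd by (intro order_trans[OF sum_abs] sum_bounded_above)
  have iS: "integrable M (\<lambda>\<omega>. S \<omega> ^ a)" for a
    using Sb by (intro integrable_const_bound[where B = "(real (card C) * B) ^ a"])
      (auto simp: power_abs intro!: power_mono)
  have i\<eta>: "integrable M (\<lambda>\<omega>. \<eta> i \<omega> ^ a)" for a i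
    using bnd by (intro integrable_const_bound[where B = "B ^ a"])
      (auto simp: power_abs intro!: power_mono)
  have p: "expectation (\<lambda>\<omega>. \<eta> j \<omega> ^ b * S \<omega> ^ a) = expectation (\<lambda>\<omega>. \<eta> j \<omega> ^ b) * expectation (\<lambda>\<omega>. S \<omega> ^ a)"
    "integrable M (\<lambda>\<omega>. \<eta> j \<omega> ^ b * S \<omega> ^ a)" for a b
  proof -
    have "indep_var borel ((\<lambda>x. x ^ b) \<circ> \<eta> j) borel ((\<lambda>x. x ^ a) \<circ> S)"
      by (rule indep_var_compose[OF ind]) auto
    then have "indep_var borel (\<lambda>\<omega>. \<eta> j \<omega> ^ b) borel (\<lambda>\<omega>. S \<omega> ^ a)"
      by (simp add: comp_def)
    from indep_var_lebesgue_integral[OF this i\<eta> iS] indep_var_integrable[OF this i\<eta> iS]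
    show "expectation (\<lambda>\<omega>. \<eta> j \<omega> ^ b * S \<omega> ^ a) = expectation (\<lambda>\<omega>. \<eta> j \<omega> ^ b) * expectation (\<lambda>\<omega>. S \<omega> ^ a)"
      "integrable M (\<lambda>\<omega>. \<eta> j \<omega> ^ b * S \<omega> ^ a)" by auto
  qed
  have m\<eta>: "expectation (\<lambda>\<omega>. \<eta> i \<omega> ^ a) \<le> B ^ a" for i a
  proof -
    have "expectation (\<lambda>\<omega>. \<eta> i \<omega> ^ a) \<le> expectation (\<lambda>\<omega>. B ^ a)"
    proof (intro integral_mono i\<eta>)
      fix \<omega>
      have "\<eta> i \<omega> ^ a \<le> \<bar>\<eta> i \<omega>\<bar> ^ a"
        by (simp flip: power_abs)
      also have "\<dots> \<le> B ^ a"
        using bnd by (intro power_mono) auto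
      finally show "\<eta> i \<omega> ^ a \<le> B ^ a" .
    qed simp
    then show ?thesis by (simp add: prob_space)
  qed
  have mS: "expectation S = 0"
    unfolding S_def using mean i\<eta>[of _ 1] by simp
  have S2: "expectation (\<lambda>\<omega>. (S \<omega>)\<^sup>2) \<le> real (card C) * B\<^sup>2"
    using second_moment_indep_sum[OF indep _ mean _ \<open>finite C\<close>] i\<eta>[of _ 1] i\<eta>[of _ 2] m\<eta>[of _ 2]
    unfolding S_def by (simp add: sum_bounded_above)
  \<comment> \<open>First powers are written out so that every mixed term has the shape of the
    product rule \<open>p\<close>.\<close>
  have eq: "(\<Sum>i\<in>insert j C. \<eta> i \<omega>) ^ 4 = S \<omega> ^ 4 + 4 * (\<eta> j \<omega> ^ 1 * S \<omega> ^ 3) + 6 * (\<eta> j \<omega> ^ 2 * S \<omega> ^ 2)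
      + 4 * (\<eta> j \<omega> ^ 3 * S \<omega> ^ 1) + \<eta> j \<omega> ^ 4" for \<omega>
    using insert by (simp add: S_def[symmetric] power2_eq_square power3_eq_cube power4_eq_xxxx algebra_simps)
  have "expectation (\<lambda>\<omega>. (\<Sum>i\<in>insert j C. \<eta> i \<omega>) ^ 4)
      = expectation (\<lambda>\<omega>. S \<omega> ^ 4) + 6 * (expectation (\<lambda>\<omega>. \<eta> j \<omega> ^ 2) * expectation (\<lambda>\<omega>. S \<omega> ^ 2)) + expectation (\<lambda>\<omega>. \<eta> j \<omega> ^ 4)"
    unfolding eq using iS i\<eta> p(2) p(2)[of 1 3] p(2)[of 3 1] p(1)[of 1 3] p(1)[of 2 2] p(1)[of 3 1] mS mean by simp
  also have "\<dots> \<le> 3 * B ^ 4 * (real (card C))\<^sup>2 + 6 * (B ^ 2 * (real (card C) * B\<^sup>2)) + B ^ 4"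
    using insert.IH S2 m\<eta> B0 unfolding S_def[symmetric]
    by (intro add_mono mult_left_mono mult_mono integral_nonneg) auto
  also have "\<dots> \<le> 3 * B ^ 4 * (real (card (insert j C)))\<^sup>2"
  proof -
    have "3 * B ^ 4 * (real (card (insert j C)))\<^sup>2
        = 3 * B ^ 4 * (real (card C))\<^sup>2 + 6 * (B ^ 2 * (real (card C) * B\<^sup>2)) + 3 * B ^ 4"
      using insert.hyps by (simp add: power2_eq_square power4_eq_xxxx algebra_simps)
    moreover have "0 \<le> B ^ 4" by simp
    ultimately show ?thesis by linarith
  qed
  finally show ?case .
qed simp

section \<open>Sums of multipliers\<close>

locale multipliers = prob_space M for M :: "'a measure" +
  fixes \<xi> :: "nat \<Rightarrow> 'a \<Rightarrow> real"
  assumes xi_indep: "indep_vars (\<lambda>_. borel) \<xi> UNIV"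
    and xi_distr: "\<And>i j. distr M borel (\<xi> i) = distr M borel (\<xi> j)"
    and xi_int [simp]: "\<And>i. integrable M (\<xi> i)"
    and xi_mean [simp]: "\<And>i. expectation (\<xi> i) = 0"
    and xi_square_int [simp]: "\<And>i. integrable M (\<lambda>\<omega>. (\<xi> i \<omega>)\<^sup>2)"
    and xi_second_moment [simp]: "\<And>i. expectation (\<lambda>\<omega>. (\<xi> i \<omega>)\<^sup>2) = 1"
begin

lemma xi_measurable [measurable]: "\<xi> i \<in> borel_measurable M"
  using xi_indep by (simp add: indep_vars_def2)

lemma xi_expectation_cong:
  fixes f :: "real \<Rightarrow> real"
  assumes [measurable]: "f \<in> borel_measurable borel"
  shows "expectation (\<lambda>\<omega>. f (\<xi> i \<omega>)) = expectation (\<lambda>\<omega>. f (\<xi> j \<omega>))"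
  using xi_distr[of i j] integral_distr[of "\<xi> i" M borel f] integral_distr[of "\<xi> j" M borel f]
  by simp

lemma weighted_second_moment:
  assumes "finite C"
  shows "integrable M (\<lambda>\<omega>. (\<Sum>i\<in>C. c i * \<xi> i \<omega>)\<^sup>2)"
    and "expectation (\<lambda>\<omega>. (\<Sum>i\<in>C. c i * \<xi> i \<omega>)\<^sup>2) = (\<Sum>i\<in>C. (c i)\<^sup>2)"
proof -
  have "indep_vars (\<lambda>_. borel) (\<lambda>i \<omega>. c i * \<xi> i \<omega>) UNIV"
    by (rule indep_vars_compose2[OF xi_indep]) auto
  from second_moment_indep_sum[OF this _ _ _ assms]
  show "integrable M (\<lambda>\<omega>. (\<Sum>i\<in>C. c i * \<xi> i \<omega>)\<^sup>2)"
    and "expectation (\<lambda>\<omega>. (\<Sum>i\<in>C. c i * \<xi> i \<omega>)\<^sup>2) = (\<Sum>i\<in>C. (c i)\<^sup>2)"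
    by (auto simp: power_mult_distrib)
qed

text \<open>At each point the truncated square is eventually zero, and it is dominated by the square
  itself.\<close>

lemma truncated_tail:
  assumes "0 < \<tau>"
  obtains B :: real where "0 < B" "expectation (\<lambda>\<omega>. (\<xi> 0 \<omega>)\<^sup>2 * of_bool (B < \<bar>\<xi> 0 \<omega>\<bar>)) \<le> \<tau>"
proof -
  have "(\<lambda>k. expectation (\<lambda>\<omega>. (\<xi> 0 \<omega>)\<^sup>2 * of_bool (real k < \<bar>\<xi> 0 \<omega>\<bar>))) \<longlonglongrightarrow> expectation (\<lambda>_. 0)"
  proof (rule integral_dominated_convergence)
    have "(\<lambda>k. x\<^sup>2 * of_bool (real k < \<bar>x\<bar>)) \<longlonglongrightarrow> 0" for x :: real
    proof (rule tendsto_eventually)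
      show "\<forall>\<^sub>F k in sequentially. x\<^sup>2 * of_bool (real k < \<bar>x\<bar>) = 0"
        using eventually_ge_at_top[of "nat \<lceil>\<bar>x\<bar>\<rceil>"] by eventually_elim (auto simp: nat_le_iff ceiling_le_iff)
    qed
    then show "AE \<omega> in M. (\<lambda>k. (\<xi> 0 \<omega>)\<^sup>2 * of_bool (real k < \<bar>\<xi> 0 \<omega>\<bar>)) \<longlonglongrightarrow> 0"
      by simp
    show "integrable M (\<lambda>\<omega>. (\<xi> 0 \<omega>)\<^sup>2)" by simp
  qed auto
  from order_tendstoD(2)[OF this[simplified] assms]
  obtain k0 where k0: "\<And>k. k0 \<le> k \<Longrightarrow> expectation (\<lambda>\<omega>. (\<xi> 0 \<omega>)\<^sup>2 * of_bool (real k < \<bar>\<xi> 0 \<omega>\<bar>)) < \<tau>"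
    unfolding eventually_sequentially by blast
  show ?thesis
    by (rule that[of "real (Suc k0)"]) (use k0[of "Suc k0"] in auto)
qed

text \<open>
  Truncation splits the multipliers into a bounded part, to which the fourth moment bound applies,
  and a part of small variance. The quadratic dependence on \<open>card (U j)\<close> is what makes the bound small
  when the index set is cut into many small pieces.
\<close>

lemma multiplier_chains_bound:
  assumes "0 < \<epsilon>" "0 < \<tau>"
  obtains K :: real where "0 \<le> K"
    and "\<And>n J (U :: nat \<Rightarrow> nat set) (\<C> :: nat \<Rightarrow> nat set set). finite J \<Longrightarrow> disjoint_family_on U J \<Longrightarrow>
      (\<And>j. j \<in> J \<Longrightarrow> U j \<subseteq> {..<n}) \<Longrightarrow> (\<And>j. j \<in> J \<Longrightarrow> \<C> j \<subseteq> Pow (U j)) \<Longrightarrow>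
      (\<And>j C D. j \<in> J \<Longrightarrow> C \<in> \<C> j \<Longrightarrow> D \<in> \<C> j \<Longrightarrow> C \<subseteq> D \<or> D \<subseteq> C) \<Longrightarrow> 0 < n \<Longrightarrow>
      prob {\<omega>\<in>space M. \<exists>j\<in>J. \<exists>C\<in>\<C> j. 2 * \<epsilon> * sqrt (real n) < \<bar>\<Sum>i\<in>C. \<xi> i \<omega>\<bar>}
        \<le> (\<Sum>j\<in>J. K * (real (card (U j)) / real n)\<^sup>2) + \<tau>"
proof -
  \<comment> \<open>The tail bound is set so that Chebyshev's inequality at level
    \<open>\<epsilon> * sqrt n\<close> costs \<open>\<tau> / n\<close> per index, hence at most
    \<open>\<tau>\<close> in total.\<close>
  obtain B :: real where B: "0 < B" and tail: "expectation (\<lambda>\<omega>. (\<xi> 0 \<omega>)\<^sup>2 * of_bool (B < \<bar>\<xi> 0 \<omega>\<bar>)) \<le> \<tau> * \<epsilon>\<^sup>2"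
    using truncated_tail[of "\<tau> * \<epsilon>\<^sup>2"] assms by auto
  define t where "t x = x * of_bool (\<bar>x\<bar> \<le> B)" for x :: real
  define a where "a = expectation (\<lambda>\<omega>. t (\<xi> 0 \<omega>))"
  \<comment> \<open>Shifting by the truncated mean centres both parts without changing their
    sum.\<close>
  define \<eta> where "\<eta> i \<omega> = t (\<xi> i \<omega>) - a" for i \<omega>
  define \<zeta> where "\<zeta> i \<omega> = \<xi> i \<omega> - t (\<xi> i \<omega>) + a" for i \<omega>
  have t [measurable]: "t \<in> borel_measurable borel"
    unfolding t_def by measurable
  have tb: "\<bar>t x\<bar> \<le> B" for x
    using B by (simp add: t_def)
  have ti: "integrable M (\<lambda>\<omega>. t (\<xi> i \<omega>))" for i
    by (rule integrable_const_bound[where B = B]) (auto simp: tb)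
  have ta: "expectation (\<lambda>\<omega>. t (\<xi> i \<omega>)) = a" for i
    unfolding a_def by (rule xi_expectation_cong) simp
  have ab: "\<bar>a\<bar> \<le> B"
  proof -
    have "\<bar>a\<bar> \<le> expectation (\<lambda>\<omega>. \<bar>t (\<xi> 0 \<omega>)\<bar>)"
      unfolding a_def by (rule integral_abs_bound)
    also have "\<dots> \<le> expectation (\<lambda>_. B)"
      using ti tb by (intro integral_mono) auto
    finally show ?thesis by (simp add: prob_space)
  qed
  have \<eta>b: "\<bar>\<eta> i \<omega>\<bar> \<le> 2 * B" for i \<omega>
    using tb[of "\<xi> i \<omega>"] ab unfolding \<eta>_def by linarith
  have \<eta>ind: "indep_vars (\<lambda>_. borel) \<eta> UNIV"
    unfolding \<eta>_def by (rule indep_vars_compose2[OF xi_indep]) simp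
  have \<zeta>ind: "indep_vars (\<lambda>_. borel) \<zeta> UNIV"
    unfolding \<zeta>_def by (rule indep_vars_compose2[OF xi_indep]) simp
  have [measurable]: "\<eta> i \<in> borel_measurable M" "\<zeta> i \<in> borel_measurable M" for i
    unfolding \<eta>_def \<zeta>_def by measurable
  have \<eta>i: "integrable M (\<eta> i)" and \<zeta>i: "integrable M (\<zeta> i)" for i
    unfolding \<eta>_def \<zeta>_def using ti by auto
  have \<eta>m: "expectation (\<eta> i) = 0" and \<zeta>m: "expectation (\<zeta> i) = 0" for i
    unfolding \<eta>_def \<zeta>_def using ti by (simp_all add: ta prob_space)
  have \<zeta>2: "integrable M (\<lambda>\<omega>. (\<zeta> i \<omega>)\<^sup>2)" "expectation (\<lambda>\<omega>. (\<zeta> i \<omega>)\<^sup>2) \<le> \<tau> * \<epsilon>\<^sup>2" for i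
  proof -
    let ?r = "\<lambda>x. x\<^sup>2 * of_bool (B < \<bar>x\<bar>) :: real"
    have sq: "(x - t x)\<^sup>2 = ?r x" for x
      by (auto simp: t_def)
    have ri: "integrable M (\<lambda>\<omega>. ?r (\<xi> i \<omega>))"
      by (rule Bochner_Integration.integrable_bound[OF xi_square_int[of i]]) auto
    have eq: "(\<zeta> i \<omega>)\<^sup>2 = ?r (\<xi> i \<omega>) + 2 * a * (\<xi> i \<omega> - t (\<xi> i \<omega>)) + a\<^sup>2" for \<omega>
      unfolding sq[symmetric] \<zeta>_def by (simp add: power2_eq_square algebra_simps)
    show "integrable M (\<lambda>\<omega>. (\<zeta> i \<omega>)\<^sup>2)"
      unfolding eq using ri ti by simp
    \<comment> \<open>The cross term contributes \<open>- 2 * a\<^sup>2\<close>, because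
      \<open>\<xi> i - t (\<xi> i)\<close> has mean \<open>- a\<close>; centring can therefore only
      lower the second moment.\<close>
    have "expectation (\<lambda>\<omega>. (\<zeta> i \<omega>)\<^sup>2) = expectation (\<lambda>\<omega>. ?r (\<xi> i \<omega>)) - a\<^sup>2"
      unfolding eq using ri ti by (simp add: ta prob_space power2_eq_square)
    also have "\<dots> \<le> expectation (\<lambda>\<omega>. ?r (\<xi> 0 \<omega>))"
      using xi_expectation_cong[of ?r i 0] by simp
    finally show "expectation (\<lambda>\<omega>. (\<zeta> i \<omega>)\<^sup>2) \<le> \<tau> * \<epsilon>\<^sup>2"
      using tail by simp
  qed
  \<comment> \<open>The fourth moment constant for variables bounded by \<open>2 * B\<close>,
    divided by the fourth power of the level without its factor \<open>sqrt n\<close>.\<close>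
  define K where "K = 3 * (2 * B) ^ 4 / \<epsilon> ^ 4"
  show ?thesis
  proof (rule that[of K])
    show "0 \<le> K" unfolding K_def by simp
    fix n J and U :: "nat \<Rightarrow> nat set" and \<C> :: "nat \<Rightarrow> nat set set"
    assume J: "finite J" and disj: "disjoint_family_on U J" and U: "\<And>j. j \<in> J \<Longrightarrow> U j \<subseteq> {..<n}"
      and CU: "\<And>j. j \<in> J \<Longrightarrow> \<C> j \<subseteq> Pow (U j)"
      and chain: "\<And>j C D. j \<in> J \<Longrightarrow> C \<in> \<C> j \<Longrightarrow> D \<in> \<C> j \<Longrightarrow> C \<subseteq> D \<or> D \<subseteq> C" and n: "0 < n"
    define c where "c = \<epsilon> * sqrt (real n)"
    have c: "0 < c" using assms n by (simp add: c_def)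
    have Uf: "finite (U j)" if "j \<in> J" for j
      using U[OF that] finite_subset by blast
    have Cc: "countable (\<C> j)" if "j \<in> J" for j
      using CU[OF that] Uf[OF that] by (meson finite_Pow_iff finite_subset countable_finite)
    define A1 where "A1 j = {\<omega>\<in>space M. \<exists>C\<in>\<C> j. c < \<bar>\<Sum>i\<in>C. \<eta> i \<omega>\<bar>}" for j
    define A2 where "A2 j = {\<omega>\<in>space M. \<exists>C\<in>\<C> j. c < \<bar>\<Sum>i\<in>C. \<zeta> i \<omega>\<bar>}" for j
    have A [measurable]: "A1 j \<in> sets M" "A2 j \<in> sets M" if "j \<in> J" for j
      unfolding A1_def A2_def using Cc[OF that] by measurable
    have P1: "prob (A1 j) \<le> K * (real (card (U j)) / real n)\<^sup>2" if j: "j \<in> J" for j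
    proof -
      have "prob (A1 j) \<le> expectation (\<lambda>\<omega>. (\<Sum>i\<in>U j. \<eta> i \<omega>) ^ 4) / c ^ 4"
        unfolding A1_def
      proof (rule chain_maximal_inequality[OF \<eta>ind \<eta>i \<eta>m _ _ Uf[OF j] CU[OF j] chain[OF j] c])
        fix C assume "C \<subseteq> U j"
        have "\<bar>\<Sum>i\<in>C. \<eta> i \<omega>\<bar> \<le> real (card C) * (2 * B)" for \<omega>
          using \<eta>b by (intro order_trans[OF sum_abs] sum_bounded_above)
        then show "integrable M (\<lambda>\<omega>. (\<Sum>i\<in>C. \<eta> i \<omega>) ^ 4)"
          by (intro integrable_const_bound[where B = "(real (card C) * (2 * B)) ^ 4"])
             (auto simp: power_abs intro!: power_mono simp del: power_even_abs_numeral)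
      qed auto
      also have "\<dots> \<le> (3 * (2 * B) ^ 4 * (real (card (U j)))\<^sup>2) / c ^ 4"
        using c by (intro divide_right_mono fourth_moment_indep_sum[OF \<eta>ind \<eta>b \<eta>m Uf[OF j]]) auto
      also have "c ^ 4 = \<epsilon> ^ 4 * (real n)\<^sup>2"
        unfolding c_def by (simp add: power_mult_distrib power4_eq_xxxx power2_eq_square)
      finally show ?thesis
        by (simp add: K_def power_divide)
    qed
    have P2: "prob (A2 j) \<le> \<tau> / real n * real (card (U j))" if j: "j \<in> J" for j
    proof -
      note second = second_moment_indep_sum[OF \<zeta>ind \<zeta>i \<zeta>m \<zeta>2(1)]
      have "prob (A2 j) \<le> expectation (\<lambda>\<omega>. (\<Sum>i\<in>U j. \<zeta> i \<omega>)\<^sup>2) / c\<^sup>2"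
        unfolding A2_def
        by (rule chain_maximal_inequality[OF \<zeta>ind \<zeta>i \<zeta>m _ _ Uf[OF j] CU[OF j] chain[OF j] c])
           (use second finite_subset[OF _ Uf[OF j]] in auto)
      also have "expectation (\<lambda>\<omega>. (\<Sum>i\<in>U j. \<zeta> i \<omega>)\<^sup>2) = (\<Sum>i\<in>U j. expectation (\<lambda>\<omega>. (\<zeta> i \<omega>)\<^sup>2))"
        using second[OF Uf[OF j]] by simp
      also have "\<dots> / c\<^sup>2 \<le> (real (card (U j)) * (\<tau> * \<epsilon>\<^sup>2)) / c\<^sup>2"
        using \<zeta>2(2) by (intro divide_right_mono sum_bounded_above) auto
      finally show ?thesis
        using assms n by (simp add: c_def power_mult_distrib field_simps)
    qed
    have "{\<omega>\<in>space M. \<exists>j\<in>J. \<exists>C\<in>\<C> j. 2 * \<epsilon> * sqrt (real n) < \<bar>\<Sum>i\<in>C. \<xi> i \<omega>\<bar>} \<subseteq> (\<Union>j\<in>J. A1 j) \<union> (\<Union>j\<in>J. A2 j)"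
    proof
      fix \<omega> assume "\<omega> \<in> {\<omega>\<in>space M. \<exists>j\<in>J. \<exists>C\<in>\<C> j. 2 * \<epsilon> * sqrt (real n) < \<bar>\<Sum>i\<in>C. \<xi> i \<omega>\<bar>}"
      then obtain j C where j: "\<omega> \<in> space M" "j \<in> J" "C \<in> \<C> j" "2 * c < \<bar>\<Sum>i\<in>C. \<xi> i \<omega>\<bar>"
        by (auto simp: c_def mult.assoc)
      have "(\<Sum>i\<in>C. \<xi> i \<omega>) = (\<Sum>i\<in>C. \<eta> i \<omega>) + (\<Sum>i\<in>C. \<zeta> i \<omega>)"
        by (simp add: \<eta>_def \<zeta>_def flip: sum.distrib)
      then have "c < \<bar>\<Sum>i\<in>C. \<eta> i \<omega>\<bar> \<or> c < \<bar>\<Sum>i\<in>C. \<zeta> i \<omega>\<bar>"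
        using j(4) by linarith
      then show "\<omega> \<in> (\<Union>j\<in>J. A1 j) \<union> (\<Union>j\<in>J. A2 j)"
        using j by (auto simp: A1_def A2_def)
    qed
    then have "prob {\<omega>\<in>space M. \<exists>j\<in>J. \<exists>C\<in>\<C> j. 2 * \<epsilon> * sqrt (real n) < \<bar>\<Sum>i\<in>C. \<xi> i \<omega>\<bar>}
        \<le> prob ((\<Union>j\<in>J. A1 j) \<union> (\<Union>j\<in>J. A2 j))"
      using A J by (intro finite_measure_mono sets.Un sets.finite_UN) auto
    also have "\<dots> \<le> prob (\<Union>j\<in>J. A1 j) + prob (\<Union>j\<in>J. A2 j)"
      using A J by (intro measure_Un_le sets.finite_UN) auto
    also have "\<dots> \<le> (\<Sum>j\<in>J. prob (A1 j)) + (\<Sum>j\<in>J. prob (A2 j))"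
      using A J by (intro add_mono finite_measure_subadditive_finite) auto
    also have "\<dots> \<le> (\<Sum>j\<in>J. K * (real (card (U j)) / real n)\<^sup>2) + (\<Sum>j\<in>J. \<tau> / real n * real (card (U j)))"
      by (intro add_mono sum_mono P1 P2)
    \<comment> \<open>The blocks are disjoint subsets of \<open>{..<n}\<close>, so their sizes add
      up to at most \<open>n\<close>.\<close>
    also have "(\<Sum>j\<in>J. \<tau> / real n * real (card (U j))) = \<tau> / real n * real (card (\<Union>j\<in>J. U j))"
      using J Uf disj by (subst card_UN_disjoint) (auto simp: sum_distrib_left disjoint_family_on_def)
    also have "\<dots> \<le> \<tau> / real n * real n"
      using assms card_mono[of "{..<n}" "\<Union>j\<in>J. U j"] U by (intro mult_left_mono) auto
    finally show "prob {\<omega>\<in>space M. \<exists>j\<in>J. \<exists>C\<in>\<C> j. 2 * \<epsilon> * sqrt (real n) < \<bar>\<Sum>i\<in>C. \<xi> i \<omega>\<bar>}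
        \<le> (\<Sum>j\<in>J. K * (real (card (U j)) / real n)\<^sup>2) + \<tau>"
      using n by simp
  qed
qed

end

section \<open>Conditional characteristic functions\<close>

text \<open>Nonnegativity of the variance of \<open>\<bar>Y\<bar>\<close> is the Cauchy-Schwarz
  bound.\<close>

lemma (in prob_space) expectation_abs_le_sqrt:
  fixes Y :: "'a \<Rightarrow> real"
  assumes [measurable]: "Y \<in> borel_measurable M" and Y2: "integrable M (\<lambda>\<omega>. (Y \<omega>)\<^sup>2)"
  shows "integrable M Y" and "expectation (\<lambda>\<omega>. \<bar>Y \<omega>\<bar>) \<le> sqrt (expectation (\<lambda>\<omega>. (Y \<omega>)\<^sup>2))"
proof -
  show Y: "integrable M Y"
    using square_integrable_imp_integrable[OF assms] .
  have "0 \<le> variance (\<lambda>\<omega>. \<bar>Y \<omega>\<bar>)"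
    by (rule variance_positive)
  also have "\<dots> = expectation (\<lambda>\<omega>. (Y \<omega>)\<^sup>2) - (expectation (\<lambda>\<omega>. \<bar>Y \<omega>\<bar>))\<^sup>2"
    using Y Y2 by (subst variance_eq) auto
  finally show "expectation (\<lambda>\<omega>. \<bar>Y \<omega>\<bar>) \<le> sqrt (expectation (\<lambda>\<omega>. (Y \<omega>)\<^sup>2))"
    by (intro real_le_rsqrt) simp
qed

text \<open>The upper half follows from \<open>exp u \<ge> 1 + u\<close> and
  \<open>(1 - u + u\<^sup>2) * (1 + u) = 1 + u ^ 3\<close>.\<close>

lemma exp_minus_second_order:
  fixes u :: real
  assumes "0 \<le> u"
  shows "\<bar>(1 - u) - exp (- u)\<bar> \<le> u\<^sup>2"
proof -
  have "1 - u \<le> exp (- u)"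
    using exp_ge_add_one_self[of "- u"] by simp
  moreover have "exp (- u) \<le> 1 - u + u\<^sup>2"
  proof -
    have "exp (- u) = 1 / exp u"
      by (simp add: exp_minus field_simps)
    also have "\<dots> \<le> 1 / (1 + u)"
      using assms exp_ge_add_one_self[of u] by (intro divide_left_mono) auto
    also have "\<dots> \<le> 1 - u + u\<^sup>2"
    proof -
      have "(1 - u + u\<^sup>2) * (1 + u) = 1 + u ^ 3"
        by (simp add: power2_eq_square power3_eq_cube algebra_simps)
      moreover have "0 \<le> u ^ 3" using assms by simp
      ultimately show ?thesis
        using assms by (simp add: divide_le_eq)
    qed
    finally show ?thesis .
  qed
  ultimately show ?thesis by simp
qed

context multipliers
begin

text \<open>The moment in the second-order Taylor remainder of a characteristic function. The
  minimum is integrable by the second moment, and its cubic branch makes it small for small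
  \<open>s\<close>, as in Lindeberg's condition.\<close>

definition min_moment :: "real \<Rightarrow> real" where
  "min_moment s = expectation (\<lambda>\<omega>. min (6 * (\<xi> 0 \<omega>)\<^sup>2) (\<bar>s\<bar> * \<bar>\<xi> 0 \<omega>\<bar> ^ 3))"

lemma min_moment_integrable: "integrable M (\<lambda>\<omega>. min (6 * (\<xi> 0 \<omega>)\<^sup>2) (\<bar>s\<bar> * \<bar>\<xi> 0 \<omega>\<bar> ^ 3))"
proof (rule Bochner_Integration.integrable_bound)
  show "integrable M (\<lambda>\<omega>. 6 * (\<xi> 0 \<omega>)\<^sup>2)" by simp
qed auto

lemma min_moment_mono: "\<bar>s\<bar> \<le> \<bar>r\<bar> \<Longrightarrow> min_moment s \<le> min_moment r"
  unfolding min_moment_def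
  by (intro integral_mono min_moment_integrable min.mono mult_right_mono) auto

lemma min_moment_nonneg: "0 \<le> min_moment s"
  unfolding min_moment_def by (intro Bochner_Integration.integral_nonneg) auto

lemma min_moment_tendsto: "(\<lambda>n. min_moment (A / sqrt (real n))) \<longlonglongrightarrow> 0"
proof -
  have lim: "(\<lambda>n. min (6 * x\<^sup>2) (\<bar>A / sqrt (real n)\<bar> * \<bar>x\<bar> ^ 3)) \<longlonglongrightarrow> 0" for x :: real
  proof -
    have "(\<lambda>n. \<bar>A / sqrt (real n)\<bar> * \<bar>x\<bar> ^ 3) \<longlonglongrightarrow> 0"
      by (intro tendsto_mult_left_zero tendsto_rabs_zero tendsto_divide_0[OF tendsto_const]
          filterlim_at_top_imp_at_infinity sqrt_at_top[THEN filterlim_compose] filterlim_real_sequentially)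
    from tendsto_min[OF tendsto_const this, of "6 * x\<^sup>2"] show ?thesis
      by (simp add: min_absorb2)
  qed
  have "(\<lambda>n. min_moment (A / sqrt (real n))) \<longlonglongrightarrow> expectation (\<lambda>_. 0)"
    unfolding min_moment_def
  proof (rule integral_dominated_convergence)
    show "integrable M (\<lambda>\<omega>. 6 * (\<xi> 0 \<omega>)\<^sup>2)" by simp
    show "AE \<omega> in M. (\<lambda>n. min (6 * (\<xi> 0 \<omega>)\<^sup>2) (\<bar>A / sqrt (real n)\<bar> * \<bar>\<xi> 0 \<omega>\<bar> ^ 3)) \<longlonglongrightarrow> 0"
      using lim by simp
  qed auto
  then show ?thesis by simp
qed

text \<open>Second-order expansion, after which \<open>1 - s\<^sup>2 / 2\<close> is replaced by the
  exponential at the price \<open>(s\<^sup>2 / 2)\<^sup>2\<close>.\<close>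

lemma xi_char_approx:
  "cmod (char (distr M borel (\<lambda>\<omega>. s * \<xi> i \<omega>)) 1 - complex_of_real (exp (- (s\<^sup>2 / 2)))) \<le> s\<^sup>2 * min_moment s + s ^ 4"
proof -
  let ?\<nu> = "distr M borel (\<xi> 0)"
  have "char (distr M borel (\<lambda>\<omega>. s * \<xi> i \<omega>)) 1 = char (distr M borel (\<xi> i)) s"
    unfolding char_def by (simp add: integral_distr)
  also have "\<dots> = char ?\<nu> s"
    using xi_distr[of i 0] by simp
  finally have eq: "char (distr M borel (\<lambda>\<omega>. s * \<xi> i \<omega>)) 1 = char ?\<nu> s" .
  have "cmod (char ?\<nu> s - (1 - s\<^sup>2 * 1 / 2)) \<le> (s\<^sup>2 / 6) * min_moment s"
    unfolding min_moment_def by (rule char_approx3') auto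
  also have "\<dots> \<le> s\<^sup>2 * min_moment s"
    using min_moment_nonneg by (intro mult_right_mono) auto
  finally have 1: "cmod (char ?\<nu> s - complex_of_real (1 - s\<^sup>2 / 2)) \<le> s\<^sup>2 * min_moment s"
    by simp
  have "cmod (complex_of_real (1 - s\<^sup>2 / 2) - complex_of_real (exp (- (s\<^sup>2 / 2)))) \<le> (s\<^sup>2 / 2)\<^sup>2"
    using exp_minus_second_order[of "s\<^sup>2 / 2"] by (simp only: norm_of_real zero_le_power2 divide_nonneg_nonneg zero_le_numeral flip: of_real_diff)
  also have "\<dots> \<le> s ^ 4"
    by (simp add: power_divide flip: power_mult)
  finally have 2: "cmod (complex_of_real (1 - s\<^sup>2 / 2) - complex_of_real (exp (- (s\<^sup>2 / 2)))) \<le> s ^ 4" .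
  show ?thesis
    unfolding eq by (rule norm_diff_triangle_le[OF 1 2])
qed

text \<open>Independence factors the characteristic function, and products of numbers in the unit
  disc differ by at most the sum of the factorwise differences. The coefficients enter the error
  through their common bound \<open>A\<close> only, so it is uniform over samples.\<close>

lemma multiplier_cos_approx:
  assumes "0 < n" and a: "\<And>i. i < n \<Longrightarrow> \<bar>a i\<bar> \<le> A"
  shows "\<bar>expectation (\<lambda>\<omega>. cos ((1 / sqrt (real n)) * (\<Sum>i<n. a i * \<xi> i \<omega>) + b))
      - cos b * exp (- ((\<Sum>i<n. (a i)\<^sup>2) / real n / 2))\<bar>
    \<le> A\<^sup>2 * min_moment (A / sqrt (real n)) + A ^ 4 / real n"
proof -
  define s where "s i = a i / sqrt (real n)" for i
  define Y where "Y \<omega> = (\<Sum>i<n. s i * \<xi> i \<omega>)" for \<omega>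
  have Y: "(1 / sqrt (real n)) * (\<Sum>i<n. a i * \<xi> i \<omega>) = Y \<omega>" for \<omega>
    unfolding Y_def s_def by (simp add: sum_divide_distrib)
  have [measurable]: "Y \<in> borel_measurable M"
    unfolding Y_def by measurable
  have sb: "\<bar>s i\<bar> \<le> \<bar>A / sqrt (real n)\<bar>" if "i < n" for i
    using a[OF that] unfolding s_def by (auto simp: abs_divide intro: divide_right_mono)
  have s2: "(s i)\<^sup>2 \<le> A\<^sup>2 / real n" if "i < n" for i
    using power_mono[OF sb[OF that], of 2] by (simp add: power_divide)
  have s4: "s i ^ 4 \<le> A ^ 4 / (real n)\<^sup>2" if "i < n" for i
    using power_mono[OF s2[OF that], of 2] by (simp add: power_divide flip: power_mult)
  have "indep_vars (\<lambda>_. borel) (\<lambda>i \<omega>. s i * \<xi> i \<omega>) {..<n}"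
    by (rule indep_vars_subset[OF indep_vars_compose2[OF xi_indep]]) auto
  from char_distr_sum[OF this, of 1]
  have prod: "char (distr M borel Y) 1 = (\<Prod>i<n. char (distr M borel (\<lambda>\<omega>. s i * \<xi> i \<omega>)) 1)"
    unfolding Y_def by simp
  define E where "E = exp (- ((\<Sum>i<n. (a i)\<^sup>2) / real n / 2))"
  have E: "complex_of_real E = (\<Prod>i<n. complex_of_real (exp (- ((s i)\<^sup>2 / 2))))"
  proof -
    have "- ((\<Sum>i<n. (a i)\<^sup>2) / real n / 2) = (\<Sum>i<n. - ((s i)\<^sup>2 / 2))"
      by (simp add: s_def power_divide sum_negf flip: sum_divide_distrib)
    then show ?thesis
      unfolding E_def by (simp add: exp_sum del: of_real_exp flip: of_real_prod)
  qed
  have "cmod (char (distr M borel Y) 1 - complex_of_real E)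
      \<le> (\<Sum>i<n. cmod (char (distr M borel (\<lambda>\<omega>. s i * \<xi> i \<omega>)) 1 - complex_of_real (exp (- ((s i)\<^sup>2 / 2)))))"
    unfolding prod E
  proof (rule norm_prod_diff)
    fix i
    show "cmod (char (distr M borel (\<lambda>\<omega>. s i * \<xi> i \<omega>)) 1) \<le> 1"
      by (intro real_distribution.cmod_char_le_1 real_distribution_distr) simp
    show "cmod (complex_of_real (exp (- ((s i)\<^sup>2 / 2)))) \<le> 1"
      by (simp only: norm_of_real) simp
  qed
  also have "\<dots> \<le> (\<Sum>i<n. (s i)\<^sup>2 * min_moment (s i) + s i ^ 4)"
    by (intro sum_mono xi_char_approx)
  also have "\<dots> \<le> (\<Sum>i<n. A\<^sup>2 / real n * min_moment (A / sqrt (real n)) + A ^ 4 / (real n)\<^sup>2)"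
    using s2 s4 sb by (intro sum_mono add_mono mult_mono min_moment_mono min_moment_nonneg) auto
  also have "\<dots> = A\<^sup>2 * min_moment (A / sqrt (real n)) + A ^ 4 / real n"
    using assms(1) by (simp add: field_simps power2_eq_square)
  finally have le: "cmod (char (distr M borel Y) 1 - complex_of_real E)
      \<le> A\<^sup>2 * min_moment (A / sqrt (real n)) + A ^ 4 / real n" .
  have iexp: "integrable M (\<lambda>\<omega>. iexp (Y \<omega>))"
    by (rule integrable_const_bound[where B = 1]) auto
  have "expectation (\<lambda>\<omega>. cos (Y \<omega> + b)) = expectation (\<lambda>\<omega>. Re (iexp b * iexp (Y \<omega>)))"
    by (intro Bochner_Integration.integral_cong) (auto simp: cos_add Re_exp Im_exp)
  also have "\<dots> = Re (iexp b * (CLINT \<omega>|M. iexp (Y \<omega>)))"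
    using iexp by (subst integral_Re) auto
  also have "(CLINT \<omega>|M. iexp (Y \<omega>)) = char (distr M borel Y) 1"
    unfolding char_def by (simp add: integral_distr)
  finally have "expectation (\<lambda>\<omega>. cos (Y \<omega> + b)) - cos b * E
      = Re (iexp b * (char (distr M borel Y) 1 - complex_of_real E))"
    by (simp add: right_diff_distrib Re_exp Im_exp)
  also have "\<bar>\<dots>\<bar> \<le> cmod (iexp b * (char (distr M borel Y) 1 - complex_of_real E))"
    by (rule abs_Re_le_cmod)
  also have "\<dots> = cmod (char (distr M borel Y) 1 - complex_of_real E)"
    by (simp add: norm_mult)
  finally show ?thesis
    using le unfolding Y E_def by simp
qed

end

text \<open>The centred normal characteristic function in real form, with a phase. Square
  integrability is read off the law and not off the value of an integral, which would be 0 by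
  default for a function that is not integrable.\<close>

lemma (in prob_space) normal_law_cos:
  assumes [measurable]: "Y \<in> borel_measurable M"
    and law: "distr M borel Y = normal_law a \<sigma>" and "0 \<le> \<sigma>"
  shows "integrable M (\<lambda>\<omega>. (Y \<omega>)\<^sup>2)" and
    "expectation Y = 0 \<Longrightarrow> expectation (\<lambda>\<omega>. cos (Y \<omega> + b)) = cos b * exp (- (expectation (\<lambda>\<omega>. (Y \<omega>)\<^sup>2) / 2))"
proof -
  have "integrable M (\<lambda>\<omega>. (Y \<omega>)\<^sup>2) \<and> (expectation Y = 0 \<longrightarrow>
    expectation (\<lambda>\<omega>. cos (Y \<omega> + b)) = cos b * exp (- (expectation (\<lambda>\<omega>. (Y \<omega>)\<^sup>2) / 2)))"
  proof (cases "\<sigma> = 0")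
    case True
    then have l: "distr M borel Y = return borel a"
      using law by (simp add: normal_law_def)
    have "AE y in distr M borel Y. y = a"
      unfolding l by (subst AE_return) auto
    then have ae: "AE \<omega> in M. Y \<omega> = a"
      by (subst (asm) AE_distr_iff) auto
    have e: "expectation (\<lambda>\<omega>. f (Y \<omega>)) = f a" if [measurable]: "f \<in> borel_measurable borel" for f :: "real \<Rightarrow> real"
    proof -
      have "expectation (\<lambda>\<omega>. f (Y \<omega>)) = expectation (\<lambda>\<omega>. f a)"
        using ae by (intro integral_cong_AE) auto
      then show ?thesis by (simp add: prob_space)
    qed
    have "integrable M (\<lambda>\<omega>. (Y \<omega>)\<^sup>2) \<longleftrightarrow> integrable M (\<lambda>\<omega>. a\<^sup>2)"
      using ae by (intro integrable_cong_AE) auto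
    moreover have "expectation Y = a" "expectation (\<lambda>\<omega>. (Y \<omega>)\<^sup>2) = a\<^sup>2" "expectation (\<lambda>\<omega>. cos (Y \<omega> + b)) = cos (a + b)"
      using e[of "\<lambda>y. y"] e[of "\<lambda>y. y\<^sup>2"] e[of "\<lambda>y. cos (y + b)"] by simp_all
    ultimately show ?thesis by simp
  next
    case False
    then have \<sigma>: "0 < \<sigma>" using assms by simp
    \<comment> \<open>\<open>distributed\<close> is phrased over \<open>lborel\<close>, which has
      the same measurable sets as \<open>borel\<close>.\<close>
    have "distr M lborel Y = distr M borel Y"
      by (rule distr_cong) auto
    then have D: "distributed M lborel Y (normal_density a \<sigma>)"
      using law False by (simp add: distributed_def normal_law_def)
    have m: "expectation Y = a"
      by (rule normal_distributed_expectation[OF \<sigma> D])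
    have c: "integrable M (\<lambda>\<omega>. (Y \<omega> - a)\<^sup>2)"
      using integrable_normal_moment[OF \<sigma>, of a 2]
      by (subst distributed_integrable[OF D, of "\<lambda>y. (y - a)\<^sup>2", symmetric]) auto
    have y: "integrable M Y"
      using integrable_normal_moment_nz_1[OF \<sigma>, of a]
      by (subst distributed_integrable[OF D, of "\<lambda>y. y", symmetric]) auto
    have "integrable M (\<lambda>\<omega>. (Y \<omega> - a)\<^sup>2 + 2 * a * Y \<omega> - a\<^sup>2)"
      using c y by simp
    moreover have "(\<lambda>\<omega>. (Y \<omega> - a)\<^sup>2 + 2 * a * Y \<omega> - a\<^sup>2) = (\<lambda>\<omega>. (Y \<omega>)\<^sup>2)"
      by (auto simp: power2_eq_square algebra_simps)
    ultimately have "integrable M (\<lambda>\<omega>. (Y \<omega>)\<^sup>2)"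
      by simp
    moreover have "expectation (\<lambda>\<omega>. cos (Y \<omega> + b)) = cos b * exp (- (expectation (\<lambda>\<omega>. (Y \<omega>)\<^sup>2) / 2))"
      if "expectation Y = 0"
    proof -
      have a: "a = 0" using m that by simp
      have v: "expectation (\<lambda>\<omega>. (Y \<omega>)\<^sup>2) = \<sigma>\<^sup>2"
        using normal_distributed_variance[OF \<sigma> D] that by simp
      have "distributed M lborel (\<lambda>\<omega>. (Y \<omega> - a) / \<sigma>) std_normal_density"
        using D normal_standard_normal_convert[OF \<sigma>, of Y a] by simp
      then have "distr M lborel (\<lambda>\<omega>. Y \<omega> / \<sigma>) = std_normal_distribution"
        by (simp add: distributed_def a)
      moreover have "distr M lborel (\<lambda>\<omega>. Y \<omega> / \<sigma>) = distr M borel (\<lambda>\<omega>. Y \<omega> / \<sigma>)"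
        by (rule distr_cong) auto
      ultimately have "char (distr M borel (\<lambda>\<omega>. Y \<omega> / \<sigma>)) \<sigma> = complex_of_real (exp (- (\<sigma>\<^sup>2) / 2))"
        by (simp add: char_std_normal_distribution)
      then have ch: "(CLINT \<omega>|M. iexp (Y \<omega>)) = complex_of_real (exp (- (\<sigma>\<^sup>2) / 2))"
        unfolding char_def using \<sigma> by (simp add: integral_distr)
      have iexp: "integrable M (\<lambda>\<omega>. iexp (Y \<omega>))"
        by (rule integrable_const_bound[where B = 1]) auto
      have "expectation (\<lambda>\<omega>. cos (Y \<omega> + b)) = expectation (\<lambda>\<omega>. Re (iexp b * iexp (Y \<omega>)))"
        by (intro Bochner_Integration.integral_cong) (auto simp: cos_add Re_exp Im_exp)
      also have "\<dots> = Re (iexp b * (CLINT \<omega>|M. iexp (Y \<omega>)))"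
        using iexp by (subst integral_Re) auto
      finally show ?thesis
        unfolding ch v by (simp add: Re_exp del: of_real_exp)
    qed
    ultimately show ?thesis by blast
  qed
  then show "integrable M (\<lambda>\<omega>. (Y \<omega>)\<^sup>2)" and
    "expectation Y = 0 \<Longrightarrow> expectation (\<lambda>\<omega>. cos (Y \<omega> + b)) = cos b * exp (- (expectation (\<lambda>\<omega>. (Y \<omega>)\<^sup>2) / 2))"
    by auto
qed

section \<open>Finite-dimensional convergence\<close>

locale multiplier_sample = multipliers M \<xi> for M :: "'a measure" and \<xi> +
  fixes X :: "nat \<Rightarrow> 'a \<Rightarrow> real" and D :: "real measure" and F :: "real \<Rightarrow> real"
  assumes D: "real_distribution D" and F: "F = cdf D"
    and X_indep: "indep_vars (\<lambda>_. borel) X UNIV"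
    and X_distr: "\<And>i. distr M borel (X i) = D"
begin

sublocale D: cdf_distribution D
  rewrites "cdf D = F"
  using D F by (simp_all add: cdf_distribution_def)

lemma X_measurable [measurable]: "X i \<in> borel_measurable M"
  using X_indep by (simp add: indep_vars_def2)

lemma F_mono: "x \<le> y \<Longrightarrow> F x \<le> F y"
  using D.mono by (rule monoD)

lemma F_nonneg [simp]: "0 \<le> F x" and F_le_one [simp]: "F x \<le> 1"
  using D.cdf_nonneg[of x] D.cdf_bounded_prob[of x] by auto

lemma F_measurable [measurable]: "F \<in> borel_measurable borel"
  by (rule D.measurable_C)

lemma prob_X_le: "prob {\<omega>\<in>space M. X i \<omega> \<le> x} = F x"
proof -
  have "F x = measure (distr M borel (X i)) {..x}"
    by (simp add: X_distr F cdf_def)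
  also have "\<dots> = prob {\<omega>\<in>space M. X i \<omega> \<le> x}"
    by (subst measure_distr) (auto intro!: arg_cong[where f = prob])
  finally show ?thesis by simp
qed

definition centred :: "real \<Rightarrow> nat \<Rightarrow> 'a \<Rightarrow> real" where
  "centred x i \<omega> = indicator {..x} (X i \<omega>) - F x"

definition combination :: "real set \<Rightarrow> (real \<Rightarrow> real) \<Rightarrow> nat \<Rightarrow> 'a \<Rightarrow> real" where
  "combination T s i \<omega> = (\<Sum>x\<in>T. s x * centred x i \<omega>)"

definition covariance :: "real \<Rightarrow> real \<Rightarrow> real" where
  "covariance x y = F (min x y) - F x * F y"

text \<open>The quadratic form of the covariance. It is the variance of a linear combination both of
  centred indicators and of the coordinates of the limit.\<close>

definition variance_form :: "real set \<Rightarrow> (real \<Rightarrow> real) \<Rightarrow> real" where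
  "variance_form T s = (\<Sum>x\<in>T. \<Sum>y\<in>T. s x * s y * covariance x y)"

text \<open>The sample is taken at \<open>\<omega>\<close> and the multipliers at
  \<open>\<omega>'\<close>: the integral over \<open>\<omega>'\<close> is the expectation with the
  sample held fixed, and \<open>W n \<omega> \<omega>\<close> is the process itself.\<close>

definition W :: "nat \<Rightarrow> 'a \<Rightarrow> 'a \<Rightarrow> real \<Rightarrow> real" where
  "W n \<omega> \<omega>' = multiplier_process F (\<lambda>i. X i \<omega>) (\<lambda>i. \<xi> i \<omega>') n"

lemma W_eq: "W n \<omega> \<omega>' x = (1 / sqrt (real n)) * (\<Sum>i<n. centred x i \<omega> * \<xi> i \<omega>')"
  unfolding W_def multiplier_process_def centred_def by (simp add: mult.commute)

lemma centred_measurable [measurable]: "centred x i \<in> borel_measurable M"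
  unfolding centred_def by measurable

lemma combination_measurable [measurable]: "combination T s i \<in> borel_measurable M"
  unfolding combination_def by measurable

lemma centred_bound: "\<bar>centred x i \<omega>\<bar> \<le> 1"
  unfolding centred_def using F_nonneg[of x] F_le_one[of x] by (auto simp: indicator_def)

lemma combination_bound: "\<bar>combination T s i \<omega>\<bar> \<le> (\<Sum>x\<in>T. \<bar>s x\<bar>)"
  unfolding combination_def
  by (intro order_trans[OF sum_abs] sum_mono) (simp add: abs_mult mult_left_le centred_bound)

lemma combination_square_integrable: "integrable M (\<lambda>\<omega>. (combination T s i \<omega>)\<^sup>2)"
proof (rule integrable_const_bound[where B = "(\<Sum>x\<in>T. \<bar>s x\<bar>)\<^sup>2"])
  have "\<bar>combination T s i \<omega>\<bar>\<^sup>2 \<le> (\<Sum>x\<in>T. \<bar>s x\<bar>)\<^sup>2" for \<omega>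
    by (intro power_mono combination_bound) simp
  then show "AE \<omega> in M. norm ((combination T s i \<omega>)\<^sup>2) \<le> (\<Sum>x\<in>T. \<bar>s x\<bar>)\<^sup>2"
    by simp
qed simp

lemma centred_second_moment: "expectation (\<lambda>\<omega>. centred x i \<omega> * centred y i \<omega>) = covariance x y"
proof -
  define I where "I x = {\<omega>\<in>space M. X i \<omega> \<le> x}" for x
  have [measurable]: "I x \<in> sets M" for x
    unfolding I_def by measurable
  have int: "integrable M (indicat_real (I x))" for x
    by (rule integrable_const_bound[where B = 1]) auto
  have P: "prob (I x) = F x" for x
    unfolding I_def by (rule prob_X_le)
  have "expectation (\<lambda>\<omega>. centred x i \<omega> * centred y i \<omega>)
      = expectation (\<lambda>\<omega>. indicator (I (min x y)) \<omega> - F y * indicator (I x) \<omega> - F x * indicator (I y) \<omega> + F x * F y)"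
    by (intro Bochner_Integration.integral_cong)
       (auto simp: centred_def I_def indicator_def algebra_simps)
  also have "\<dots> = covariance x y"
    using int by (simp add: P prob_space covariance_def)
  finally show ?thesis .
qed

lemma combination_second_moment: "expectation (\<lambda>\<omega>. (combination T s i \<omega>)\<^sup>2) = variance_form T s"
proof -
  have int: "integrable M (\<lambda>\<omega>. centred x i \<omega> * centred y i \<omega>)" for x y
    using centred_bound[of x i] centred_bound[of y i]
    by (intro integrable_const_bound[where B = "1 * 1"]) (auto simp: abs_mult intro!: mult_le_one)
  have "(combination T s i \<omega>)\<^sup>2 = (\<Sum>x\<in>T. \<Sum>y\<in>T. s x * s y * (centred x i \<omega> * centred y i \<omega>))" for \<omega>
    unfolding combination_def power2_eq_square by (simp add: sum_product mult_ac)
  then show ?thesis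
    using int by (simp add: centred_second_moment variance_form_def)
qed

lemma variance_form_singleton: "variance_form {x} (\<lambda>_. 1) = F x * (1 - F x)"
  by (simp add: variance_form_def covariance_def algebra_simps)

lemma W_combination: "(\<Sum>x\<in>T. s x * W n \<omega> \<omega>' x) = (1 / sqrt (real n)) * (\<Sum>i<n. combination T s i \<omega> * \<xi> i \<omega>')"
proof -
  have "(\<Sum>x\<in>T. s x * W n \<omega> \<omega>' x) = (1 / sqrt (real n)) * (\<Sum>x\<in>T. \<Sum>i<n. s x * centred x i \<omega> * \<xi> i \<omega>')"
    unfolding W_eq by (simp add: sum_distrib_left mult_ac)
  also have "(\<Sum>x\<in>T. \<Sum>i<n. s x * centred x i \<omega> * \<xi> i \<omega>') = (\<Sum>i<n. combination T s i \<omega> * \<xi> i \<omega>')"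
    unfolding combination_def sum_distrib_right by (rule sum.swap)
  finally show ?thesis .
qed

lemma W_second_moment:
  shows "integrable M (\<lambda>\<omega>'. (\<Sum>x\<in>T. s x * W n \<omega> \<omega>' x)\<^sup>2)"
    and "expectation (\<lambda>\<omega>'. (\<Sum>x\<in>T. s x * W n \<omega> \<omega>' x)\<^sup>2) = (\<Sum>i<n. (combination T s i \<omega>)\<^sup>2) / real n"
  unfolding W_combination power_mult_distrib
  using weighted_second_moment[of "{..<n}" "\<lambda>i. combination T s i \<omega>"] by (simp_all add: power_divide)

text \<open>The conditional variance has the limiting variance as its mean for every positive
  \<open>n\<close>, so process and limit obey second moment bounds with the same constants.\<close>

lemma W_second_moment_expectation:
  assumes "0 < n"
  shows "expectation (\<lambda>\<omega>. expectation (\<lambda>\<omega>'. (\<Sum>x\<in>T. s x * W n \<omega> \<omega>' x)\<^sup>2)) = variance_form T s"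
  using combination_square_integrable assms
  by (simp add: W_second_moment combination_second_moment)

text \<open>The conditional variance is a mean of independent variables with values in
  \<open>[0, A\<^sup>2]\<close>. The variance of that mean is at most \<open>A ^ 4 / n\<close>, and
  Cauchy-Schwarz passes to the first absolute moment.\<close>

lemma combination_lln:
  assumes "0 < n"
  shows "expectation (\<lambda>\<omega>. \<bar>(\<Sum>i<n. (combination T s i \<omega>)\<^sup>2) / real n - variance_form T s\<bar>)
    \<le> (\<Sum>x\<in>T. \<bar>s x\<bar>)\<^sup>2 / sqrt (real n)"
proof -
  define A where "A = (\<Sum>x\<in>T. \<bar>s x\<bar>)"
  define \<eta> where "\<eta> i \<omega> = (combination T s i \<omega>)\<^sup>2 - variance_form T s" for i \<omega>
  have "indep_vars (\<lambda>_. borel) (\<lambda>i \<omega>. (\<Sum>x\<in>T. s x * (indicator {..x} (X i \<omega>) - F x))\<^sup>2 - variance_form T s) UNIV"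
    by (rule indep_vars_compose2[OF X_indep]) simp
  then have ind: "indep_vars (\<lambda>_. borel) \<eta> UNIV"
    unfolding \<eta>_def combination_def centred_def .
  have [measurable]: "\<eta> i \<in> borel_measurable M" for i
    unfolding \<eta>_def by measurable
  have c: "(combination T s i \<omega>)\<^sup>2 \<le> A\<^sup>2" for i \<omega>
    using combination_bound[of T s i \<omega>] unfolding A_def[symmetric] by (rule abs_le_square_iff[THEN iffD1, OF order_trans]) simp
  have v: "0 \<le> variance_form T s" "variance_form T s \<le> A\<^sup>2"
  proof -
    show "0 \<le> variance_form T s"
      unfolding combination_second_moment[of T s 0, symmetric] by simp
    have "expectation (\<lambda>\<omega>. (combination T s 0 \<omega>)\<^sup>2) \<le> expectation (\<lambda>_. A\<^sup>2)"
      using c by (intro integral_mono combination_square_integrable) auto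
    then show "variance_form T s \<le> A\<^sup>2"
      by (simp add: combination_second_moment prob_space)
  qed
  have b: "\<bar>\<eta> i \<omega>\<bar> \<le> A\<^sup>2" for i \<omega>
    using c[of i \<omega>] v unfolding \<eta>_def by (smt (verit) zero_le_power2)
  have i: "integrable M (\<eta> i)" for i
    using combination_square_integrable unfolding \<eta>_def by auto
  have m: "expectation (\<eta> i) = 0" for i
    using combination_square_integrable unfolding \<eta>_def by (simp add: combination_second_moment prob_space)
  have b2: "(\<eta> i \<omega>)\<^sup>2 \<le> (A\<^sup>2)\<^sup>2" for i \<omega>
    using b[of i \<omega>] by (rule abs_le_square_iff[THEN iffD1, OF order_trans]) simp
  have i2: "integrable M (\<lambda>\<omega>. (\<eta> i \<omega>)\<^sup>2)" for i
    using b2 by (intro integrable_const_bound[where B = "(A\<^sup>2)\<^sup>2"]) auto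
  have m2: "expectation (\<lambda>\<omega>. (\<eta> i \<omega>)\<^sup>2) \<le> (A\<^sup>2)\<^sup>2" for i
  proof -
    have "expectation (\<lambda>\<omega>. (\<eta> i \<omega>)\<^sup>2) \<le> expectation (\<lambda>_. (A\<^sup>2)\<^sup>2)"
      using b2 by (intro integral_mono i2) auto
    then show ?thesis by (simp add: prob_space)
  qed
  have sm: "integrable M (\<lambda>\<omega>. (\<Sum>i<n. \<eta> i \<omega>)\<^sup>2)"
    "expectation (\<lambda>\<omega>. (\<Sum>i<n. \<eta> i \<omega>)\<^sup>2) = (\<Sum>i<n. expectation (\<lambda>\<omega>. (\<eta> i \<omega>)\<^sup>2))"
    using second_moment_indep_sum[OF ind i m i2, of "{..<n}"] by auto
  have "(\<Sum>i<n. expectation (\<lambda>\<omega>. (\<eta> i \<omega>)\<^sup>2)) \<le> (\<Sum>i<n. (A\<^sup>2)\<^sup>2)"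
    by (intro sum_mono m2)
  then have "sqrt (expectation (\<lambda>\<omega>. (\<Sum>i<n. \<eta> i \<omega>)\<^sup>2)) \<le> sqrt (real n * (A\<^sup>2)\<^sup>2)"
    unfolding sm(2) by (intro real_sqrt_le_mono) simp
  also have "\<dots> = sqrt (real n) * A\<^sup>2"
    by (simp only: real_sqrt_mult real_sqrt_abs abs_power2)
  finally have le: "expectation (\<lambda>\<omega>. \<bar>\<Sum>i<n. \<eta> i \<omega>\<bar>) \<le> sqrt (real n) * A\<^sup>2"
    using expectation_abs_le_sqrt(2)[OF _ sm(1)] by simp
  have "(\<Sum>i<n. (combination T s i \<omega>)\<^sup>2) / real n - variance_form T s = (\<Sum>i<n. \<eta> i \<omega>) / real n" for \<omega>
    using assms by (simp add: \<eta>_def sum_subtractf field_simps)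
  then have "expectation (\<lambda>\<omega>. \<bar>(\<Sum>i<n. (combination T s i \<omega>)\<^sup>2) / real n - variance_form T s\<bar>)
      = expectation (\<lambda>\<omega>. \<bar>\<Sum>i<n. \<eta> i \<omega>\<bar>) / real n"
    by (simp add: abs_divide)
  also have "\<dots> \<le> sqrt (real n) * A\<^sup>2 / real n"
    using le by (intro divide_right_mono) auto
  also have "\<dots> = A\<^sup>2 / sqrt (real n)"
    using assms by (simp add: field_simps real_sqrt_divide[symmetric] real_div_sqrt)
  finally show ?thesis unfolding A_def .
qed

end

section \<open>Expectations with the sample held fixed\<close>

context multiplier_sample
begin

lemma W_pair_measurable [measurable]: "(\<lambda>p. W n (fst p) (snd p) x) \<in> borel_measurable (M \<Otimes>\<^sub>M M)"
  unfolding W_eq centred_def by measurable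

lemma W_measurable [measurable]: "(\<lambda>\<omega>'. W n \<omega> \<omega>' x) \<in> borel_measurable M"
  unfolding W_eq by measurable

definition cond :: "((real \<Rightarrow> real) \<Rightarrow> real) \<Rightarrow> nat \<Rightarrow> 'a \<Rightarrow> real" where
  "cond \<phi> n \<omega> = expectation (\<lambda>\<omega>'. \<phi> (W n \<omega> \<omega>'))"

lemma trig_sum_W_integrable:
  assumes "trig_sum T \<phi>"
  shows "integrable M (\<lambda>\<omega>'. \<phi> (W n \<omega> \<omega>'))"
proof -
  obtain B where "\<And>y. \<bar>\<phi> y\<bar> \<le> B"
    using trig_sum_bounded[OF assms] by blast
  then show ?thesis
    by (intro integrable_const_bound[where B = B] trig_sum_measurable[OF assms]) auto
qed

lemma trig_sum_cond_measurable [measurable]: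
  assumes "trig_sum T \<phi>"
  shows "cond \<phi> n \<in> borel_measurable M"
proof -
  have "(\<lambda>p. \<phi> (W n (fst p) (snd p))) \<in> borel_measurable (M \<Otimes>\<^sub>M M)"
    by (rule trig_sum_measurable[OF assms W_pair_measurable])
  then show ?thesis
    unfolding cond_def by (intro borel_measurable_lebesgue_integral) (simp add: case_prod_beta')
qed

lemma trig_sum_cond_bounded: "trig_sum T \<phi> \<Longrightarrow> \<exists>B. \<forall>n \<omega>. \<bar>cond \<phi> n \<omega>\<bar> \<le> B"
proof -
  assume \<phi>: "trig_sum T \<phi>"
  obtain B where B: "\<And>y. \<bar>\<phi> y\<bar> \<le> B"
    using trig_sum_bounded[OF \<phi>] by blast
  have "\<bar>cond \<phi> n \<omega>\<bar> \<le> B" for n \<omega>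
  proof -
    have "\<bar>cond \<phi> n \<omega>\<bar> \<le> expectation (\<lambda>\<omega>'. \<bar>\<phi> (W n \<omega> \<omega>')\<bar>)"
      unfolding cond_def by (rule integral_abs_bound)
    also have "\<dots> \<le> expectation (\<lambda>_. B)"
      using trig_sum_W_integrable[OF \<phi>] B by (intro integral_mono) auto
    finally show ?thesis by (simp add: prob_space)
  qed
  then show ?thesis by blast
qed

lemma trig_sum_cond_integrable: "trig_sum T \<phi> \<Longrightarrow> integrable M (\<lambda>\<omega>. \<bar>cond \<phi> n \<omega> - c\<bar>)"
proof -
  assume \<phi>: "trig_sum T \<phi>"
  note [measurable] = trig_sum_cond_measurable[OF \<phi>]
  obtain B where B: "\<And>\<omega>. \<bar>cond \<phi> n \<omega>\<bar> \<le> B"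
    using trig_sum_cond_bounded[OF \<phi>] by blast
  have "\<bar>cond \<phi> n \<omega> - c\<bar> \<le> B + \<bar>c\<bar>" for \<omega>
    using abs_triangle_ineq4[of "cond \<phi> n \<omega>" c] B[of \<omega>] by linarith
  then show ?thesis
    by (intro integrable_const_bound[where B = "B + \<bar>c\<bar>"]) auto
qed

end

section \<open>Gaussian limits of the finite-dimensional laws\<close>

locale multiplier_limit = multiplier_sample M \<xi> X D F + N: prob_space N
  for M :: "'a measure" and \<xi> X D F and N :: "'b measure" +
  fixes Z :: "'b \<Rightarrow> real \<Rightarrow> real"
  assumes Z: "mean_zero_gaussian_process N Z covariance"
begin

lemma Z_measurable [measurable]: "(\<lambda>\<omega>. Z \<omega> x) \<in> borel_measurable N"
  using Z by (simp add: mean_zero_gaussian_process_def gaussian_process_def)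

lemma Z_law:
  assumes "finite T"
  obtains a \<sigma> where "0 \<le> \<sigma>" "distr N borel (\<lambda>\<omega>. \<Sum>x\<in>T. s x * Z \<omega> x) = normal_law a \<sigma>"
proof -
  have "\<exists>a. \<exists>\<sigma>\<ge>0. distr N borel (\<lambda>\<omega>. \<Sum>x\<in>T. s x * Z \<omega> x) = normal_law a \<sigma>"
    using Z assms unfolding mean_zero_gaussian_process_def gaussian_process_def by blast
  then show ?thesis using that by blast
qed

lemma Z_mean: "N.expectation (\<lambda>\<omega>. Z \<omega> x) = 0"
  and Z_covariance: "N.expectation (\<lambda>\<omega>. Z \<omega> x * Z \<omega> y) = covariance x y"
  using Z by (simp_all add: mean_zero_gaussian_process_def)

lemma Z_combination_square_integrable:
  assumes "finite T"
  shows "integrable N (\<lambda>\<omega>. (\<Sum>x\<in>T. s x * Z \<omega> x)\<^sup>2)"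
proof -
  obtain a \<sigma> where "0 \<le> \<sigma>" "distr N borel (\<lambda>\<omega>. \<Sum>x\<in>T. s x * Z \<omega> x) = normal_law a \<sigma>"
    by (rule Z_law[OF assms])
  then show ?thesis
    by (intro N.normal_law_cos(1)) auto
qed

lemma Z_square_integrable: "integrable N (\<lambda>\<omega>. (Z \<omega> x)\<^sup>2)"
  using Z_combination_square_integrable[where T = "{x}" and s = "\<lambda>_. 1"] by simp

lemma Z_integrable: "integrable N (\<lambda>\<omega>. Z \<omega> x)"
  by (rule N.expectation_abs_le_sqrt(1)) (auto intro: Z_square_integrable)

lemma Z_combination_second_moment:
  assumes "finite T"
  shows "N.expectation (\<lambda>\<omega>. (\<Sum>x\<in>T. s x * Z \<omega> x)\<^sup>2) = variance_form T s"
proof -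
  have int: "integrable N (\<lambda>\<omega>. Z \<omega> x * Z \<omega> y)" for x y
  proof (rule Bochner_Integration.integrable_bound)
    show "integrable N (\<lambda>\<omega>. (Z \<omega> x)\<^sup>2 + (Z \<omega> y)\<^sup>2)"
      using Z_square_integrable by simp
    have "\<bar>a * b\<bar> \<le> a\<^sup>2 + b\<^sup>2" for a b :: real
    proof -
      have "2 * (\<bar>a\<bar> * \<bar>b\<bar>) \<le> a\<^sup>2 + b\<^sup>2"
        using sum_squares_bound[of "\<bar>a\<bar>" "\<bar>b\<bar>"] by simp
      moreover have "0 \<le> \<bar>a\<bar> * \<bar>b\<bar>" by simp
      ultimately show ?thesis
        unfolding abs_mult by linarith
    qed
    then show "AE \<omega> in N. norm (Z \<omega> x * Z \<omega> y) \<le> norm ((Z \<omega> x)\<^sup>2 + (Z \<omega> y)\<^sup>2)"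
      by simp
  qed measurable
  have "(\<Sum>x\<in>T. s x * Z \<omega> x)\<^sup>2 = (\<Sum>x\<in>T. \<Sum>y\<in>T. s x * s y * (Z \<omega> x * Z \<omega> y))" for \<omega>
    unfolding power2_eq_square by (simp add: sum_product mult_ac)
  then show ?thesis
    using int by (simp add: variance_form_def Z_covariance)
qed

lemma Z_cos:
  assumes "finite T"
  shows "N.expectation (\<lambda>\<omega>. cos ((\<Sum>x\<in>T. s x * Z \<omega> x) + b)) = cos b * exp (- (variance_form T s / 2))"
proof -
  obtain a \<sigma> where *: "0 \<le> \<sigma>" "distr N borel (\<lambda>\<omega>. \<Sum>x\<in>T. s x * Z \<omega> x) = normal_law a \<sigma>"
    by (rule Z_law[OF assms])
  have "N.expectation (\<lambda>\<omega>. \<Sum>x\<in>T. s x * Z \<omega> x) = 0"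
    using Z_integrable by (simp add: Z_mean)
  with N.normal_law_cos(2)[OF _ *(2,1)] show ?thesis
    by (simp add: Z_combination_second_moment[OF assms])
qed

lemma trig_sum_Z_integrable:
  assumes "trig_sum T \<phi>"
  shows "integrable N (\<lambda>\<omega>. \<phi> (Z \<omega>))"
proof -
  obtain B where "\<And>y. \<bar>\<phi> y\<bar> \<le> B"
    using trig_sum_bounded[OF assms] by blast
  then show ?thesis
    by (intro N.integrable_const_bound[where B = B] trig_sum_measurable[OF assms]) auto
qed

text \<open>For one cosine, the conditional expectation is close to the Gaussian one with the
  conditional variance \<open>v n\<close>, which converges in mean. Convergence in mean passes
  through sums and multiples, and this carries the induction.\<close>

lemma trig_sum_converges:
  assumes "trig_sum T \<phi>" "finite T"
  shows "(\<lambda>n. expectation (\<lambda>\<omega>. \<bar>cond \<phi> n \<omega> - N.expectation (\<lambda>\<omega>. \<phi> (Z \<omega>))\<bar>)) \<longlonglongrightarrow> 0"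
  using assms(1)
proof induction
  case (trig_sum_cos s b)
  let ?\<phi> = "\<lambda>y. cos ((\<Sum>x\<in>T. s x * y x) + b)"
  have \<phi>: "trig_sum T ?\<phi>"
    by (rule trig_sum.trig_sum_cos)
  define A where "A = (\<Sum>x\<in>T. \<bar>s x\<bar>)"
  define v where "v n \<omega> = (\<Sum>i<n. (combination T s i \<omega>)\<^sup>2) / real n" for n \<omega>
  define \<delta> where "\<delta> n = A\<^sup>2 * min_moment (A / sqrt (real n)) + A ^ 4 / real n" for n
  have vi: "integrable M (\<lambda>\<omega>. \<bar>v n \<omega> - variance_form T s\<bar>)" for n
    unfolding v_def using combination_square_integrable by auto
  have v0: "0 \<le> variance_form T s"
    unfolding combination_second_moment[of T s 0, symmetric] by simp
  have bound: "\<bar>cond ?\<phi> n \<omega> - N.expectation (\<lambda>\<omega>. ?\<phi> (Z \<omega>))\<bar> \<le> \<delta> n + \<bar>v n \<omega> - variance_form T s\<bar>" if n: "0 < n" for n \<omega>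
  proof -
    have "\<bar>cond ?\<phi> n \<omega> - cos b * exp (- (v n \<omega> / 2))\<bar> \<le> \<delta> n"
      unfolding cond_def W_combination v_def \<delta>_def
      by (rule multiplier_cos_approx[OF n]) (simp add: A_def combination_bound)
    moreover have "\<bar>cos b * exp (- (v n \<omega> / 2)) - cos b * exp (- (variance_form T s / 2))\<bar> \<le> \<bar>v n \<omega> - variance_form T s\<bar>"
    proof -
      \<comment> \<open>On the nonnegative half line \<open>exp (- u)\<close> has slope at most 1 in
        absolute value.\<close>
      have exp: "\<bar>exp (- u) - exp (- w)\<bar> \<le> \<bar>u - w\<bar>" if "0 \<le> u" "0 \<le> w" for u w :: real
      proof -
        have *: "exp (- u) - exp (- w) \<le> w - u" if "0 \<le> u" "u \<le> w" for u w :: real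
        proof -
          have "exp (- u) - exp (- w) = exp (- u) * (1 - exp (u - w))"
            by (simp add: right_diff_distrib flip: exp_add)
          also have "\<dots> \<le> 1 * (w - u)"
            using that exp_ge_add_one_self[of "u - w"] by (intro mult_mono) (simp_all del: exp_ge_add_one_self)
          finally show ?thesis by simp
        qed
        show ?thesis
          using *[of u w] *[of w u] that by (cases "u \<le> w") auto
      qed
      have "0 \<le> v n \<omega>"
        unfolding v_def by (intro divide_nonneg_nonneg sum_nonneg) auto
      then have "\<bar>exp (- (v n \<omega> / 2)) - exp (- (variance_form T s / 2))\<bar> \<le> \<bar>v n \<omega> / 2 - variance_form T s / 2\<bar>"
        using v0 by (intro exp) auto
      then have "\<bar>cos b\<bar> * \<bar>exp (- (v n \<omega> / 2)) - exp (- (variance_form T s / 2))\<bar> \<le> 1 * \<bar>v n \<omega> - variance_form T s\<bar>"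
        by (intro mult_mono) auto
      then show ?thesis
        by (simp flip: right_diff_distrib abs_mult)
    qed
    ultimately show ?thesis
      unfolding Z_cos[OF assms(2)] by linarith
  qed
  have "expectation (\<lambda>\<omega>. \<bar>cond ?\<phi> n \<omega> - N.expectation (\<lambda>\<omega>. ?\<phi> (Z \<omega>))\<bar>) \<le> \<delta> n + A\<^sup>2 / sqrt (real n)" if n: "0 < n" for n
  proof -
    have "expectation (\<lambda>\<omega>. \<bar>cond ?\<phi> n \<omega> - N.expectation (\<lambda>\<omega>. ?\<phi> (Z \<omega>))\<bar>)
        \<le> expectation (\<lambda>\<omega>. \<delta> n + \<bar>v n \<omega> - variance_form T s\<bar>)"
      by (intro integral_mono bound n trig_sum_cond_integrable[OF \<phi>]) (use vi in auto)
    also have "\<dots> = \<delta> n + expectation (\<lambda>\<omega>. \<bar>v n \<omega> - variance_form T s\<bar>)"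
      using vi by (simp add: prob_space)
    finally show ?thesis
      using combination_lln[OF n, of T s] unfolding v_def A_def by linarith
  qed
  note le = this
  have "(\<lambda>n. \<delta> n + A\<^sup>2 / sqrt (real n)) \<longlonglongrightarrow> A\<^sup>2 * 0 + 0 + 0"
    unfolding \<delta>_def
    by (intro tendsto_add tendsto_mult tendsto_const min_moment_tendsto lim_const_over_n
        tendsto_divide_0[OF tendsto_const] filterlim_at_top_imp_at_infinity
        sqrt_at_top[THEN filterlim_compose] filterlim_real_sequentially)
  then have lim: "(\<lambda>n. \<delta> n + A\<^sup>2 / sqrt (real n)) \<longlonglongrightarrow> 0"
    by simp
  show ?case
    by (rule tendsto_sandwich[OF _ _ tendsto_const lim])
       (auto intro!: always_eventually eventually_mono[OF eventually_gt_at_top[of 0] le])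
next
  case (trig_sum_add \<phi> \<psi>)
  note i = trig_sum_W_integrable[OF trig_sum_add.hyps(1)] trig_sum_W_integrable[OF trig_sum_add.hyps(2)]
    trig_sum_Z_integrable[OF trig_sum_add.hyps(1)] trig_sum_Z_integrable[OF trig_sum_add.hyps(2)]
  let ?e = "\<lambda>\<phi> n \<omega>. cond \<phi> n \<omega> - N.expectation (\<lambda>\<omega>. \<phi> (Z \<omega>))"
  have eq: "?e (\<lambda>y. \<phi> y + \<psi> y) n \<omega> = ?e \<phi> n \<omega> + ?e \<psi> n \<omega>" for n \<omega>
    using i by (simp add: cond_def)
  have "expectation (\<lambda>\<omega>. \<bar>?e (\<lambda>y. \<phi> y + \<psi> y) n \<omega>\<bar>) \<le> expectation (\<lambda>\<omega>. \<bar>?e \<phi> n \<omega>\<bar>) + expectation (\<lambda>\<omega>. \<bar>?e \<psi> n \<omega>\<bar>)" for n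
  proof -
    have "expectation (\<lambda>\<omega>. \<bar>?e (\<lambda>y. \<phi> y + \<psi> y) n \<omega>\<bar>) \<le> expectation (\<lambda>\<omega>. \<bar>?e \<phi> n \<omega>\<bar> + \<bar>?e \<psi> n \<omega>\<bar>)"
    proof (rule integral_mono)
      show "integrable M (\<lambda>\<omega>. \<bar>?e (\<lambda>y. \<phi> y + \<psi> y) n \<omega>\<bar>)"
        by (rule trig_sum_cond_integrable[OF trig_sum.trig_sum_add[OF trig_sum_add.hyps]])
    qed (use trig_sum_cond_integrable trig_sum_add.hyps eq in \<open>auto intro: abs_triangle_ineq\<close>)
    also have "\<dots> = expectation (\<lambda>\<omega>. \<bar>?e \<phi> n \<omega>\<bar>) + expectation (\<lambda>\<omega>. \<bar>?e \<psi> n \<omega>\<bar>)"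
      by (rule Bochner_Integration.integral_add[OF trig_sum_cond_integrable[OF trig_sum_add.hyps(1)]
            trig_sum_cond_integrable[OF trig_sum_add.hyps(2)]])
    finally show ?thesis .
  qed
  note le = this
  have lim: "(\<lambda>n. expectation (\<lambda>\<omega>. \<bar>?e \<phi> n \<omega>\<bar>) + expectation (\<lambda>\<omega>. \<bar>?e \<psi> n \<omega>\<bar>)) \<longlonglongrightarrow> 0"
    using tendsto_add[OF trig_sum_add.IH] by simp
  show ?case
    by (rule tendsto_sandwich[OF _ _ tendsto_const lim]) (use le in \<open>auto intro!: always_eventually\<close>)
next
  case (trig_sum_scale \<phi> c)
  have "\<bar>cond (\<lambda>y. c * \<phi> y) n \<omega> - N.expectation (\<lambda>\<omega>. c * \<phi> (Z \<omega>))\<bar>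
      = \<bar>c\<bar> * \<bar>cond \<phi> n \<omega> - N.expectation (\<lambda>\<omega>. \<phi> (Z \<omega>))\<bar>" for n \<omega>
    unfolding abs_mult[symmetric] by (simp add: cond_def right_diff_distrib)
  then show ?case
    using tendsto_mult[OF tendsto_const trig_sum_scale.IH, of "\<bar>c\<bar>"] by simp
qed

lemma variance_form_singleton_le: "variance_form {x} (\<lambda>_. 1) \<le> 1"
  unfolding variance_form_singleton using F_nonneg[of x] F_le_one[of x] by (intro mult_le_one) auto

lemma lipschitz_W_integrable:
  assumes "finite T" "0 \<le> K" "\<And>y. \<bar>g y\<bar> \<le> B" "\<And>y y'. \<bar>g y - g y'\<bar> \<le> K * (\<Sum>x\<in>T. \<bar>y x - y' x\<bar>)"
  shows "integrable M (\<lambda>\<omega>'. g (W n \<omega> \<omega>'))" "integrable N (\<lambda>\<omega>'. g (Z \<omega>'))"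
proof -
  show "integrable M (\<lambda>\<omega>'. g (W n \<omega> \<omega>'))"
    using assms(3) by (intro integrable_const_bound[where B = B] lipschitz_borel_measurable[OF assms(1,2,4)]) auto
  show "integrable N (\<lambda>\<omega>'. g (Z \<omega>'))"
    using assms(3) by (intro N.integrable_const_bound[where B = B] lipschitz_borel_measurable[OF assms(1,2,4)]) auto
qed

text \<open>Replacing \<open>g\<close> by its trigonometric interpolation \<open>G\<close> costs an
  amount governed by second moments, under both laws. Comparing \<open>G\<close> under the two laws,
  the coefficients are values of \<open>g\<close> and hence at most \<open>B\<close>. So
  \<open>R\<close> does not involve \<open>g\<close>.\<close>

lemma finite_dimensional_uniform_approx:
  assumes T: "finite T" and "0 \<le> K" "0 \<le> B" "0 < L" "0 < m"
  defines "R n \<omega> \<equiv> B * (\<Sum>f\<in>T \<rightarrow>\<^sub>E {..m}. \<bar>cond (sin_bernstein_prod L m T f) n \<omega> - N.expectation (\<lambda>\<omega>. sin_bernstein_prod L m T f (Z \<omega>))\<bar>)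
      + K * (\<Sum>x\<in>T. (expectation (\<lambda>\<omega>'. (W n \<omega> \<omega>' x)\<^sup>2) + N.expectation (\<lambda>\<omega>'. (Z \<omega>' x)\<^sup>2)) / L + 4 * L / sqrt (real m))"
  assumes gB: "\<And>y. \<bar>g y\<bar> \<le> B" and gL: "\<And>y y'. \<bar>g y - g y'\<bar> \<le> K * (\<Sum>x\<in>T. \<bar>y x - y' x\<bar>)"
  shows "\<bar>cond g n \<omega> - N.expectation (\<lambda>\<omega>. g (Z \<omega>))\<bar> \<le> R n \<omega>"
proof -
  let ?P = "T \<rightarrow>\<^sub>E {..m}" and ?\<psi> = "sin_bernstein_prod L m T"
  define p where "p f = g (\<lambda>x. sin_node L m (f x))" for f
  define G where "G y = (\<Sum>f\<in>?P. p f * ?\<psi> f y)" for y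
  note \<psi> = trig_sum_sin_bernstein_prod[OF T, of L m]
  have app: "\<bar>g y - G y\<bar> \<le> K * (\<Sum>x\<in>T. (y x)\<^sup>2 / L + 2 * L / sqrt (real m))" for y
    unfolding G_def p_def by (rule lipschitz_sin_bernstein_approx[OF T]) (use assms in auto)
  have GW: "integrable M (\<lambda>\<omega>'. G (W n \<omega> \<omega>'))" and GZ: "integrable N (\<lambda>\<omega>'. G (Z \<omega>'))"
    unfolding G_def using trig_sum_W_integrable[OF \<psi>] trig_sum_Z_integrable[OF \<psi>] by auto
  note gi = lipschitz_W_integrable[OF T \<open>0 \<le> K\<close> gB gL]
  have W2: "integrable M (\<lambda>\<omega>'. (W n \<omega> \<omega>' x)\<^sup>2)" for x
    using W_second_moment(1)[where T = "{x}" and s = "\<lambda>_. 1"] by simp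
  have W: "\<bar>cond g n \<omega> - cond G n \<omega>\<bar> \<le> K * (\<Sum>x\<in>T. expectation (\<lambda>\<omega>'. (W n \<omega> \<omega>' x)\<^sup>2) / L + 2 * L / sqrt (real m))"
  proof -
    have "\<bar>cond g n \<omega> - cond G n \<omega>\<bar> = \<bar>expectation (\<lambda>\<omega>'. g (W n \<omega> \<omega>') - G (W n \<omega> \<omega>'))\<bar>"
      unfolding cond_def using gi(1) GW by simp
    also have "\<dots> \<le> expectation (\<lambda>\<omega>'. \<bar>g (W n \<omega> \<omega>') - G (W n \<omega> \<omega>')\<bar>)"
      by (rule integral_abs_bound)
    also have "\<dots> \<le> expectation (\<lambda>\<omega>'. K * (\<Sum>x\<in>T. (W n \<omega> \<omega>' x)\<^sup>2 / L + 2 * L / sqrt (real m)))"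
      using gi(1) GW W2 by (intro integral_mono app) auto
    also have "\<dots> = K * (\<Sum>x\<in>T. expectation (\<lambda>\<omega>'. (W n \<omega> \<omega>' x)\<^sup>2) / L + 2 * L / sqrt (real m))"
      using W2 by (simp add: prob_space)
    finally show ?thesis .
  qed
  have Z: "\<bar>N.expectation (\<lambda>\<omega>. g (Z \<omega>)) - N.expectation (\<lambda>\<omega>. G (Z \<omega>))\<bar>
      \<le> K * (\<Sum>x\<in>T. N.expectation (\<lambda>\<omega>'. (Z \<omega>' x)\<^sup>2) / L + 2 * L / sqrt (real m))"
  proof -
    have "\<bar>N.expectation (\<lambda>\<omega>. g (Z \<omega>)) - N.expectation (\<lambda>\<omega>. G (Z \<omega>))\<bar> = \<bar>N.expectation (\<lambda>\<omega>'. g (Z \<omega>') - G (Z \<omega>'))\<bar>"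
      using gi(2) GZ by simp
    also have "\<dots> \<le> N.expectation (\<lambda>\<omega>'. \<bar>g (Z \<omega>') - G (Z \<omega>')\<bar>)"
      by (rule integral_abs_bound)
    also have "\<dots> \<le> N.expectation (\<lambda>\<omega>'. K * (\<Sum>x\<in>T. (Z \<omega>' x)\<^sup>2 / L + 2 * L / sqrt (real m)))"
      using gi(2) GZ Z_square_integrable by (intro integral_mono app) auto
    also have "\<dots> = K * (\<Sum>x\<in>T. N.expectation (\<lambda>\<omega>'. (Z \<omega>' x)\<^sup>2) / L + 2 * L / sqrt (real m))"
      using Z_square_integrable by (simp add: N.prob_space)
    finally show ?thesis .
  qed
  have "cond G n \<omega> - N.expectation (\<lambda>\<omega>. G (Z \<omega>))
      = (\<Sum>f\<in>?P. p f * (cond (?\<psi> f) n \<omega> - N.expectation (\<lambda>\<omega>. ?\<psi> f (Z \<omega>))))"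
    unfolding G_def cond_def using trig_sum_W_integrable[OF \<psi>] trig_sum_Z_integrable[OF \<psi>]
    by (simp add: right_diff_distrib sum_subtractf)
  then have "\<bar>cond G n \<omega> - N.expectation (\<lambda>\<omega>. G (Z \<omega>))\<bar>
      \<le> (\<Sum>f\<in>?P. \<bar>p f * (cond (?\<psi> f) n \<omega> - N.expectation (\<lambda>\<omega>. ?\<psi> f (Z \<omega>)))\<bar>)"
    by (simp only: sum_abs)
  also have "\<dots> \<le> (\<Sum>f\<in>?P. B * \<bar>cond (?\<psi> f) n \<omega> - N.expectation (\<lambda>\<omega>. ?\<psi> f (Z \<omega>))\<bar>)"
    unfolding abs_mult p_def by (intro sum_mono mult_right_mono gB abs_ge_zero)
  finally have G: "\<bar>cond G n \<omega> - N.expectation (\<lambda>\<omega>. G (Z \<omega>))\<bar>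
      \<le> B * (\<Sum>f\<in>?P. \<bar>cond (?\<psi> f) n \<omega> - N.expectation (\<lambda>\<omega>. ?\<psi> f (Z \<omega>))\<bar>)"
    unfolding sum_distrib_left .
  have "K * (\<Sum>x\<in>T. expectation (\<lambda>\<omega>'. (W n \<omega> \<omega>' x)\<^sup>2) / L + 2 * L / sqrt (real m))
      + K * (\<Sum>x\<in>T. N.expectation (\<lambda>\<omega>'. (Z \<omega>' x)\<^sup>2) / L + 2 * L / sqrt (real m))
    = K * (\<Sum>x\<in>T. (expectation (\<lambda>\<omega>'. (W n \<omega> \<omega>' x)\<^sup>2) + N.expectation (\<lambda>\<omega>'. (Z \<omega>' x)\<^sup>2)) / L + 4 * L / sqrt (real m))"
    unfolding distrib_left[symmetric] sum.distrib[symmetric]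
    by (intro arg_cong[where f = "\<lambda>c. K * c"] sum.cong) (simp_all add: add_divide_distrib)
  with W Z G show ?thesis
    unfolding R_def by linarith
qed

text \<open>The order of choice is \<open>L\<close>, then \<open>m\<close>, then \<open>n\<close>: a
  large \<open>L\<close> beats the second moments, a large \<open>m\<close> beats the factor
  \<open>L\<close>, and the weights that are then fixed are finitely many and converge in mean. Each
  step takes a third of \<open>\<epsilon>\<close>.\<close>

lemma finite_dimensional_uniform:
  assumes T: "finite T" and K: "0 \<le> K" and B: "0 \<le> B" and "0 < \<epsilon>"
  obtains R :: "nat \<Rightarrow> 'a \<Rightarrow> real" where "\<And>n. integrable M (R n)" "\<forall>\<^sub>F n in sequentially. expectation (R n) \<le> \<epsilon>"
    "\<And>g n \<omega>. (\<And>y. \<bar>g y\<bar> \<le> B) \<Longrightarrow> (\<And>y y'. \<bar>g y - g y'\<bar> \<le> K * (\<Sum>x\<in>T. \<bar>y x - y' x\<bar>)) \<Longrightarrow>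
      \<bar>cond g n \<omega> - N.expectation (\<lambda>\<omega>. g (Z \<omega>))\<bar> \<le> R n \<omega>"
proof -
  define c where "c = real (card T) * K"
  have c: "0 \<le> c" using K by (simp add: c_def)
  \<comment> \<open>Makes \<open>c * (2 / L) \<le> \<epsilon> / 3\<close>; the 2 adds the second
    moments of process and limit, at most 1 each in mean.\<close>
  define L where "L = 1 + 6 * c / \<epsilon>"
  have L: "0 < L" using c \<open>0 < \<epsilon>\<close> unfolding L_def by (simp add: add_pos_nonneg)
  \<comment> \<open>Makes \<open>c * (4 * L / sqrt m) \<le> \<epsilon> / 3\<close>; the added 1
    keeps \<open>m\<close> positive.\<close>
  obtain m :: nat where m: "(12 * c * L / \<epsilon>)\<^sup>2 + 1 < real m"
    using reals_Archimedean2 by blast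
  then have "0 < real m"
    using zero_le_power2[of "12 * c * L / \<epsilon>"] by linarith
  then have m0: "0 < m" by simp
  define S where "S n \<omega> = (\<Sum>f\<in>T \<rightarrow>\<^sub>E {..m}. \<bar>cond (sin_bernstein_prod L m T f) n \<omega> - N.expectation (\<lambda>\<omega>. sin_bernstein_prod L m T f (Z \<omega>))\<bar>)" for n \<omega>
  define Q where "Q n \<omega> = (\<Sum>x\<in>T. (expectation (\<lambda>\<omega>'. (W n \<omega> \<omega>' x)\<^sup>2) + N.expectation (\<lambda>\<omega>'. (Z \<omega>' x)\<^sup>2)) / L + 4 * L / sqrt (real m))" for n \<omega>
  note \<psi> = trig_sum_sin_bernstein_prod[OF T, of L m]
  have Si: "integrable M (S n)" for n
    unfolding S_def by (intro Bochner_Integration.integrable_sum trig_sum_cond_integrable[OF \<psi>])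
  have Wi: "integrable M (\<lambda>\<omega>. expectation (\<lambda>\<omega>'. (W n \<omega> \<omega>' x)\<^sup>2))" for n x
    using combination_square_integrable[where T = "{x}" and s = "\<lambda>_. 1"] W_second_moment(2)[where T = "{x}" and s = "\<lambda>_. 1"] by simp
  have Qi: "integrable M (Q n)" for n
    unfolding Q_def using Wi by auto
  have EQ: "K * expectation (Q n) \<le> 2 / 3 * \<epsilon>" if "0 < n" for n
  proof -
    have s1: "expectation (\<lambda>\<omega>. expectation (\<lambda>\<omega>'. (W n \<omega> \<omega>' x)\<^sup>2)) \<le> 1" and s2: "N.expectation (\<lambda>\<omega>'. (Z \<omega>' x)\<^sup>2) \<le> 1" for x
      using W_second_moment_expectation[OF that, where T = "{x}" and s = "\<lambda>_. 1"] Z_combination_second_moment[where T = "{x}" and s = "\<lambda>_. 1"]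
        variance_form_singleton_le[of x] by simp_all
    have s: "expectation (\<lambda>\<omega>. expectation (\<lambda>\<omega>'. (W n \<omega> \<omega>' x)\<^sup>2)) + N.expectation (\<lambda>\<omega>'. (Z \<omega>' x)\<^sup>2) \<le> 2" for x
      using add_mono[OF s1[of x] s2[of x]] by simp
    have "expectation (Q n) = (\<Sum>x\<in>T. (expectation (\<lambda>\<omega>. expectation (\<lambda>\<omega>'. (W n \<omega> \<omega>' x)\<^sup>2)) + N.expectation (\<lambda>\<omega>'. (Z \<omega>' x)\<^sup>2)) / L + 4 * L / sqrt (real m))"
      unfolding Q_def using Wi by (simp add: prob_space)
    also have "\<dots> \<le> (\<Sum>x\<in>T. 2 / L + 4 * L / sqrt (real m))"
      using s L by (intro sum_mono add_right_mono divide_right_mono) auto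
    finally have "K * expectation (Q n) \<le> K * (real (card T) * (2 / L + 4 * L / sqrt (real m)))"
      using K by (intro mult_left_mono) simp_all
    then have "K * expectation (Q n) \<le> c * (2 / L + 4 * L / sqrt (real m))"
      by (simp only: c_def mult_ac)
    moreover have "c * (2 / L) \<le> \<epsilon> / 3"
    proof -
      have "c * 2 \<le> \<epsilon> / 3 * L"
        unfolding L_def using \<open>0 < \<epsilon>\<close> c by (simp add: field_simps)
      then show ?thesis using L by (simp add: field_simps)
    qed
    moreover have "c * (4 * L / sqrt (real m)) \<le> \<epsilon> / 3"
    proof -
      have "12 * c * L / \<epsilon> \<le> sqrt (real m)"
        using m by (intro real_le_rsqrt) simp
      then have "c * (4 * L) \<le> \<epsilon> / 3 * sqrt (real m)"
        using \<open>0 < \<epsilon>\<close> by (simp add: field_simps)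
      then show ?thesis using m0 by (simp add: field_simps)
    qed
    ultimately show ?thesis by (simp add: distrib_left)
  qed
  have "(\<lambda>n. expectation (S n)) \<longlonglongrightarrow> (\<Sum>f\<in>T \<rightarrow>\<^sub>E {..m}. 0)"
  proof -
    have "expectation (S n) = (\<Sum>f\<in>T \<rightarrow>\<^sub>E {..m}. expectation (\<lambda>\<omega>. \<bar>cond (sin_bernstein_prod L m T f) n \<omega> - N.expectation (\<lambda>\<omega>. sin_bernstein_prod L m T f (Z \<omega>))\<bar>))" for n
      unfolding S_def by (intro Bochner_Integration.integral_sum trig_sum_cond_integrable[OF \<psi>])
    then show ?thesis
      by (simp only:) (intro tendsto_sum trig_sum_converges[OF \<psi> T])
  qed
  then have "(\<lambda>n. B * expectation (S n)) \<longlonglongrightarrow> 0"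
    by (intro tendsto_mult_right_zero) simp
  from order_tendstoD(2)[OF this, of "\<epsilon> / 3"]
  have ev: "\<forall>\<^sub>F n in sequentially. B * expectation (S n) < \<epsilon> / 3"
    using \<open>0 < \<epsilon>\<close> by simp
  show ?thesis
  proof (rule that[of "\<lambda>n \<omega>. B * S n \<omega> + K * Q n \<omega>"])
    show "integrable M (\<lambda>\<omega>. B * S n \<omega> + K * Q n \<omega>)" for n
      using Si Qi by auto
    show "\<forall>\<^sub>F n in sequentially. expectation (\<lambda>\<omega>. B * S n \<omega> + K * Q n \<omega>) \<le> \<epsilon>"
      using ev eventually_gt_at_top[of 0]
    proof eventually_elim
      case (elim n)
      then show ?case using EQ[of n] Si[of n] Qi[of n] by simp
    qed
  next
    fix g n \<omega>
    assume "\<And>y. \<bar>g y\<bar> \<le> B" "\<And>y y'. \<bar>g y - g y'\<bar> \<le> K * (\<Sum>x\<in>T. \<bar>y x - y' x\<bar>)"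
    then show "\<bar>cond g n \<omega> - N.expectation (\<lambda>\<omega>. g (Z \<omega>))\<bar> \<le> B * S n \<omega> + K * Q n \<omega>"
      unfolding S_def Q_def by (rule finite_dimensional_uniform_approx[OF T K B L m0])
  qed
qed

end

section \<open>Step function approximation of the processes\<close>

text \<open>Jensen's inequality for the square root, as an instance of Cauchy-Schwarz.\<close>

lemma (in prob_space) expectation_sqrt_le:
  assumes "integrable M v" and "\<And>\<omega>. 0 \<le> v \<omega>"
  shows "(\<integral>\<^sup>+\<omega>. ennreal (sqrt (v \<omega>)) \<partial>M) \<le> ennreal (sqrt (expectation v))"
proof -
  have v: "integrable M (\<lambda>\<omega>. (sqrt (v \<omega>))\<^sup>2)"
    using assms by simp
  have [measurable]: "v \<in> borel_measurable M"
    using assms(1) by auto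
  note * = expectation_abs_le_sqrt[OF _ v]
  have "(\<integral>\<^sup>+\<omega>. ennreal (sqrt (v \<omega>)) \<partial>M) = ennreal (expectation (\<lambda>\<omega>. sqrt (v \<omega>)))"
    using assms * by (intro nn_integral_eq_integral) auto
  also have "\<dots> \<le> ennreal (sqrt (expectation v))"
    using * assms(2) by (intro ennreal_leI) simp
  finally show ?thesis .
qed

context multiplier_sample
begin

lemma centred_pair_measurable [measurable]:
  assumes [measurable]: "f \<in> borel_measurable Q" "g \<in> measurable Q M"
  shows "(\<lambda>q. centred (f q) i (g q)) \<in> borel_measurable Q"
proof -
  \<comment> \<open>Written as a comparison, the indicator is visibly measurable jointly in the
    threshold and the sample point.\<close>
  have "centred (f q) i (g q) = (if X i (g q) \<le> f q then 1 else 0) - F (f q)" for q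
    by (simp add: centred_def)
  then show ?thesis by simp
qed

lemma W_joint_measurable [measurable]:
  assumes [measurable]: "f \<in> borel_measurable Q" "g \<in> measurable Q M" "h \<in> measurable Q M"
  shows "(\<lambda>q. W n (g q) (h q) (f q)) \<in> borel_measurable Q"
  unfolding W_eq by measurable

text \<open>Cauchy-Schwarz given the sample and Jensen over the sample reduce the double expectation
  to the root of the mean conditional variance.\<close>

lemma W_abs_expectation_le:
  assumes "0 < n"
  shows "(\<integral>\<^sup>+\<omega>. \<integral>\<^sup>+\<omega>'. ennreal \<bar>\<Sum>x\<in>T. s x * W n \<omega> \<omega>' x\<bar> \<partial>M \<partial>M) \<le> ennreal (sqrt (variance_form T s))"
proof -
  have "(\<integral>\<^sup>+\<omega>'. ennreal \<bar>\<Sum>x\<in>T. s x * W n \<omega> \<omega>' x\<bar> \<partial>M) \<le> ennreal (sqrt ((\<Sum>i<n. (combination T s i \<omega>)\<^sup>2) / real n))" for \<omega>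
  proof -
    note * = expectation_abs_le_sqrt[OF _ W_second_moment(1)[where T = T and s = s]]
    have "(\<integral>\<^sup>+\<omega>'. ennreal \<bar>\<Sum>x\<in>T. s x * W n \<omega> \<omega>' x\<bar> \<partial>M) = ennreal (expectation (\<lambda>\<omega>'. \<bar>\<Sum>x\<in>T. s x * W n \<omega> \<omega>' x\<bar>))"
      using *(1) by (intro nn_integral_eq_integral) auto
    also have "\<dots> \<le> ennreal (sqrt ((\<Sum>i<n. (combination T s i \<omega>)\<^sup>2) / real n))"
      using *(2) unfolding W_second_moment(2) by (intro ennreal_leI) simp
    finally show ?thesis .
  qed
  then have "(\<integral>\<^sup>+\<omega>. \<integral>\<^sup>+\<omega>'. ennreal \<bar>\<Sum>x\<in>T. s x * W n \<omega> \<omega>' x\<bar> \<partial>M \<partial>M)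
      \<le> (\<integral>\<^sup>+\<omega>. ennreal (sqrt ((\<Sum>i<n. (combination T s i \<omega>)\<^sup>2) / real n)) \<partial>M)"
    by (intro nn_integral_mono) simp
  also have "\<dots> \<le> ennreal (sqrt (expectation (\<lambda>\<omega>. (\<Sum>i<n. (combination T s i \<omega>)\<^sup>2) / real n)))"
    using combination_square_integrable by (intro expectation_sqrt_le) (auto intro!: divide_nonneg_nonneg sum_nonneg)
  also have "expectation (\<lambda>\<omega>. (\<Sum>i<n. (combination T s i \<omega>)\<^sup>2) / real n) = variance_form T s"
    using combination_square_integrable assms by (simp add: combination_second_moment)
  finally show ?thesis .
qed

text \<open>The left-hand side is the variance \<open>p - p\<^sup>2\<close> of the indicator of
  \<open>{a<..x}\<close>, with \<open>p = F x - F a\<close>.\<close>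

lemma variance_form_difference:
  assumes "a < x"
  shows "variance_form {a, x} (\<lambda>y. if y = x then 1 else - 1) \<le> F x - F a"
proof -
  have "variance_form {a, x} (\<lambda>y. if y = x then 1 else - 1) = (F x - F a) - (F x - F a)\<^sup>2"
    using assms by (simp add: variance_form_def covariance_def min_def power2_eq_square algebra_simps)
  then show ?thesis by simp
qed

lemma W_increment_expectation:
  assumes "0 < n" "a \<le> x"
  shows "(\<integral>\<^sup>+\<omega>. \<integral>\<^sup>+\<omega>'. ennreal \<bar>W n \<omega> \<omega>' x - W n \<omega> \<omega>' a\<bar> \<partial>M \<partial>M) \<le> ennreal (sqrt (F x - F a))"
proof (cases "a = x")
  case False
  let ?s = "\<lambda>y. if y = x then 1 else - 1 :: real"
  have "(\<integral>\<^sup>+\<omega>. \<integral>\<^sup>+\<omega>'. ennreal \<bar>W n \<omega> \<omega>' x - W n \<omega> \<omega>' a\<bar> \<partial>M \<partial>M)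
      = (\<integral>\<^sup>+\<omega>. \<integral>\<^sup>+\<omega>'. ennreal \<bar>\<Sum>y\<in>{a, x}. ?s y * W n \<omega> \<omega>' y\<bar> \<partial>M \<partial>M)"
    using False by simp
  also have "\<dots> \<le> ennreal (sqrt (variance_form {a, x} ?s))"
    by (rule W_abs_expectation_le[OF assms(1)])
  also have "\<dots> \<le> ennreal (sqrt (F x - F a))"
    using variance_form_difference[of a x] assms False by (intro ennreal_leI real_sqrt_le_mono) auto
  finally show ?thesis .
qed simp

lemma W_expectation:
  assumes "0 < n"
  shows "(\<integral>\<^sup>+\<omega>. \<integral>\<^sup>+\<omega>'. ennreal \<bar>W n \<omega> \<omega>' x\<bar> \<partial>M \<partial>M) \<le> ennreal (sqrt (F x * (1 - F x)))"
  using W_abs_expectation_le[OF assms, where T = "{x}" and s = "\<lambda>_. 1"] by (simp add: variance_form_singleton)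

section \<open>Quantile cells, knots and the step projection\<close>

definition cell :: "nat \<Rightarrow> real \<Rightarrow> nat" where
  "cell k x = nat \<lfloor>real k * F x\<rfloor>"

text \<open>The \<open>j / k\<close> quantile of \<open>D\<close>. For \<open>1 \<le> j < k\<close>
  it is the left end point of cell \<open>j\<close> whenever that cell is nonempty; a jump of
  \<open>F\<close> can make several knots coincide.\<close>

definition knot :: "nat \<Rightarrow> nat \<Rightarrow> real" where
  "knot k j = Inf {y. real j / real k \<le> F y}"

text \<open>Leaves out the levels 0, \<open>k - 1\<close> and \<open>k\<close>, the last one being
  taken where \<open>F x = 1\<close>. These are the tails, where \<open>F\<close> or
  \<open>1 - F\<close> is at most \<open>1 / k\<close>.\<close>

definition inner_cell :: "nat \<Rightarrow> real \<Rightarrow> bool" where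
  "inner_cell k x \<longleftrightarrow> 1 \<le> cell k x \<and> cell k x + 2 \<le> k"

text \<open>Vanishing in the tails keeps the projection integrable even under an infinite measure,
  as the inner cells have finite mass.\<close>

definition proj :: "nat \<Rightarrow> (real \<Rightarrow> real) \<Rightarrow> real \<Rightarrow> real" where
  "proj k z x = (if inner_cell k x then z (knot k (cell k x)) else 0)"

definition knots :: "nat \<Rightarrow> real set" where
  "knots k = knot k ` {1..k - 2}"

lemma finite_knots [simp]: "finite (knots k)"
  by (simp add: knots_def)

lemma cell_measurable [measurable]: "cell k \<in> measurable borel (count_space UNIV)"
  unfolding cell_def by measurable

lemma inner_cell_measurable [measurable]: "Measurable.pred borel (inner_cell k)"
  unfolding inner_cell_def by measurable

lemma cell_bounds: "real (cell k x) \<le> real k * F x" "real k * F x < real (cell k x) + 1"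
proof -
  have "0 \<le> real k * F x" by simp
  then show "real (cell k x) \<le> real k * F x" "real k * F x < real (cell k x) + 1"
    unfolding cell_def by (simp_all add: of_nat_nat)
qed

lemma cell_mono: "x \<le> y \<Longrightarrow> cell k x \<le> cell k y"
  unfolding cell_def by (intro nat_mono floor_mono mult_left_mono F_mono) auto

text \<open>The Galois connection between quantiles and the distribution function, valid for levels
  strictly between 0 and 1.\<close>

lemma knot_le_iff:
  assumes "1 \<le> j" "j < k"
  shows "knot k j \<le> x \<longleftrightarrow> real j / real k \<le> F x"
  unfolding knot_def using assms by (subst D.pseudoinverse[symmetric]) auto

lemma F_knot: "1 \<le> j \<Longrightarrow> j < k \<Longrightarrow> real j / real k \<le> F (knot k j)"
  using knot_le_iff[of j k "knot k j"] by simp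

lemma knot_le:
  assumes "1 \<le> j" "j < k" "j \<le> cell k x"
  shows "knot k j \<le> x"
proof -
  have "real j \<le> real k * F x"
    using cell_bounds(1)[of k x] assms by linarith
  then show ?thesis
    using assms by (subst knot_le_iff) (auto simp: field_simps)
qed

lemma inner_cell_knot:
  assumes "inner_cell k x"
  shows "knot k (cell k x) \<le> x" "F x - F (knot k (cell k x)) \<le> 1 / real k" "knot k (cell k x) \<in> knots k"
    "1 / real k \<le> F x" "1 / real k \<le> 1 - F x"
proof -
  have c: "1 \<le> cell k x" "cell k x < k" "cell k x + 2 \<le> k"
    using assms by (auto simp: inner_cell_def)
  then have k: "0 < real k" by simp
  show "knot k (cell k x) \<le> x"
    using c by (intro knot_le) auto
  have "F x < (real (cell k x) + 1) / real k"
    using cell_bounds(2)[of k x] k by (simp add: field_simps)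
  then show "F x - F (knot k (cell k x)) \<le> 1 / real k"
    using F_knot[OF c(1,2)] by (simp add: add_divide_distrib)
  show "knot k (cell k x) \<in> knots k"
    using c by (auto simp: knots_def)
  have "1 \<le> real k * F x" "real k * F x \<le> real k - 1"
    using cell_bounds[of k x] c by linarith+
  then show "1 / real k \<le> F x" "1 / real k \<le> 1 - F x"
    using k by (simp_all add: field_simps)
qed

lemma not_inner_cell:
  assumes "\<not> inner_cell k x" "2 \<le> k"
  shows "cell k x = 0 \<and> F x < 1 / real k \<or> k - 1 \<le> cell k x \<and> 1 - F x \<le> 1 / real k"
proof (cases "cell k x = 0")
  case True
  then show ?thesis
    using cell_bounds(2)[of k x] assms by (auto simp: field_simps)
next
  case False
  then have c: "k - 1 \<le> cell k x"
    using assms by (auto simp: inner_cell_def)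
  then have "real k - 1 \<le> real k * F x"
    using cell_bounds(1)[of k x] assms by (simp add: of_nat_diff)
  then show ?thesis
    using c assms by (auto simp: field_simps)
qed

lemma F_right_continuous: "continuous (at_right x) F"
  by (rule D.cont)

text \<open>Monotonicity and right continuity of \<open>F\<close> make the cell constant on some
  interval to the right of \<open>x\<close>.\<close>

lemma proj_right_continuous: "continuous (at_right x) (proj k z)"
proof -
  have "(F \<longlongrightarrow> F x) (at_right x)"
    using F_right_continuous by (simp add: continuous_within)
  then have lim: "((\<lambda>y. real k * F y) \<longlongrightarrow> real k * F x) (at_right x)"
    by (intro tendsto_mult tendsto_const)
  have "\<forall>\<^sub>F y in at_right x. real k * F y < real (cell k x) + 1"
    using order_tendstoD(2)[OF lim cell_bounds(2)] .
  moreover have "\<forall>\<^sub>F y in at_right x. x < y"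
    by (simp add: eventually_at_right_less)
  ultimately have "\<forall>\<^sub>F y in at_right x. cell k y = cell k x"
  proof eventually_elim
    case (elim y)
    have "cell k x \<le> cell k y" using elim by (intro cell_mono) simp
    moreover have "real (cell k y) < real (cell k x) + 1"
      using elim cell_bounds(1)[of k y] by linarith
    ultimately show ?case by linarith
  qed
  then have "\<forall>\<^sub>F y in at_right x. proj k z y = proj k z x"
    by eventually_elim (simp add: proj_def inner_cell_def)
  then show ?thesis
    unfolding continuous_within by (rule tendsto_eventually)
qed

lemma proj_measurable [measurable]: "proj k z \<in> borel_measurable borel"
proof -
  have "(\<lambda>x. (\<lambda>j. z (knot k j)) (cell k x)) \<in> borel_measurable borel"
    by (rule measurable_compose[OF cell_measurable]) simp
  then show ?thesis
    unfolding proj_def[abs_def] by measurable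
qed

lemma proj_diff_le:
  "\<bar>proj k y x - proj k y' x\<bar> \<le> indicator {x. inner_cell k x} x * (\<Sum>a\<in>knots k. \<bar>y a - y' a\<bar>)"
  using inner_cell_knot(3)[of k x]
    member_le_sum[of "knot k (cell k x)" "knots k" "\<lambda>a. \<bar>y a - y' a\<bar>"]
  by (auto simp: proj_def)

text \<open>A bound for the mean absolute error of the projection at \<open>x\<close>: the root of a
  variance bound, for an increment on inner cells and for the whole coordinate in the tails.\<close>

definition L1_modulus :: "nat \<Rightarrow> real \<Rightarrow> real" where
  "L1_modulus k x = (if inner_cell k x then sqrt (F x - F (knot k (cell k x))) else sqrt (F x * (1 - F x)))"

lemma L1_modulus_measurable [measurable]: "L1_modulus k \<in> borel_measurable borel"
proof -
  have [measurable]: "(\<lambda>x. (\<lambda>j. F (knot k j)) (cell k x)) \<in> borel_measurable borel"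
    by (rule measurable_compose[OF cell_measurable]) simp
  show ?thesis
    unfolding L1_modulus_def[abs_def] by measurable
qed

text \<open>On an inner cell one of \<open>F x\<close> and \<open>1 - F x\<close> is at least
  \<open>1 / 2\<close> and the other at least \<open>1 / k\<close>, so the product is at least
  \<open>1 / (2 * k)\<close>, while \<open>F\<close> grows by at most \<open>1 / k\<close> from the
  knot. A factor 4 in place of 2 gives a round square root.\<close>

lemma L1_modulus_dominated:
  assumes "2 \<le> k"
  shows "L1_modulus k x \<le> 2 * sqrt (F x * (1 - F x))"
proof (cases "inner_cell k x")
  case True
  note i = inner_cell_knot[OF True]
  have *: "F x - F (knot k (cell k x)) \<le> 4 * P" if "1 / real k * (1 / 2) \<le> P" for P
  proof -
    have "d \<le> 4 * P" if "0 \<le> u" "u * (1 / 2) \<le> P" "d \<le> u" for d u :: real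
      using that by linarith
    from this[OF _ that i(2)] show ?thesis by simp
  qed
  have "F x - F (knot k (cell k x)) \<le> 4 * (F x * (1 - F x))"
  proof (cases "F x \<le> 1 / 2")
    case True
    then have "1 / real k * (1 / 2) \<le> F x * (1 - F x)"
      using i by (intro mult_mono) auto
    then show ?thesis by (rule *)
  next
    case False
    then have "1 / 2 * (1 / real k) \<le> F x * (1 - F x)"
      using i by (intro mult_mono) auto
    then have "1 / real k * (1 / 2) \<le> F x * (1 - F x)"
      by (simp only: mult.commute)
    then show ?thesis by (rule *)
  qed
  then have "L1_modulus k x \<le> sqrt (4 * (F x * (1 - F x)))"
    using True unfolding L1_modulus_def by (simp del: real_sqrt_le_iff add: real_sqrt_le_mono)
  also have "\<dots> = 2 * sqrt (F x * (1 - F x))"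
    unfolding real_sqrt_mult[of 4] by simp
  finally show ?thesis .
next
  case False
  then show ?thesis by (simp add: L1_modulus_def)
qed

lemma L1_modulus_le:
  assumes "2 \<le> k"
  shows "L1_modulus k x \<le> sqrt (1 / real k)"
proof (cases "inner_cell k x")
  case True
  then show ?thesis
    using inner_cell_knot(2)[OF True] by (simp add: L1_modulus_def del: real_sqrt_le_iff add: real_sqrt_le_mono)
next
  case False
  have "F x * (1 - F x) \<le> 1 / real k"
    using not_inner_cell[OF False assms]
  proof
    assume "cell k x = 0 \<and> F x < 1 / real k"
    then show ?thesis using mult_left_le[of "1 - F x" "F x"] by simp
  next
    assume "k - 1 \<le> cell k x \<and> 1 - F x \<le> 1 / real k"
    then show ?thesis using mult_left_le_one_le[of "1 - F x" "F x"] by simp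
  qed
  then show ?thesis
    using False by (simp add: L1_modulus_def del: real_sqrt_le_iff add: real_sqrt_le_mono)
qed

lemma L1_modulus_nonneg: "0 \<le> L1_modulus k x"
proof (cases "inner_cell k x")
  case True
  then show ?thesis
    using F_mono[OF inner_cell_knot(1)[OF True]] by (simp add: L1_modulus_def)
qed (simp add: L1_modulus_def)

lemma W_proj_expectation:
  assumes "0 < n"
  shows "(\<integral>\<^sup>+\<omega>. \<integral>\<^sup>+\<omega>'. ennreal \<bar>W n \<omega> \<omega>' x - proj k (W n \<omega> \<omega>') x\<bar> \<partial>M \<partial>M) \<le> ennreal (L1_modulus k x)"
proof (cases "inner_cell k x")
  case True
  then show ?thesis
    using W_increment_expectation[OF assms inner_cell_knot(1)[OF True]] by (simp add: proj_def L1_modulus_def)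
next
  case False
  then show ?thesis
    using W_expectation[OF assms, of x] by (simp add: proj_def L1_modulus_def)
qed

end

section \<open>Uniform oscillation between knots\<close>

context multiplier_sample
begin

text \<open>The left end point is removed so that an atom sitting there does not count: the mass is
  then at most \<open>1 / k\<close>, and increments from the knot see only observations strictly to
  its right. The \<open>min\<close> merges the points of level \<open>k\<close> with the last
  cell.\<close>

definition region :: "nat \<Rightarrow> nat \<Rightarrow> real set" where
  "region k j = {y. min (cell k y) (k - 1) = j \<and> (j = 0 \<or> knot k j < y)}"

lemma region_measurable [measurable]: "region k j \<in> sets borel"
  unfolding region_def by measurable

lemma disjoint_region: "disjoint_family_on (region k) J"
  by (auto simp: disjoint_family_on_def region_def)

text \<open>The mass is the left limit of \<open>F\<close>, which stays below the level
  \<open>j / k\<close> until the quantile is reached.\<close>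

lemma measure_below_knot:
  assumes "1 \<le> j" "j < k"
  shows "measure D {..<knot k j} \<le> real j / real k"
proof (rule tendsto_upperbound)
  show "(F \<longlongrightarrow> measure D {..<knot k j}) (at_left (knot k j))"
    using D.cdf_at_left .
  have "\<forall>\<^sub>F y in at_left (knot k j). y < knot k j"
    by (simp add: eventually_at_left_field) (meson lt_ex)
  then show "\<forall>\<^sub>F y in at_left (knot k j). F y \<le> real j / real k"
  proof eventually_elim
    case (elim y)
    then show ?case
      using knot_le_iff[OF assms, of y] by linarith
  qed
qed simp

lemma measure_region_le:
  assumes "2 \<le> k" "j < k"
  shows "measure D (region k j) \<le> 1 / real k"
proof (cases "j = 0")
  case True
  have "region k j \<subseteq> {..<knot k 1}"
  proof
    fix y assume "y \<in> region k j"
    then have "cell k y = 0"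
      using assms True by (auto simp: region_def)
    then have "F y < real 1 / real k"
      using cell_bounds(2)[of k y] assms by (simp add: field_simps)
    then show "y \<in> {..<knot k 1}"
      using knot_le_iff[of 1 k y] assms by auto
  qed
  then have "measure D (region k j) \<le> measure D {..<knot k 1}"
    by (intro D.finite_measure_mono) auto
  also have "\<dots> \<le> 1 / real k"
    using measure_below_knot[of 1 k] assms by simp
  finally show ?thesis .
next
  case False
  then have j: "1 \<le> j" by simp
  note Fk = F_knot[OF j \<open>j < k\<close>]
  have le: "measure D {..knot k j} = F (knot k j)" for k j
    by (simp add: F cdf_def)
  show ?thesis
  proof (cases "j = k - 1")
    case True
    have "measure D (region k j) \<le> measure D (UNIV - {..knot k j})"
      using False by (intro D.finite_measure_mono) (auto simp: region_def)
    also have "\<dots> = 1 - F (knot k j)"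
      using D.prob_compl[of "{..knot k j}"] by (simp add: le)
    also have "\<dots> \<le> 1 - real j / real k"
      using Fk by simp
    also have "\<dots> = 1 / real k"
      using True assms by (simp add: field_simps of_nat_diff)
    finally show ?thesis .
  next
    case no: False
    have sub: "region k j \<subseteq> {..<knot k (j + 1)} - {..knot k j}"
    proof
      fix y assume y: "y \<in> region k j"
      then have "cell k y = j" "knot k j < y"
        using False no by (auto simp: region_def)
      moreover from this have "F y < real (j + 1) / real k"
        using cell_bounds(2)[of k y] assms by (simp add: field_simps)
      moreover have "j + 1 < k"
        using no assms by simp
      ultimately show "y \<in> {..<knot k (j + 1)} - {..knot k j}"
        using knot_le_iff[of "j + 1" k y] by auto
    qed
    show ?thesis
    \<comment> \<open>Knots coincide when a jump of \<open>F\<close> passes several levels; the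
      region is then empty.\<close>
    proof (cases "knot k j < knot k (j + 1)")
      case True
      have "measure D (region k j) \<le> measure D ({..<knot k (j + 1)} - {..knot k j})"
        using sub by (intro D.finite_measure_mono) auto
      also have "\<dots> = measure D {..<knot k (j + 1)} - measure D {..knot k j}"
        using True by (intro D.finite_measure_Diff) auto
      also have "\<dots> \<le> real (j + 1) / real k - real j / real k"
        using measure_below_knot[of "j + 1" k] Fk no assms unfolding le by (intro diff_mono) auto
      finally show ?thesis
        by (simp add: diff_divide_distrib[symmetric])
    next
      case False
      then have "region k j = {}" using sub by force
      then show ?thesis by simp
    qed
  qed
qed

definition region_count :: "nat \<Rightarrow> nat \<Rightarrow> 'a \<Rightarrow> nat \<Rightarrow> nat" where
  "region_count k n \<omega> j = card {i. i < n \<and> X i \<omega> \<in> region k j}"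

lemma region_count_eq: "real (region_count k n \<omega> j) = (\<Sum>i<n. indicator (region k j) (X i \<omega>))"
  by (simp add: region_count_def indicator_def sum.If_cases Int_def)

text \<open>A relative frequency with success probability \<open>p\<close> has second moment at most
  \<open>p / n + p\<^sup>2\<close>. By \<open>p \<le> 1 / k\<close> this is at most
  \<open>p * (1 / n + 1 / k)\<close>, and the probabilities of disjoint regions add up to at most
  1.\<close>

lemma region_count_second_moment:
  assumes "2 \<le> k" "0 < n"
  shows "integrable M (\<lambda>\<omega>. \<Sum>j<k. (real (region_count k n \<omega> j) / real n)\<^sup>2)"
    and "expectation (\<lambda>\<omega>. \<Sum>j<k. (real (region_count k n \<omega> j) / real n)\<^sup>2) \<le> 1 / real n + 1 / real k"
proof -
  define p where "p j = measure D (region k j)" for j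
  have one: "integrable M (\<lambda>\<omega>. (real (region_count k n \<omega> j) / real n)\<^sup>2)
    \<and> expectation (\<lambda>\<omega>. (real (region_count k n \<omega> j) / real n)\<^sup>2) \<le> p j * (1 / real n + 1 / real k)"
    if j: "j < k" for j
  proof -
    define \<eta> where "\<eta> i \<omega> = indicator (region k j) (X i \<omega>) - p j" for i \<omega>
    have ind: "indep_vars (\<lambda>_. borel) \<eta> UNIV"
      unfolding \<eta>_def by (rule indep_vars_compose2[OF X_indep]) simp
    have [measurable]: "\<eta> i \<in> borel_measurable M" for i
      unfolding \<eta>_def by measurable
    have ii: "integrable M (\<lambda>\<omega>. indicat_real (region k j) (X i \<omega>))" for i
      by (rule integrable_const_bound[where B = 1]) auto
    have pe: "expectation (\<lambda>\<omega>. indicat_real (region k j) (X i \<omega>)) = p j" for i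
    proof -
      have "p j = expectation (\<lambda>\<omega>. indicat_real (region k j) (X i \<omega>))"
        unfolding p_def X_distr[of i, symmetric]
        by (subst integral_distr[symmetric, of _ M borel]) auto
      then show ?thesis by simp
    qed
    have i: "integrable M (\<eta> i)" and m: "expectation (\<eta> i) = 0" for i
      unfolding \<eta>_def using ii by (auto simp: pe prob_space)
    have sq: "(\<eta> i \<omega>)\<^sup>2 = (1 - 2 * p j) * indicator (region k j) (X i \<omega>) + (p j)\<^sup>2" for i \<omega>
      by (auto simp: \<eta>_def indicator_def power2_eq_square algebra_simps)
    have i2: "integrable M (\<lambda>\<omega>. (\<eta> i \<omega>)\<^sup>2)" and m2: "expectation (\<lambda>\<omega>. (\<eta> i \<omega>)\<^sup>2) \<le> p j" for i
      unfolding sq using ii by (auto simp: pe prob_space power2_eq_square algebra_simps p_def)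
    note s = second_moment_indep_sum[OF ind i m i2, of "{..<n}"]
    have eq: "(real (region_count k n \<omega> j) / real n)\<^sup>2
        = (1 / (real n)\<^sup>2) * ((\<Sum>i<n. \<eta> i \<omega>)\<^sup>2 + 2 * (real n * p j) * (\<Sum>i<n. \<eta> i \<omega>) + (real n * p j)\<^sup>2)" for \<omega>
    proof -
      have "real (region_count k n \<omega> j) = (\<Sum>i<n. \<eta> i \<omega>) + real n * p j"
        by (simp add: region_count_eq \<eta>_def sum_subtractf)
      then show ?thesis
        by (simp add: power_divide power2_sum mult_ac)
    qed
    have "expectation (\<lambda>\<omega>. (real (region_count k n \<omega> j) / real n)\<^sup>2)
        = (1 / (real n)\<^sup>2) * ((\<Sum>i<n. expectation (\<lambda>\<omega>. (\<eta> i \<omega>)\<^sup>2)) + (real n * p j)\<^sup>2)"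
      unfolding eq using s i by (simp add: m prob_space)
    also have "\<dots> \<le> (1 / (real n)\<^sup>2) * ((\<Sum>i<n. p j) + (real n * p j)\<^sup>2)"
      by (intro mult_left_mono add_right_mono sum_mono m2) auto
    also have "\<dots> = p j * (1 / real n + p j)"
      using assms by (simp add: field_simps power2_eq_square)
    also have "\<dots> \<le> p j * (1 / real n + 1 / real k)"
      using measure_region_le[OF assms(1) j] by (intro mult_left_mono add_left_mono) (auto simp: p_def)
    finally have "expectation (\<lambda>\<omega>. (real (region_count k n \<omega> j) / real n)\<^sup>2) \<le> p j * (1 / real n + 1 / real k)" .
    moreover have "integrable M (\<lambda>\<omega>. (real (region_count k n \<omega> j) / real n)\<^sup>2)"
      unfolding eq using s i by simp
    ultimately show ?thesis by blast
  qed
  show "integrable M (\<lambda>\<omega>. \<Sum>j<k. (real (region_count k n \<omega> j) / real n)\<^sup>2)"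
    using one by (intro Bochner_Integration.integrable_sum) auto
  have "(\<Sum>j<k. p j) = measure D (\<Union>j<k. region k j)"
    unfolding p_def using disjoint_region by (intro D.finite_measure_finite_Union[symmetric]) auto
  then have p1: "(\<Sum>j<k. p j) \<le> 1"
    by simp
  have "expectation (\<lambda>\<omega>. \<Sum>j<k. (real (region_count k n \<omega> j) / real n)\<^sup>2)
      = (\<Sum>j<k. expectation (\<lambda>\<omega>. (real (region_count k n \<omega> j) / real n)\<^sup>2))"
    using one by (intro Bochner_Integration.integral_sum) auto
  also have "\<dots> \<le> (\<Sum>j<k. p j * (1 / real n + 1 / real k))"
    using one by (intro sum_mono) auto
  also have "\<dots> = (\<Sum>j<k. p j) * (1 / real n + 1 / real k)"
    by (simp only: sum_distrib_right)
  also have "\<dots> \<le> 1 * (1 / real n + 1 / real k)"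
    by (intro mult_right_mono p1) simp
  finally show "expectation (\<lambda>\<omega>. \<Sum>j<k. (real (region_count k n \<omega> j) / real n)\<^sup>2) \<le> 1 / real n + 1 / real k"
    by simp
qed

text \<open>
  The increment of the process from the knot below \<open>q\<close> is, up to a small multiple of the sum of all
  multipliers, the sum of the multipliers over \<open>increment_indices k n \<omega> q\<close>; in the two tail regions, where the
  projection vanishes, the sums run over the observations beyond \<open>q\<close>.
\<close>

definition increment_indices :: "nat \<Rightarrow> nat \<Rightarrow> 'a \<Rightarrow> real \<Rightarrow> nat set" where
  "increment_indices k n \<omega> q =
    (if inner_cell k q then {i. i < n \<and> knot k (cell k q) < X i \<omega> \<and> X i \<omega> \<le> q}
     else if cell k q = 0 then {i. i < n \<and> X i \<omega> \<le> q} else {i. i < n \<and> q < X i \<omega>})"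

text \<open>By this inclusion the increments of different regions use disjoint sets of
  multipliers.\<close>

lemma increment_indices_subset:
  assumes "2 \<le> k"
  shows "increment_indices k n \<omega> q \<subseteq> {i. i < n \<and> X i \<omega> \<in> region k (min (cell k q) (k - 1))}"
proof
  fix i assume i: "i \<in> increment_indices k n \<omega> q"
  show "i \<in> {i. i < n \<and> X i \<omega> \<in> region k (min (cell k q) (k - 1))}"
  proof (cases "inner_cell k q")
    case True
    then have c: "1 \<le> cell k q" "cell k q + 2 \<le> k" by (auto simp: inner_cell_def)
    have x: "i < n" "knot k (cell k q) < X i \<omega>" "X i \<omega> \<le> q"
      using i True by (auto simp: increment_indices_def)
    have "cell k (X i \<omega>) \<le> cell k q"
      using x by (intro cell_mono)
    moreover have "cell k q \<le> cell k (X i \<omega>)"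
    proof -
      have "real (cell k q) / real k \<le> F (X i \<omega>)"
        using x c knot_le_iff[of "cell k q" k "X i \<omega>"] by auto
      then have "real (cell k q) \<le> real k * F (X i \<omega>)"
        using assms by (simp add: field_simps)
      then have "real (cell k q) < real (cell k (X i \<omega>)) + 1"
        using cell_bounds(2)[of k "X i \<omega>"] by linarith
      then show ?thesis by linarith
    qed
    ultimately show ?thesis
      using x c by (auto simp: region_def)
  next
    case no: False
    show ?thesis
    proof (cases "cell k q = 0")
      case True
      then have "i < n" "X i \<omega> \<le> q" using i no by (auto simp: increment_indices_def)
      with cell_mono[of "X i \<omega>" q k] True show ?thesis
        by (auto simp: region_def)
    next
      case False
      then have x: "i < n" "q < X i \<omega>" using i no by (auto simp: increment_indices_def)
      have c: "k - 1 \<le> cell k q" using not_inner_cell[OF no assms] False by auto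
      have "knot k (k - 1) \<le> q" using c assms by (intro knot_le) auto
      with x cell_mono[of q "X i \<omega>" k] c show ?thesis
        by (auto simp: region_def min_def)
    qed
  qed
qed

text \<open>Within one region the sets are slices of the same observations, cut at a moving end
  point; they increase with \<open>q\<close>, and decrease in the upper tail.\<close>

lemma increment_indices_chain:
  assumes "min (cell k q) (k - 1) = min (cell k r) (k - 1)" "2 \<le> k"
  shows "increment_indices k n \<omega> q \<subseteq> increment_indices k n \<omega> r \<or> increment_indices k n \<omega> r \<subseteq> increment_indices k n \<omega> q"
proof -
  consider "inner_cell k q" "inner_cell k r" "cell k q = cell k r"
    | "\<not> inner_cell k q" "\<not> inner_cell k r" "cell k q = 0" "cell k r = 0"
    | "\<not> inner_cell k q" "\<not> inner_cell k r" "cell k q \<noteq> 0" "cell k r \<noteq> 0"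
    using assms by (cases "inner_cell k q"; cases "inner_cell k r"; cases "cell k q = 0"; cases "cell k r = 0")
      (auto simp: inner_cell_def)
  then show ?thesis
    by cases (cases "q \<le> r"; force simp: increment_indices_def)+
qed

lemma W_proj_increment:
  assumes "2 \<le> k"
  shows "\<bar>W n \<omega> \<omega>' q - proj k (W n \<omega> \<omega>') q\<bar>
    \<le> (1 / sqrt (real n)) * (\<bar>\<Sum>i\<in>increment_indices k n \<omega> q. \<xi> i \<omega>'\<bar> + (1 / real k) * \<bar>\<Sum>i<n. \<xi> i \<omega>'\<bar>)"
proof -
  define S where "S = (\<Sum>i<n. \<xi> i \<omega>')"
  define I where "I P = (\<Sum>i | i < n \<and> P i. \<xi> i \<omega>')" for P
  have I: "(\<Sum>i<n. of_bool (P i) * \<xi> i \<omega>') = I P" for P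
  proof -
    have "I P = (\<Sum>i\<in>{i\<in>{..<n}. P i}. \<xi> i \<omega>')"
      unfolding I_def by (intro sum.cong) auto
    also have "\<dots> = (\<Sum>i<n. if P i then \<xi> i \<omega>' else 0)"
      by (rule sum.inter_filter) simp
    also have "\<dots> = (\<Sum>i<n. of_bool (P i) * \<xi> i \<omega>')"
      by (intro sum.cong) auto
    finally show ?thesis by simp
  qed
  have W: "W n \<omega> \<omega>' x = (1 / sqrt (real n)) * (I (\<lambda>i. X i \<omega> \<le> x) - F x * S)" for x
  proof -
    have "(\<Sum>i<n. centred x i \<omega> * \<xi> i \<omega>') = (\<Sum>i<n. of_bool (X i \<omega> \<le> x) * \<xi> i \<omega>' - F x * \<xi> i \<omega>')"
      unfolding centred_def by (intro sum.cong) (auto simp: left_diff_distrib)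
    then show ?thesis
      unfolding W_eq S_def I[symmetric] by (simp add: sum_subtractf sum_distrib_left)
  qed
  \<comment> \<open>The common form of all three cases: a signed sum over the increment indices, and
    a multiple at most \<open>1 / k\<close> of the full sum, which comes from the centring by
    \<open>F\<close>.\<close>
  have main: ?thesis
    if "W n \<omega> \<omega>' q - proj k (W n \<omega> \<omega>') q = (1 / sqrt (real n)) * (e * (\<Sum>i\<in>increment_indices k n \<omega> q. \<xi> i \<omega>') + d * S)"
      and "\<bar>e\<bar> = 1" "\<bar>d\<bar> \<le> 1 / real k" for d e
  proof -
    have "\<bar>e * (\<Sum>i\<in>increment_indices k n \<omega> q. \<xi> i \<omega>') + d * S\<bar>
        \<le> \<bar>e * (\<Sum>i\<in>increment_indices k n \<omega> q. \<xi> i \<omega>')\<bar> + \<bar>d * S\<bar>"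
      by (rule abs_triangle_ineq)
    also have "\<dots> \<le> \<bar>\<Sum>i\<in>increment_indices k n \<omega> q. \<xi> i \<omega>'\<bar> + (1 / real k) * \<bar>S\<bar>"
      unfolding abs_mult that(2) using that(3) by (intro add_mono mult_right_mono) auto
    finally have le: "\<bar>e * (\<Sum>i\<in>increment_indices k n \<omega> q. \<xi> i \<omega>') + d * S\<bar>
        \<le> \<bar>\<Sum>i\<in>increment_indices k n \<omega> q. \<xi> i \<omega>'\<bar> + (1 / real k) * \<bar>S\<bar>" .
    have "\<bar>(1 / sqrt (real n)) * a\<bar> = (1 / sqrt (real n)) * \<bar>a\<bar>" for a
      by (simp add: abs_mult)
    then show ?thesis
      unfolding that(1) S_def[symmetric] using le by (simp only:) (intro mult_left_mono, auto)
  qed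
  show ?thesis
  proof (cases "inner_cell k q")
    case True
    let ?a = "knot k (cell k q)"
    note i = inner_cell_knot[OF True]
    have "I (\<lambda>i. X i \<omega> \<le> q) - I (\<lambda>i. X i \<omega> \<le> ?a) = I (\<lambda>i. ?a < X i \<omega> \<and> X i \<omega> \<le> q)"
      unfolding I[symmetric] sum_subtractf[symmetric] using i(1) by (intro sum.cong) auto
    then have "W n \<omega> \<omega>' q - proj k (W n \<omega> \<omega>') q
        = (1 / sqrt (real n)) * (1 * (\<Sum>i\<in>increment_indices k n \<omega> q. \<xi> i \<omega>') + (F ?a - F q) * S)"
      using True unfolding proj_def W by (simp add: increment_indices_def I_def algebra_simps)
    then show ?thesis
      using i(2) F_mono[OF i(1)] by (intro main[of 1 "F ?a - F q"]) auto
  next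
    case no: False
    show ?thesis
    proof (cases "cell k q = 0")
      case True
      have "W n \<omega> \<omega>' q - proj k (W n \<omega> \<omega>') q
          = (1 / sqrt (real n)) * (1 * (\<Sum>i\<in>increment_indices k n \<omega> q. \<xi> i \<omega>') + (- F q) * S)"
        using True no unfolding proj_def W by (simp add: increment_indices_def I_def)
      then show ?thesis
        using not_inner_cell[OF no assms] True assms by (intro main[of 1 "- F q"]) auto
    next
      case False
      \<comment> \<open>In the upper tail the complementary sum is taken, so that \<open>S\<close>
        is multiplied by the small \<open>1 - F q\<close> and not by \<open>F q\<close>.\<close>
      have "S = I (\<lambda>i. X i \<omega> \<le> q) + I (\<lambda>i. q < X i \<omega>)"
        unfolding S_def I[symmetric] sum.distrib[symmetric] by (intro sum.cong) auto
      then have "W n \<omega> \<omega>' q - proj k (W n \<omega> \<omega>') q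
          = (1 / sqrt (real n)) * ((- 1) * (\<Sum>i\<in>increment_indices k n \<omega> q. \<xi> i \<omega>') + (1 - F q) * S)"
        using False no unfolding proj_def W by (simp add: increment_indices_def I_def algebra_simps)
      then show ?thesis
        using not_inner_cell[OF no assms] False by (intro main[of "- 1" "1 - F q"]) auto
    qed
  qed
qed

text \<open>The supremum runs over the rationals to stay measurable; for right continuous paths it
  equals the supremum over the line. Values in \<open>ennreal\<close> make it meaningful for
  unbounded paths.\<close>

definition oscillation :: "nat \<Rightarrow> (real \<Rightarrow> real) \<Rightarrow> ennreal" where
  "oscillation k z = (SUP q\<in>\<rat>. ennreal \<bar>z q - proj k z q\<bar>)"

text \<open>Unless some chain sum exceeds \<open>2 * \<delta> * sqrt n\<close> or the full sum
  exceeds \<open>k * \<delta> * sqrt n\<close>, the oscillation is at most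
  \<open>3 * \<delta>\<close>. The other terms bound the probabilities of these two events.\<close>

lemma W_oscillation_conditional:
  assumes "0 < \<delta>" "0 < \<tau>"
  obtains K :: real where "0 \<le> K"
    and "\<And>n k \<omega>. 0 < n \<Longrightarrow> 2 \<le> k \<Longrightarrow> (\<integral>\<^sup>+\<omega>'. min 1 (oscillation k (W n \<omega> \<omega>')) \<partial>M)
      \<le> ennreal (3 * \<delta> + 1 / (real k * \<delta>)\<^sup>2 + \<tau> + K * (\<Sum>j<k. (real (region_count k n \<omega> j) / real n)\<^sup>2))"
proof (rule multiplier_chains_bound[OF assms])
  fix K :: real
  assume K: "0 \<le> K" and bound: "\<And>n J (U :: nat \<Rightarrow> nat set) (\<C> :: nat \<Rightarrow> nat set set). finite J \<Longrightarrow> disjoint_family_on U J \<Longrightarrow>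
      (\<And>j. j \<in> J \<Longrightarrow> U j \<subseteq> {..<n}) \<Longrightarrow> (\<And>j. j \<in> J \<Longrightarrow> \<C> j \<subseteq> Pow (U j)) \<Longrightarrow>
      (\<And>j C D. j \<in> J \<Longrightarrow> C \<in> \<C> j \<Longrightarrow> D \<in> \<C> j \<Longrightarrow> C \<subseteq> D \<or> D \<subseteq> C) \<Longrightarrow> 0 < n \<Longrightarrow>
      prob {\<omega>\<in>space M. \<exists>j\<in>J. \<exists>C\<in>\<C> j. 2 * \<delta> * sqrt (real n) < \<bar>\<Sum>i\<in>C. \<xi> i \<omega>\<bar>}
        \<le> (\<Sum>j\<in>J. K * (real (card (U j)) / real n)\<^sup>2) + \<tau>"
  show thesis
  proof (rule that[OF K])
    fix n k :: nat and \<omega> assume n: "0 < n" and k: "2 \<le> k"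
    define \<C> where "\<C> j = increment_indices k n \<omega> ` {q. min (cell k q) (k - 1) = j}" for j
    define U where "U j = {i. i < n \<and> X i \<omega> \<in> region k j}" for j
    have CU: "\<C> j \<subseteq> Pow (U j)" for j
      unfolding \<C>_def U_def using increment_indices_subset[OF k] by auto
    have "finite (\<C> j)" for j
      by (rule finite_subset[OF CU]) (simp add: U_def)
    then have [measurable]: "countable (\<C> j)" for j
      by (rule countable_finite)
    define B1 where "B1 = {\<omega>'\<in>space M. \<exists>j\<in>{..<k}. \<exists>C\<in>\<C> j. 2 * \<delta> * sqrt (real n) < \<bar>\<Sum>i\<in>C. \<xi> i \<omega>'\<bar>}"
    \<comment> \<open>The full sum as a chain with one member, so that the maximal inequality with
      \<open>p = 2\<close> doubles as Chebyshev's. The level carries the factor \<open>k\<close>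
      because this sum is weighted by \<open>1 / k\<close>.\<close>
    define B2 where "B2 = {\<omega>'\<in>space M. \<exists>C\<in>{{..<n}}. real k * \<delta> * sqrt (real n) < \<bar>\<Sum>i\<in>C. \<xi> i \<omega>'\<bar>}"
    have [measurable]: "B1 \<in> sets M" "B2 \<in> sets M"
      unfolding B1_def B2_def by measurable
    have P1: "prob B1 \<le> K * (\<Sum>j<k. (real (region_count k n \<omega> j) / real n)\<^sup>2) + \<tau>"
    proof -
      have "prob B1 \<le> (\<Sum>j<k. K * (real (card (U j)) / real n)\<^sup>2) + \<tau>"
        unfolding B1_def
      proof (rule bound[OF _ _ _ CU _ n])
        show "disjoint_family_on U {..<k}"
          using disjoint_region[of k "{..<k}"] unfolding disjoint_family_on_def U_def by blast
        show "C \<subseteq> D \<or> D \<subseteq> C" if "C \<in> \<C> j" "D \<in> \<C> j" for j C D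
          using that increment_indices_chain[OF _ k] unfolding \<C>_def by fastforce
      qed (auto simp: U_def)
      then show ?thesis
        by (simp add: sum_distrib_left region_count_def U_def)
    qed
    have P2: "prob B2 \<le> 1 / (real k * \<delta>)\<^sup>2"
    proof -
      have "prob B2 \<le> expectation (\<lambda>\<omega>'. (\<Sum>i<n. \<xi> i \<omega>')\<^sup>2) / (real k * \<delta> * sqrt (real n))\<^sup>2"
        unfolding B2_def
      proof (rule chain_maximal_inequality[OF xi_indep xi_int xi_mean])
        show "integrable M (\<lambda>\<omega>'. (\<Sum>i\<in>C. \<xi> i \<omega>')\<^sup>2)" if "C \<subseteq> {..<n}" for C
          using weighted_second_moment(1)[of C "\<lambda>_. 1"] that finite_subset by auto
      qed (use assms n k in auto)
      also have "expectation (\<lambda>\<omega>'. (\<Sum>i<n. \<xi> i \<omega>')\<^sup>2) = real n"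
        using weighted_second_moment(2)[of "{..<n}" "\<lambda>_. 1"] by simp
      finally show ?thesis
        using n by (simp add: power_mult_distrib)
    qed
    have le: "min 1 (oscillation k (W n \<omega> \<omega>')) \<le> ennreal (3 * \<delta>) + indicator (B1 \<union> B2) \<omega>'"
      if "\<omega>' \<in> space M" for \<omega>'
    proof (cases "\<omega>' \<in> B1 \<union> B2")
      case True
      then show ?thesis by (simp add: min.coboundedI1 add_increasing)
    next
      case False
      have "\<bar>W n \<omega> \<omega>' q - proj k (W n \<omega> \<omega>') q\<bar> \<le> 3 * \<delta>" for q
      proof -
        have "increment_indices k n \<omega> q \<in> \<C> (min (cell k q) (k - 1))" "min (cell k q) (k - 1) \<in> {..<k}"
          using k by (auto simp: \<C>_def)
        then have 1: "\<bar>\<Sum>i\<in>increment_indices k n \<omega> q. \<xi> i \<omega>'\<bar> \<le> 2 * \<delta> * sqrt (real n)"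
          using False that unfolding B1_def by (force simp: not_less)
        have "\<bar>\<Sum>i<n. \<xi> i \<omega>'\<bar> \<le> real k * \<delta> * sqrt (real n)"
          using False that unfolding B2_def by (auto simp: not_less)
        then have "(1 / real k) * \<bar>\<Sum>i<n. \<xi> i \<omega>'\<bar> \<le> (1 / real k) * (real k * \<delta> * sqrt (real n))"
          by (intro mult_left_mono) auto
        also have "\<dots> = \<delta> * sqrt (real n)"
          using k by simp
        finally have "\<bar>\<Sum>i\<in>increment_indices k n \<omega> q. \<xi> i \<omega>'\<bar> + (1 / real k) * \<bar>\<Sum>i<n. \<xi> i \<omega>'\<bar> \<le> 3 * \<delta> * sqrt (real n)"
          using 1 by linarith
        then have "(1 / sqrt (real n)) * (\<bar>\<Sum>i\<in>increment_indices k n \<omega> q. \<xi> i \<omega>'\<bar> + (1 / real k) * \<bar>\<Sum>i<n. \<xi> i \<omega>'\<bar>)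
            \<le> (1 / sqrt (real n)) * (3 * \<delta> * sqrt (real n))"
          by (intro mult_left_mono) auto
        also have "\<dots> = 3 * \<delta>"
          using n by simp
        finally show ?thesis
          using W_proj_increment[OF k, of n \<omega> \<omega>' q] by linarith
      qed
      then have "oscillation k (W n \<omega> \<omega>') \<le> ennreal (3 * \<delta>)"
        unfolding oscillation_def by (intro SUP_least ennreal_leI)
      then show ?thesis
        using False by (simp add: min.coboundedI2)
    qed
    have "(\<integral>\<^sup>+\<omega>'. min 1 (oscillation k (W n \<omega> \<omega>')) \<partial>M) \<le> (\<integral>\<^sup>+\<omega>'. ennreal (3 * \<delta>) + indicator (B1 \<union> B2) \<omega>' \<partial>M)"
      by (intro nn_integral_mono le)
    also have "\<dots> = ennreal (3 * \<delta>) + emeasure M (B1 \<union> B2)"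
      by (subst nn_integral_add) (auto simp: emeasure_space_1)
    also have "\<dots> = ennreal (3 * \<delta> + prob (B1 \<union> B2))"
      using assms by (simp add: emeasure_eq_measure ennreal_plus)
    also have "\<dots> \<le> ennreal (3 * \<delta> + 1 / (real k * \<delta>)\<^sup>2 + \<tau> + K * (\<Sum>j<k. (real (region_count k n \<omega> j) / real n)\<^sup>2))"
      using P1 P2 measure_Un_le[of B1 M B2] by (intro ennreal_leI) auto
    finally show "(\<integral>\<^sup>+\<omega>'. min 1 (oscillation k (W n \<omega> \<omega>')) \<partial>M)
      \<le> ennreal (3 * \<delta> + 1 / (real k * \<delta>)\<^sup>2 + \<tau> + K * (\<Sum>j<k. (real (region_count k n \<omega> j) / real n)\<^sup>2))" .
  qed
qed

lemma W_oscillation: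
  assumes "0 < \<epsilon>"
  obtains k0 where "\<And>k. k0 \<le> k \<Longrightarrow>
    \<forall>\<^sub>F n in sequentially. (\<integral>\<^sup>+\<omega>. \<integral>\<^sup>+\<omega>'. min 1 (oscillation k (W n \<omega> \<omega>')) \<partial>M \<partial>M) \<le> ennreal \<epsilon>"
proof -
  \<comment> \<open>\<open>3 * \<delta>\<close> is a quarter of \<open>\<epsilon>\<close>; a second
    quarter is the truncation loss, and the other two are for large \<open>k\<close> and large
    \<open>n\<close>.\<close>
  define \<delta> where "\<delta> = \<epsilon> / 12"
  have \<delta>: "0 < \<delta>" "0 < \<epsilon> / 4" using assms by (auto simp: \<delta>_def)
  obtain K where K: "0 \<le> K" and bound: "\<And>n k \<omega>. 0 < n \<Longrightarrow> 2 \<le> k \<Longrightarrow> (\<integral>\<^sup>+\<omega>'. min 1 (oscillation k (W n \<omega> \<omega>')) \<partial>M)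
      \<le> ennreal (3 * \<delta> + 1 / (real k * \<delta>)\<^sup>2 + \<epsilon> / 4 + K * (\<Sum>j<k. (real (region_count k n \<omega> j) / real n)\<^sup>2))"
    by (rule W_oscillation_conditional[OF \<delta>]) blast
  have double: "(\<integral>\<^sup>+\<omega>. \<integral>\<^sup>+\<omega>'. min 1 (oscillation k (W n \<omega> \<omega>')) \<partial>M \<partial>M)
      \<le> ennreal (\<epsilon> / 2 + 1 / (real k * \<delta>)\<^sup>2 + K / real n + K / real k)" if n: "0 < n" and k: "2 \<le> k" for n k
  proof -
    note c = region_count_second_moment[OF k n]
    define G where "G \<omega> = 3 * \<delta> + 1 / (real k * \<delta>)\<^sup>2 + \<epsilon> / 4 + K * (\<Sum>j<k. (real (region_count k n \<omega> j) / real n)\<^sup>2)" for \<omega>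
    have G: "integrable M G" "\<And>\<omega>. 0 \<le> G \<omega>"
      unfolding G_def using c(1) \<delta> K by (auto intro!: add_nonneg_nonneg mult_nonneg_nonneg sum_nonneg)
    have "(\<integral>\<^sup>+\<omega>. \<integral>\<^sup>+\<omega>'. min 1 (oscillation k (W n \<omega> \<omega>')) \<partial>M \<partial>M) \<le> (\<integral>\<^sup>+\<omega>. ennreal (G \<omega>) \<partial>M)"
      unfolding G_def by (intro nn_integral_mono bound n k)
    also have "\<dots> = ennreal (expectation G)"
      using G by (intro nn_integral_eq_integral) auto
    also have "expectation G = 3 * \<delta> + 1 / (real k * \<delta>)\<^sup>2 + \<epsilon> / 4
        + K * expectation (\<lambda>\<omega>. \<Sum>j<k. (real (region_count k n \<omega> j) / real n)\<^sup>2)"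
      unfolding G_def using c(1) by (simp add: prob_space)
    also have "\<dots> \<le> 3 * \<delta> + 1 / (real k * \<delta>)\<^sup>2 + \<epsilon> / 4 + K * (1 / real n + 1 / real k)"
      using c(2) K by (intro add_left_mono mult_left_mono)
    also have "\<dots> = \<epsilon> / 2 + 1 / (real k * \<delta>)\<^sup>2 + K / real n + K / real k"
      by (simp add: \<delta>_def distrib_left)
    finally show ?thesis
      by (simp add: ennreal_leI)
  qed
  have "(\<lambda>k. 1 / (real k * \<delta>)\<^sup>2 + K / real k) \<longlonglongrightarrow> 0"
    using tendsto_add[OF tendsto_power[OF lim_const_over_n[of "1 / \<delta>"], of 2] lim_const_over_n[of K]]
    by (simp add: power_divide power_mult_distrib mult.commute)
  from order_tendstoD(2)[OF this \<delta>(2)]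
  obtain k1 where k1: "\<And>k. k1 \<le> k \<Longrightarrow> 1 / (real k * \<delta>)\<^sup>2 + K / real k < \<epsilon> / 4"
    unfolding eventually_sequentially by blast
  show ?thesis
  proof (rule that[of "max 2 k1"])
    fix k assume k: "max 2 k1 \<le> k"
    have "\<forall>\<^sub>F n in sequentially. K / real n < \<epsilon> / 4"
      by (rule order_tendstoD(2)[OF lim_const_over_n \<delta>(2)])
    then show "\<forall>\<^sub>F n in sequentially. (\<integral>\<^sup>+\<omega>. \<integral>\<^sup>+\<omega>'. min 1 (oscillation k (W n \<omega> \<omega>')) \<partial>M \<partial>M) \<le> ennreal \<epsilon>"
      using eventually_gt_at_top[of 0]
    proof eventually_elim
      case (elim n)
      have "\<epsilon> / 2 + 1 / (real k * \<delta>)\<^sup>2 + K / real n + K / real k \<le> \<epsilon>"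
        using k1[of k] k elim by linarith
      then show ?case
        using double[of n k] elim k by (intro order_trans[OF double] ennreal_leI) auto
    qed
  qed
qed

end

section \<open>The space of bounded integrable functions\<close>

lemma L_space_openin:
  "openin (L_topology m) U \<longleftrightarrow> U \<subseteq> L_space m \<and> (\<forall>z\<in>U. \<exists>r>0. \<forall>w\<in>L_space m. L_dist m z w < r \<longrightarrow> w \<in> U)"
proof -
  interpret Metric_space "L_space m" "L_dist m"
    by (rule Metric_space_L)
  have "mball z r \<subseteq> U \<longleftrightarrow> (\<forall>w\<in>L_space m. L_dist m z w < r \<longrightarrow> w \<in> U)" if "z \<in> L_space m" for z r
    using that by (auto simp: mball_def)
  then have "(\<exists>r>0. mball z r \<subseteq> U) \<longleftrightarrow> (\<exists>r>0. \<forall>w\<in>L_space m. L_dist m z w < r \<longrightarrow> w \<in> U)" if "z \<in> L_space m" for z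
    using that by simp
  then show ?thesis
    unfolding L_topology_def openin_mtopology by blast
qed

lemma topspace_L_topology [simp]: "topspace (L_topology m) = L_space m"
  unfolding L_topology_def using Metric_space.topspace_mtopology[OF Metric_space_L] .

lemma L_dist_nonneg: "0 \<le> L_dist m z w"
  using Metric_space.nonneg[OF Metric_space_L] .

lemma L_dist_commute: "L_dist m z w = L_dist m w z"
  using Metric_space.commute[OF Metric_space_L] .

lemma L_dist_self [simp]: "L_dist m z z = 0"
  by (simp add: L_dist_def L_norm_def)

lemma L_dist_triangle:
  "u \<in> L_space m \<Longrightarrow> v \<in> L_space m \<Longrightarrow> w \<in> L_space m \<Longrightarrow> L_dist m u w \<le> L_dist m u v + L_dist m v w"
  using Metric_space.triangle[OF Metric_space_L] .

lemma L_dist_abs_le: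
  assumes "z \<in> L_space m" "w \<in> L_space m"
  shows "\<bar>z x - w x\<bar> \<le> L_dist m z w"
  using L_space_abs_le_SUP[OF L_space_diff[OF assms], of x] unfolding L_dist_def L_norm_def by simp

lemma L_dist_le:
  assumes "\<And>x. \<bar>z x - w x\<bar> \<le> c" "(\<integral>x. \<bar>z x - w x\<bar> \<partial>m) \<le> d" "c \<le> e" "d \<le> e"
  shows "L_dist m z w \<le> e"
proof -
  have "(SUP x. \<bar>z x - w x\<bar>) \<le> c"
    by (rule cSUP_least) (auto simp: assms)
  then show ?thesis
    using assms unfolding L_dist_def L_norm_def by linarith
qed

lemma L_space_add:
  assumes "z \<in> L_space m" "w \<in> L_space m"
  shows "(\<lambda>x. z x + w x) \<in> L_space m"
  using assms unfolding L_space_def by (auto intro: bounded_plus_comp)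

lemma L_space_scale: "z \<in> L_space m \<Longrightarrow> (\<lambda>x. c * z x) \<in> L_space m"
proof -
  assume z: "z \<in> L_space m"
  then obtain B where "\<And>x. \<bar>z x\<bar> \<le> B"
    unfolding L_space_def bounded_iff by auto
  then have "\<bar>c * z x\<bar> \<le> \<bar>c\<bar> * B" for x
    unfolding abs_mult by (intro mult_left_mono) auto
  then have "bounded (range (\<lambda>x. c * z x))"
    unfolding bounded_iff by auto
  then show ?thesis
    using z by (simp add: L_space_def)
qed

lemma L_space_zero: "(\<lambda>_. 0) \<in> L_space m"
  by (simp add: L_space_def)

lemma L_space_sum:
  assumes "\<And>i. i \<in> A \<Longrightarrow> z i \<in> L_space m"
  shows "(\<lambda>x. \<Sum>i\<in>A. z i x) \<in> L_space m"
  using assms by (induction A rule: infinite_finite_induct) (auto simp: L_space_zero intro: L_space_add)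

section \<open>Lipschitz functionals and Lipschitz minorants\<close>

definition lipschitz_L :: "real measure \<Rightarrow> real \<Rightarrow> real \<Rightarrow> ((real \<Rightarrow> real) \<Rightarrow> real) \<Rightarrow> bool" where
  "lipschitz_L m B K h \<longleftrightarrow> (\<forall>z\<in>L_space m. \<bar>h z\<bar> \<le> B) \<and>
     (\<forall>z\<in>L_space m. \<forall>w\<in>L_space m. \<bar>h z - h w\<bar> \<le> K * L_dist m z w)"

lemma lipschitz_L_D:
  assumes "lipschitz_L m B K h"
  shows "z \<in> L_space m \<Longrightarrow> \<bar>h z\<bar> \<le> B"
    and "z \<in> L_space m \<Longrightarrow> w \<in> L_space m \<Longrightarrow> \<bar>h z - h w\<bar> \<le> K * L_dist m z w"
  using assms by (auto simp: lipschitz_L_def)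

lemma lipschitz_L_continuous:
  assumes h: "lipschitz_L m B K h" and "0 \<le> K"
  shows "continuous_map (L_topology m) euclideanreal h"
  unfolding continuous_map_def L_space_openin topspace_L_topology
proof (intro conjI allI impI ballI)
  fix U :: "real set" and z assume "openin euclidean U" and z: "z \<in> {z \<in> L_space m. h z \<in> U}"
  then obtain e where e: "0 < e" "\<And>y. \<bar>y - h z\<bar> < e \<Longrightarrow> y \<in> U"
    by (auto simp: open_dist dist_real_def)
  show "\<exists>r>0. \<forall>w\<in>L_space m. L_dist m z w < r \<longrightarrow> w \<in> {z \<in> L_space m. h z \<in> U}"
  \<comment> \<open>\<open>K + 1\<close> avoids a division by zero when
    \<open>K = 0\<close>.\<close>
  proof (intro exI[of _ "e / (K + 1)"] conjI ballI impI)
    show "0 < e / (K + 1)" using e \<open>0 \<le> K\<close> by simp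
    fix w assume w: "w \<in> L_space m" "L_dist m z w < e / (K + 1)"
    have "\<bar>h w - h z\<bar> \<le> K * L_dist m w z"
      using lipschitz_L_D(2)[OF h] w z by simp
    also have "\<dots> \<le> (K + 1) * L_dist m z w"
      using L_dist_nonneg[of m z w] by (simp add: L_dist_commute mult_right_mono)
    also have "\<dots> < e"
      using w \<open>0 \<le> K\<close> by (simp add: field_simps)
    finally show "w \<in> {z \<in> L_space m. h z \<in> U}"
      using e(2) w by simp
  qed
qed auto

text \<open>
  Inf-convolution with a multiple of the metric.
\<close>

definition lip_minorant :: "real measure \<Rightarrow> real \<Rightarrow> ((real \<Rightarrow> real) \<Rightarrow> real) \<Rightarrow> (real \<Rightarrow> real) \<Rightarrow> real" where
  "lip_minorant m c f z = (if z \<in> L_space m then INF w\<in>L_space m. f w + c * L_dist m z w else 0)"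

context
  fixes m :: "real measure" and B c :: real and f :: "(real \<Rightarrow> real) \<Rightarrow> real"
  assumes f: "\<And>z. z \<in> L_space m \<Longrightarrow> \<bar>f z\<bar> \<le> B" and c: "0 \<le> c"
begin

lemma lip_minorant_bdd: "bdd_below ((\<lambda>w. f w + c * L_dist m z w) ` L_space m)"
proof (rule bdd_belowI2)
  fix w assume "w \<in> L_space m"
  then show "- B \<le> f w + c * L_dist m z w"
    using f[of w] mult_nonneg_nonneg[OF c L_dist_nonneg[of m z w]] by linarith
qed

lemma lip_minorant_le_add:
  assumes "z \<in> L_space m" "w \<in> L_space m"
  shows "lip_minorant m c f z \<le> f w + c * L_dist m z w"
  unfolding lip_minorant_def using assms by (simp add: cINF_lower[OF lip_minorant_bdd])

lemma lip_minorant_le: "z \<in> L_space m \<Longrightarrow> lip_minorant m c f z \<le> f z"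
  using lip_minorant_le_add[of z z] by simp

lemma lip_minorant_greatest:
  assumes "z \<in> L_space m" "\<And>w. w \<in> L_space m \<Longrightarrow> a \<le> f w + c * L_dist m z w"
  shows "a \<le> lip_minorant m c f z"
  unfolding lip_minorant_def using assms by (auto intro!: cINF_greatest)

lemma lip_minorant_ge: "z \<in> L_space m \<Longrightarrow> - B \<le> lip_minorant m c f z"
proof (rule lip_minorant_greatest)
  fix w assume "w \<in> L_space m"
  then show "- B \<le> f w + c * L_dist m z w"
    using f[of w] mult_nonneg_nonneg[OF c L_dist_nonneg[of m z w]] by linarith
qed

lemma lipschitz_lip_minorant: "lipschitz_L m B c (lip_minorant m c f)"
  unfolding lipschitz_L_def
proof (intro conjI ballI)
  fix z assume z: "z \<in> L_space m"
  then show "\<bar>lip_minorant m c f z\<bar> \<le> B"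
    using lip_minorant_le[OF z] lip_minorant_ge[OF z] f[OF z] by linarith
next
  have le: "lip_minorant m c f z - c * L_dist m z w \<le> lip_minorant m c f w" if "z \<in> L_space m" "w \<in> L_space m" for z w
  proof (rule lip_minorant_greatest[OF that(2)])
    fix v assume v: "v \<in> L_space m"
    have "c * L_dist m z v \<le> c * (L_dist m z w + L_dist m w v)"
      using that v c by (intro mult_left_mono L_dist_triangle)
    then show "lip_minorant m c f z - c * L_dist m z w \<le> f v + c * L_dist m w v"
      using lip_minorant_le_add[OF that(1) v] by (simp add: distrib_left)
  qed
  fix z w assume "z \<in> L_space m" "w \<in> L_space m"
  then show "\<bar>lip_minorant m c f z - lip_minorant m c f w\<bar> \<le> c * L_dist m z w"
    using le[of z w] le[of w z] by (simp add: L_dist_commute abs_le_iff)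
qed

end

text \<open>Within the radius of continuity the values of \<open>f\<close> are close to
  \<open>f z\<close>; outside it the penalty is at least \<open>2 * B\<close>, the largest possible
  drop of \<open>f\<close>.\<close>

lemma lip_minorant_tendsto:
  assumes f: "\<And>z. z \<in> L_space m \<Longrightarrow> \<bar>f z\<bar> \<le> B" and cont: "continuous_map (L_topology m) euclideanreal f"
    and z: "z \<in> L_space m"
  shows "(\<lambda>k. lip_minorant m (real k) f z) \<longlonglongrightarrow> f z"
proof (rule LIMSEQ_I)
  fix e :: real assume e: "0 < e"
  have "openin (L_topology m) {w \<in> topspace (L_topology m). f w \<in> ball (f z) (e / 2)}"
    by (rule openin_continuous_map_preimage[OF cont]) simp
  moreover have "z \<in> {w \<in> topspace (L_topology m). f w \<in> ball (f z) (e / 2)}"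
    using z e by simp
  ultimately obtain r where r: "0 < r" "\<And>w. w \<in> L_space m \<Longrightarrow> L_dist m z w < r \<Longrightarrow> \<bar>f z - f w\<bar> < e / 2"
    unfolding L_space_openin by (auto simp: dist_real_def)
  obtain k0 :: nat where k0: "2 * B / r < real k0"
    using reals_Archimedean2 by blast
  show "\<exists>k0. \<forall>k\<ge>k0. norm (lip_minorant m (real k) f z - f z) < e"
  proof (intro exI[of _ k0] allI impI)
    fix k assume k: "k0 \<le> k"
    have "f z - e / 2 \<le> lip_minorant m (real k) f z"
    proof (rule lip_minorant_greatest[OF f _ z])
      fix w assume w: "w \<in> L_space m"
      show "f z - e / 2 \<le> f w + real k * L_dist m z w"
      proof (cases "L_dist m z w < r")
        case True
        then show ?thesis
          using r(2)[OF w True] mult_nonneg_nonneg[OF of_nat_0_le_iff[of k] L_dist_nonneg[of m z w]] by linarith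
      next
        case False
        have "2 * B \<le> real k0 * r"
          using k0 r(1) by (simp add: field_simps)
        also have "\<dots> \<le> real k * L_dist m z w"
          using k False r(1) by (intro mult_mono) auto
        finally show ?thesis
          using f[OF w] f[OF z] e by linarith
      qed
    qed auto
    moreover have "lip_minorant m (real k) f z \<le> f z"
      by (rule lip_minorant_le[OF f _ z]) auto
    ultimately show "norm (lip_minorant m (real k) f z - f z) < e"
      using e by simp
  qed
qed

section \<open>Approximation of the processes by their projections\<close>

lemma right_continuous_abs_le:
  fixes d :: "real \<Rightarrow> real"
  assumes "continuous (at_right x) d" "\<And>q. q \<in> \<rat> \<Longrightarrow> \<bar>d q\<bar> \<le> c"
  shows "\<bar>d x\<bar> \<le> c"
proof (rule ccontr)
  assume "\<not> \<bar>d x\<bar> \<le> c"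
  moreover have "((\<lambda>y. \<bar>d y\<bar>) \<longlongrightarrow> \<bar>d x\<bar>) (at_right x)"
    using assms(1) by (intro tendsto_rabs) (simp add: continuous_within)
  ultimately have "\<forall>\<^sub>F y in at_right x. c < \<bar>d y\<bar>"
    by (intro order_tendstoD(1)) auto
  then obtain b where b: "x < b" "\<And>y. x < y \<Longrightarrow> y < b \<Longrightarrow> c < \<bar>d y\<bar>"
    unfolding eventually_at_right_field by blast
  obtain q where "q \<in> \<rat>" "x < q" "q < b"
    using Rats_dense_in_real[OF b(1)] by blast
  then show False
    using b(2)[of q] assms(2)[of q] by simp
qed

lemma right_continuous_indicator:
  fixes y x :: real
  shows "continuous (at_right x) (\<lambda>x. indicator {..x} y :: real)"
  unfolding continuous_within
proof (rule tendsto_eventually)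
  show "\<forall>\<^sub>F x' in at_right x. (indicator {..x'} y :: real) = indicator {..x} y"
  proof (cases "y \<le> x")
    case True
    have "\<forall>\<^sub>F x' in at_right x. x < x'"
      by (simp add: eventually_at_right_less)
    then show ?thesis
      by eventually_elim (use True in auto)
  next
    case False
    then have "\<forall>\<^sub>F x' in at_right x. x' < y"
      by (intro order_tendstoD(2)[OF tendsto_ident_at]) auto
    then show ?thesis
      by eventually_elim (use False in auto)
  qed
qed

context multiplier_sample
begin

lemma centred_right_continuous: "continuous (at_right x) (\<lambda>x. centred x i \<omega>)"
  unfolding centred_def by (intro continuous_diff right_continuous_indicator F_right_continuous)

lemma W_right_continuous: "continuous (at_right x) (W n \<omega> \<omega>')"
  unfolding W_eq[abs_def] by (intro continuous_mult continuous_sum continuous_const centred_right_continuous)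

lemma empirical_process_right_continuous: "continuous (at_right x) (empirical_process F (\<lambda>i. X i \<omega>) n)"
  unfolding empirical_process_def[abs_def] empirical_cdf_def
  by (intro continuous_mult continuous_diff continuous_sum continuous_const right_continuous_indicator F_right_continuous)

end

locale multiplier_L = multiplier_sample M \<xi> X D F + L: sigma_finite_measure m
  for M :: "'a measure" and \<xi> X D F and m :: "real measure" +
  assumes sets_m [measurable_cong]: "sets m = sets borel"
    and finite_bracket: "(\<integral>\<^sup>+x. ennreal (sqrt (F x * (1 - F x))) \<partial>m) < \<infinity>"
begin

lemma space_m [simp]: "space m = UNIV"
  using sets_eq_imp_space_eq[OF sets_m] by simp

sublocale Mm: pair_sigma_finite M m
  by standard

text \<open>Dominated convergence with the integrable envelope
  \<open>2 * sqrt (F x * (1 - F x))\<close>; the shift by 2 reaches the range where the bounds on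
  the modulus hold.\<close>

lemma L1_modulus_tendsto: "(\<lambda>k. \<integral>\<^sup>+x. ennreal (L1_modulus k x) \<partial>m) \<longlonglongrightarrow> 0"
proof -
  have "(\<lambda>k. \<integral>\<^sup>+x. ennreal (L1_modulus (k + 2) x) \<partial>m) \<longlonglongrightarrow> (\<integral>\<^sup>+x. 0 \<partial>m)"
  proof (rule nn_integral_dominated_convergence)
    show "AE x in m. ennreal (L1_modulus (k + 2) x) \<le> ennreal (2 * sqrt (F x * (1 - F x)))" for k
      using L1_modulus_dominated[of "k + 2"] by (intro AE_I2 ennreal_leI) simp
    have "(\<integral>\<^sup>+x. ennreal (2 * sqrt (F x * (1 - F x))) \<partial>m) = 2 * (\<integral>\<^sup>+x. ennreal (sqrt (F x * (1 - F x))) \<partial>m)"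
      by (subst nn_integral_cmult[symmetric]) (auto simp: ennreal_mult)
    then show "(\<integral>\<^sup>+x. ennreal (2 * sqrt (F x * (1 - F x))) \<partial>m) < \<infinity>"
      using finite_bracket by (simp add: ennreal_mult_less_top)
    show "AE x in m. (\<lambda>k. ennreal (L1_modulus (k + 2) x)) \<longlonglongrightarrow> 0"
    proof (rule AE_I2)
      fix x
      have "(\<lambda>k. sqrt (1 / real (k + 2))) \<longlonglongrightarrow> sqrt 0"
        by (intro tendsto_real_sqrt LIMSEQ_ignore_initial_segment[OF lim_const_over_n])
      then have lim: "(\<lambda>k. sqrt (1 / real (k + 2))) \<longlonglongrightarrow> 0" by simp
      have "(\<lambda>k. L1_modulus (k + 2) x) \<longlonglongrightarrow> 0"
      proof (rule tendsto_sandwich[OF _ _ tendsto_const lim])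
        show "\<forall>\<^sub>F k in sequentially. 0 \<le> L1_modulus (k + 2) x"
          by (intro always_eventually allI L1_modulus_nonneg)
        show "\<forall>\<^sub>F k in sequentially. L1_modulus (k + 2) x \<le> sqrt (1 / real (k + 2))"
          by (intro always_eventually allI L1_modulus_le) simp
      qed
      then show "(\<lambda>k. ennreal (L1_modulus (k + 2) x)) \<longlonglongrightarrow> 0"
        using tendsto_ennrealI by fastforce
    qed
  qed auto
  then show ?thesis
    using LIMSEQ_offset[of "\<lambda>k. \<integral>\<^sup>+x. ennreal (L1_modulus k x) \<partial>m" 2 0] by simp
qed

text \<open>The maximum in the norm is replaced by a sum and the Bochner integral by a nonnegative
  one: the quantity makes sense without integrability and is measurable in the two sample
  points.\<close>

definition residual :: "nat \<Rightarrow> (real \<Rightarrow> real) \<Rightarrow> ennreal" where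
  "residual k z = oscillation k z + (\<integral>\<^sup>+x. ennreal \<bar>z x - proj k z x\<bar> \<partial>m)"

lemma proj_W_joint_measurable [measurable]:
  assumes [measurable]: "f \<in> borel_measurable Q" "g \<in> measurable Q M" "h \<in> measurable Q M"
  shows "(\<lambda>q. proj k (W n (g q) (h q)) (f q)) \<in> borel_measurable Q"
proof -
  have [measurable]: "(\<lambda>x. knot k (cell k x)) \<in> borel_measurable borel"
    by (rule measurable_compose[OF cell_measurable]) simp
  show ?thesis
    unfolding proj_def by measurable
qed

lemma oscillation_W_measurable [measurable]:
  assumes [measurable]: "g \<in> measurable Q M" "h \<in> measurable Q M"
  shows "(\<lambda>q. oscillation k (W n (g q) (h q))) \<in> borel_measurable Q"
  unfolding oscillation_def by (intro borel_measurable_SUP countable_rat) measurable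

lemma residual_W_measurable [measurable]:
  assumes [measurable]: "g \<in> measurable Q M" "h \<in> measurable Q M"
  shows "(\<lambda>q. residual k (W n (g q) (h q))) \<in> borel_measurable Q"
  unfolding residual_def by measurable

text \<open>Two applications of Fubini move the integral over \<open>x\<close> outside, where the
  pointwise bound applies. Sigma-finiteness of \<open>m\<close> enters here.\<close>

lemma W_L1_expectation:
  assumes "0 < n"
  shows "(\<integral>\<^sup>+\<omega>. \<integral>\<^sup>+\<omega>'. \<integral>\<^sup>+x. ennreal \<bar>W n \<omega> \<omega>' x - proj k (W n \<omega> \<omega>') x\<bar> \<partial>m \<partial>M \<partial>M)
    \<le> (\<integral>\<^sup>+x. ennreal (L1_modulus k x) \<partial>m)"
proof -
  have "(\<integral>\<^sup>+\<omega>. \<integral>\<^sup>+\<omega>'. \<integral>\<^sup>+x. ennreal \<bar>W n \<omega> \<omega>' x - proj k (W n \<omega> \<omega>') x\<bar> \<partial>m \<partial>M \<partial>M)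
      = (\<integral>\<^sup>+\<omega>. \<integral>\<^sup>+x. \<integral>\<^sup>+\<omega>'. ennreal \<bar>W n \<omega> \<omega>' x - proj k (W n \<omega> \<omega>') x\<bar> \<partial>M \<partial>m \<partial>M)"
    by (intro nn_integral_cong Mm.Fubini'[symmetric]) measurable
  also have "\<dots> = (\<integral>\<^sup>+x. \<integral>\<^sup>+\<omega>. \<integral>\<^sup>+\<omega>'. ennreal \<bar>W n \<omega> \<omega>' x - proj k (W n \<omega> \<omega>') x\<bar> \<partial>M \<partial>M \<partial>m)"
    by (intro Mm.Fubini'[symmetric]) measurable
  also have "\<dots> \<le> (\<integral>\<^sup>+x. ennreal (L1_modulus k x) \<partial>m)"
    by (intro nn_integral_mono W_proj_expectation assms)
  finally show ?thesis .
qed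

lemma min_add_le: "min 1 (a + b) \<le> min 1 a + (b :: ennreal)"
  by (cases "a \<le> 1") (auto simp: min_def add_increasing2)

text \<open>The cap at 1 is moved onto the oscillation, which is controlled in probability; the
  integral part is controlled in mean and can do without it.\<close>

lemma W_residual:
  assumes "0 < \<epsilon>"
  obtains k0 where "\<And>k. k0 \<le> k \<Longrightarrow>
    \<forall>\<^sub>F n in sequentially. (\<integral>\<^sup>+\<omega>. \<integral>\<^sup>+\<omega>'. min 1 (residual k (W n \<omega> \<omega>')) \<partial>M \<partial>M) \<le> ennreal \<epsilon>"
proof -
  have e2: "0 < \<epsilon> / 2" using assms by simp
  obtain k1 where k1: "\<And>k. k1 \<le> k \<Longrightarrow>
      \<forall>\<^sub>F n in sequentially. (\<integral>\<^sup>+\<omega>. \<integral>\<^sup>+\<omega>'. min 1 (oscillation k (W n \<omega> \<omega>')) \<partial>M \<partial>M) \<le> ennreal (\<epsilon> / 2)"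
    by (rule W_oscillation[OF e2]) blast
  have "\<forall>\<^sub>F k in sequentially. (\<integral>\<^sup>+x. ennreal (L1_modulus k x) \<partial>m) < ennreal (\<epsilon> / 2)"
    by (rule order_tendstoD(2)[OF L1_modulus_tendsto]) (use assms in simp)
  then obtain k2 where k2: "\<And>k. k2 \<le> k \<Longrightarrow> (\<integral>\<^sup>+x. ennreal (L1_modulus k x) \<partial>m) < ennreal (\<epsilon> / 2)"
    unfolding eventually_sequentially by blast
  show ?thesis
  proof (rule that[of "max k1 k2"])
    fix k assume k: "max k1 k2 \<le> k"
    then have k': "k1 \<le> k" "k2 \<le> k" by auto
    show "\<forall>\<^sub>F n in sequentially. (\<integral>\<^sup>+\<omega>. \<integral>\<^sup>+\<omega>'. min 1 (residual k (W n \<omega> \<omega>')) \<partial>M \<partial>M) \<le> ennreal \<epsilon>"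
      using k1[OF k'(1)] eventually_gt_at_top[of 0]
    proof eventually_elim
      case (elim n)
      have "(\<integral>\<^sup>+\<omega>. \<integral>\<^sup>+\<omega>'. min 1 (residual k (W n \<omega> \<omega>')) \<partial>M \<partial>M)
          \<le> (\<integral>\<^sup>+\<omega>. \<integral>\<^sup>+\<omega>'. min 1 (oscillation k (W n \<omega> \<omega>')) + (\<integral>\<^sup>+x. ennreal \<bar>W n \<omega> \<omega>' x - proj k (W n \<omega> \<omega>') x\<bar> \<partial>m) \<partial>M \<partial>M)"
        unfolding residual_def by (intro nn_integral_mono min_add_le)
      also have "\<dots> = (\<integral>\<^sup>+\<omega>. (\<integral>\<^sup>+\<omega>'. min 1 (oscillation k (W n \<omega> \<omega>')) \<partial>M)
          + (\<integral>\<^sup>+\<omega>'. \<integral>\<^sup>+x. ennreal \<bar>W n \<omega> \<omega>' x - proj k (W n \<omega> \<omega>') x\<bar> \<partial>m \<partial>M) \<partial>M)"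
        by (intro nn_integral_cong nn_integral_add) measurable
      also have "\<dots> = (\<integral>\<^sup>+\<omega>. \<integral>\<^sup>+\<omega>'. min 1 (oscillation k (W n \<omega> \<omega>')) \<partial>M \<partial>M)
          + (\<integral>\<^sup>+\<omega>. \<integral>\<^sup>+\<omega>'. \<integral>\<^sup>+x. ennreal \<bar>W n \<omega> \<omega>' x - proj k (W n \<omega> \<omega>') x\<bar> \<partial>m \<partial>M \<partial>M)"
        by (intro nn_integral_add) measurable
      also have "\<dots> \<le> ennreal (\<epsilon> / 2) + ennreal (\<epsilon> / 2)"
        using elim W_L1_expectation[of n k] k2[OF k'(2)] by (intro add_mono) auto
      also have "\<dots> = ennreal \<epsilon>"
        using assms by (simp flip: ennreal_plus)
      finally show ?case .
    qed
  qed
qed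

section \<open>Sample paths in the function space\<close>

definition path :: "nat \<Rightarrow> 'a \<Rightarrow> real \<Rightarrow> real" where
  "path i \<omega> x = centred x i \<omega>"

definition good :: "'a \<Rightarrow> bool" where
  "good \<omega> \<longleftrightarrow> (\<forall>i. path i \<omega> \<in> L_space m)"

text \<open>The mean of \<open>\<bar>centred x i\<bar>\<close> is at most
  \<open>sqrt (F x * (1 - F x))\<close>, so Fubini makes each path integrable almost surely, and
  there are countably many paths.\<close>

lemma AE_good: "AE \<omega> in M. good \<omega>"
  unfolding good_def AE_all_countable
proof
  fix i
  have "(\<integral>\<^sup>+\<omega>. ennreal \<bar>centred x i \<omega>\<bar> \<partial>M) \<le> ennreal (sqrt (F x * (1 - F x)))" for x
  proof -
    have 1: "expectation (\<lambda>\<omega>. (centred x i \<omega>)\<^sup>2) = F x * (1 - F x)" "integrable M (\<lambda>\<omega>. (centred x i \<omega>)\<^sup>2)"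
      using combination_second_moment[of "{x}" "\<lambda>_. 1" i] combination_square_integrable[of "{x}" "\<lambda>_. 1" i]
      by (simp_all add: combination_def variance_form_singleton)
    note * = expectation_abs_le_sqrt[OF centred_measurable 1(2)]
    have "(\<integral>\<^sup>+\<omega>. ennreal \<bar>centred x i \<omega>\<bar> \<partial>M) = ennreal (expectation (\<lambda>\<omega>. \<bar>centred x i \<omega>\<bar>))"
      using *(1) by (intro nn_integral_eq_integral) auto
    then show ?thesis
      using *(2) by (simp add: 1(1) ennreal_leI)
  qed
  then have "(\<integral>\<^sup>+x. \<integral>\<^sup>+\<omega>. ennreal \<bar>centred x i \<omega>\<bar> \<partial>M \<partial>m) \<le> (\<integral>\<^sup>+x. ennreal (sqrt (F x * (1 - F x))) \<partial>m)"
    by (intro nn_integral_mono)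
  also have "\<dots> < \<infinity>"
    by (rule finite_bracket)
  also have "(\<integral>\<^sup>+x. \<integral>\<^sup>+\<omega>. ennreal \<bar>centred x i \<omega>\<bar> \<partial>M \<partial>m) = (\<integral>\<^sup>+\<omega>. \<integral>\<^sup>+x. ennreal \<bar>centred x i \<omega>\<bar> \<partial>m \<partial>M)"
    by (intro Mm.Fubini') measurable
  finally have fin: "(\<integral>\<^sup>+\<omega>. \<integral>\<^sup>+x. ennreal \<bar>centred x i \<omega>\<bar> \<partial>m \<partial>M) < \<infinity>" .
  have "(\<lambda>\<omega>. \<integral>\<^sup>+x. ennreal \<bar>centred x i \<omega>\<bar> \<partial>m) \<in> borel_measurable M"
    by measurable
  from nn_integral_PInf_AE[OF this] fin
  have "AE \<omega> in M. (\<integral>\<^sup>+x. ennreal \<bar>centred x i \<omega>\<bar> \<partial>m) \<noteq> \<infinity>"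
    by auto
  then show "AE \<omega> in M. path i \<omega> \<in> L_space m"
    using AE_space
  proof eventually_elim
    case (elim \<omega>)
    have [measurable]: "path i \<omega> \<in> borel_measurable m"
    proof -
      have "path i \<omega> = (\<lambda>x. (if X i \<omega> \<le> x then 1 else 0) - F x)"
        by (auto simp: fun_eq_iff path_def centred_def)
      then show ?thesis
        by (simp add: measurable_cong_sets[OF sets_m refl])
    qed
    show ?case
      unfolding L_space_def
    proof (intro CollectI conjI)
      show "bounded (range (path i \<omega>))"
        unfolding bounded_iff path_def using centred_bound by (intro exI[of _ 1]) auto
      show "integrable m (path i \<omega>)"
        using elim by (intro integrableI_bounded) (auto simp: path_def less_top)
    qed
  qed
qed

lemma W_path: "W n \<omega> \<omega>' = (\<lambda>x. \<Sum>i<n. (\<xi> i \<omega>' / sqrt (real n)) * path i \<omega> x)"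
  by (simp add: fun_eq_iff W_eq path_def sum_distrib_left mult_ac)

lemma W_in_L_space: "good \<omega> \<Longrightarrow> W n \<omega> \<omega>' \<in> L_space m"
  unfolding W_path by (intro L_space_sum L_space_scale) (simp add: good_def)

text \<open>Inner cells satisfy \<open>sqrt (F x * (1 - F x)) \<ge> 1 / k\<close>, so the finite
  bracket integral bounds their mass.\<close>

lemma emeasure_inner_cell: "emeasure m {x. inner_cell k x} < \<infinity>"
proof (cases "k = 0")
  case False
  have "emeasure m {x. inner_cell k x} = (\<integral>\<^sup>+x. indicator {x. inner_cell k x} x \<partial>m)"
    by (subst nn_integral_indicator) auto
  also have "\<dots> \<le> (\<integral>\<^sup>+x. ennreal (real k) * ennreal (sqrt (F x * (1 - F x))) \<partial>m)"
  proof (intro nn_integral_mono)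
    fix x
    show "indicator {x. inner_cell k x} x \<le> ennreal (real k) * ennreal (sqrt (F x * (1 - F x)))"
    proof (cases "inner_cell k x")
      case True
      note i = inner_cell_knot(4,5)[OF True]
      have "1 / real k * (1 / real k) \<le> F x * (1 - F x)"
        using i by (intro mult_mono) auto
      then have "1 / real k \<le> sqrt (F x * (1 - F x))"
        by (intro real_le_rsqrt) (simp add: power2_eq_square)
      then have "1 \<le> real k * sqrt (F x * (1 - F x))"
        using False by (simp add: field_simps)
      then have "ennreal 1 \<le> ennreal (real k * sqrt (F x * (1 - F x)))"
        by (rule ennreal_leI)
      then show ?thesis
        using True by (simp add: ennreal_mult)
    qed simp
  qed
  also have "\<dots> = ennreal (real k) * (\<integral>\<^sup>+x. ennreal (sqrt (F x * (1 - F x))) \<partial>m)"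
    by (rule nn_integral_cmult) measurable
  also have "\<dots> < \<infinity>"
    using finite_bracket by (simp add: ennreal_mult_less_top)
  finally show ?thesis .
qed (simp add: inner_cell_def)

lemma integrable_inner_cell: "integrable m (indicat_real {x. inner_cell k x})"
  using emeasure_inner_cell[of k] by (intro integrable_real_indicator) auto

lemma proj_in_L_space: "proj k z \<in> L_space m"
  unfolding L_space_def
proof (intro CollectI conjI)
  let ?c = "\<Sum>a\<in>knots k. \<bar>z a\<bar>"
  have b: "\<bar>proj k z x\<bar> \<le> indicator {x. inner_cell k x} x * ?c" for x
    using proj_diff_le[of k z x "\<lambda>_. 0"] by (simp add: proj_def)
  have c: "0 \<le> ?c" by (simp add: sum_nonneg)
  then have "\<bar>proj k z x\<bar> \<le> ?c" for x
    using b[of x] by (cases "inner_cell k x") auto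
  then show "bounded (range (proj k z))"
    unfolding bounded_iff by auto
  show "integrable m (proj k z)"
  proof (rule Bochner_Integration.integrable_bound)
    show "integrable m (\<lambda>x. indicat_real {x. inner_cell k x} x * ?c)"
      using integrable_inner_cell by simp
    show "AE x in m. norm (proj k z x) \<le> norm (indicat_real {x. inner_cell k x} x * ?c)"
      using b c by (auto intro!: AE_I2 simp: abs_mult)
  qed (simp add: measurable_cong_sets[OF sets_m refl])
qed

definition mass :: "nat \<Rightarrow> real" where
  "mass k = measure m {x. inner_cell k x}"

lemma L_dist_proj: "L_dist m (proj k y) (proj k y') \<le> (1 + mass k) * (\<Sum>a\<in>knots k. \<bar>y a - y' a\<bar>)"
proof -
  let ?c = "\<Sum>a\<in>knots k. \<bar>y a - y' a\<bar>"
  have c: "0 \<le> ?c" by (simp add: sum_nonneg)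
  have m0: "0 \<le> mass k" by (simp add: mass_def)
  note b = proj_diff_le[of k y _ y']
  show ?thesis
  proof (rule L_dist_le[where c = ?c and d = "mass k * ?c"])
    show "\<bar>proj k y x - proj k y' x\<bar> \<le> ?c" for x
      using b[of x] c by (cases "inner_cell k x") auto
    have "(\<integral>x. \<bar>proj k y x - proj k y' x\<bar> \<partial>m) \<le> (\<integral>x. indicator {x. inner_cell k x} x * ?c \<partial>m)"
      using L_space_diff[OF proj_in_L_space proj_in_L_space, of k y k y'] integrable_inner_cell b
      by (intro integral_mono) (auto simp: L_space_def)
    then show "(\<integral>x. \<bar>proj k y x - proj k y' x\<bar> \<partial>m) \<le> mass k * ?c"
      by (simp add: mass_def)
  qed (use c m0 in \<open>auto simp: distrib_right\<close>)
qed

text \<open>Right continuity extends the bound at rationals to every point; an infinite oscillation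
  leaves nothing to prove.\<close>

lemma L_dist_residual:
  assumes z: "z \<in> L_space m" and rc: "\<And>x. continuous (at_right x) z"
  shows "ennreal (L_dist m z (proj k z)) \<le> residual k z"
proof (cases "oscillation k z")
  case (real c)
  let ?d = "\<lambda>x. z x - proj k z x"
  have rat: "\<bar>?d q\<bar> \<le> c" if "q \<in> \<rat>" for q
  proof -
    have "ennreal \<bar>?d q\<bar> \<le> oscillation k z"
      unfolding oscillation_def using that by (intro SUP_upper)
    then show ?thesis
      using real by simp
  qed
  have d: "\<bar>?d x\<bar> \<le> c" for x
    by (rule right_continuous_abs_le[OF _ rat]) (intro continuous_diff rc proj_right_continuous)
  have int: "integrable m (\<lambda>x. \<bar>?d x\<bar>)"
    using L_space_diff[OF z proj_in_L_space[of k z]] by (auto simp: L_space_def)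
  have i0: "0 \<le> (\<integral>x. \<bar>?d x\<bar> \<partial>m)" by simp
  have "L_dist m z (proj k z) \<le> c + (\<integral>x. \<bar>?d x\<bar> \<partial>m)"
    by (rule L_dist_le[OF d order_refl]) (use real i0 in auto)
  then have "ennreal (L_dist m z (proj k z)) \<le> ennreal (c + (\<integral>x. \<bar>?d x\<bar> \<partial>m))"
    by (rule ennreal_leI)
  also have "\<dots> = residual k z"
    unfolding residual_def real(2) using real(1) i0 int by (simp add: ennreal_plus nn_integral_eq_integral)
  finally show ?thesis .
qed (simp add: residual_def)

text \<open>Composition with the projection turns a functional into a Lipschitz function of the
  values at the knots, to which the uniform finite-dimensional bound applies.\<close>

lemma lipschitz_proj:
  assumes h: "lipschitz_L m B K h" and "0 \<le> K"
  shows "\<bar>h (proj k y)\<bar> \<le> B"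
    and "\<bar>h (proj k y) - h (proj k y')\<bar> \<le> (K * (1 + mass k)) * (\<Sum>a\<in>knots k. \<bar>y a - y' a\<bar>)"
proof -
  show "\<bar>h (proj k y)\<bar> \<le> B"
    using lipschitz_L_D(1)[OF h proj_in_L_space] .
  have "\<bar>h (proj k y) - h (proj k y')\<bar> \<le> K * L_dist m (proj k y) (proj k y')"
    using lipschitz_L_D(2)[OF h proj_in_L_space proj_in_L_space] .
  also have "\<dots> \<le> K * ((1 + mass k) * (\<Sum>a\<in>knots k. \<bar>y a - y' a\<bar>))"
    by (intro mult_left_mono L_dist_proj assms)
  finally show "\<bar>h (proj k y) - h (proj k y')\<bar> \<le> (K * (1 + mass k)) * (\<Sum>a\<in>knots k. \<bar>y a - y' a\<bar>)"
    by (simp add: mult.assoc)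
qed

text \<open>The Lipschitz bound serves when the residual is below 1, and the bound
  \<open>2 * B\<close> otherwise; the sum of the two constants covers both.\<close>

lemma lipschitz_residual:
  assumes h: "lipschitz_L m B K h" and "0 \<le> K" "0 \<le> B"
    and z: "z \<in> L_space m" and rc: "\<And>x. continuous (at_right x) z"
  shows "ennreal \<bar>h z - h (proj k z)\<bar> \<le> ennreal (K + 2 * B) * min 1 (residual k z)"
proof -
  note p = proj_in_L_space[of k z]
  have 1: "\<bar>h z - h (proj k z)\<bar> \<le> 2 * B"
    using lipschitz_L_D(1)[OF h z] lipschitz_L_D(1)[OF h p] by linarith
  have 2: "\<bar>h z - h (proj k z)\<bar> \<le> K * L_dist m z (proj k z)"
    by (rule lipschitz_L_D(2)[OF h z p])
  show ?thesis
  proof (cases "1 \<le> residual k z")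
    case True
    moreover have "ennreal \<bar>h z - h (proj k z)\<bar> \<le> ennreal (K + 2 * B)"
      using 1 \<open>0 \<le> K\<close> by (intro ennreal_leI) linarith
    ultimately show ?thesis
      by (simp add: min_absorb1 del: ennreal_plus)
  next
    case False
    have "ennreal \<bar>h z - h (proj k z)\<bar> \<le> ennreal K * ennreal (L_dist m z (proj k z))"
      using 2 \<open>0 \<le> K\<close> L_dist_nonneg[of m z "proj k z"] by (simp add: ennreal_leI flip: ennreal_mult)
    also have "\<dots> \<le> ennreal (K + 2 * B) * residual k z"
      using \<open>0 \<le> B\<close> by (intro mult_mono ennreal_leI L_dist_residual z rc) auto
    finally show ?thesis
      using False by (simp add: min_absorb2)
  qed
qed

text \<open>For a fixed sample the process moves in the span of \<open>n\<close> fixed paths,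
  linearly in the multipliers. Hence \<open>h\<close> of it is a Lipschitz function of
  \<open>n\<close> real variables, with \<open>P\<close> bounding the norms of the paths.\<close>

lemma lipschitz_W_measurable:
  assumes h: "lipschitz_L m B K h" and "0 \<le> K" and g: "good \<omega>"
  shows "(\<lambda>\<omega>'. h (W n \<omega> \<omega>')) \<in> borel_measurable M"
proof -
  define G where "G c = h (\<lambda>x. \<Sum>i<n. (c i / sqrt (real n)) * path i \<omega> x)" for c :: "nat \<Rightarrow> real"
  define P where "P = (\<Sum>i<n. L_dist m (path i \<omega>) (\<lambda>_. 0))"
  have p: "path i \<omega> \<in> L_space m" for i
    using g by (simp add: good_def)
  have in_L: "(\<lambda>x. \<Sum>i<n. (c i / sqrt (real n)) * path i \<omega> x) \<in> L_space m" for c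
    by (intro L_space_sum L_space_scale p)
  have P: "0 \<le> P" "\<And>i. i < n \<Longrightarrow> L_dist m (path i \<omega>) (\<lambda>_. 0) \<le> P"
    unfolding P_def by (auto intro!: sum_nonneg L_dist_nonneg member_le_sum)
  have "\<bar>G c - G c'\<bar> \<le> (K * P) * (\<Sum>i<n. \<bar>c i - c' i\<bar>)" for c c'
  proof -
    let ?z = "\<lambda>c x. \<Sum>i<n. (c i / sqrt (real n)) * path i \<omega> x"
    have diff: "\<bar>?z c x - ?z c' x\<bar> \<le> (\<Sum>i<n. \<bar>c i - c' i\<bar> * \<bar>path i \<omega> x\<bar>)" for x
    proof -
      have "?z c x - ?z c' x = (\<Sum>i<n. ((c i - c' i) / sqrt (real n)) * path i \<omega> x)"
        by (simp add: sum_subtractf diff_divide_distrib left_diff_distrib)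
      also have "\<bar>\<dots>\<bar> \<le> (\<Sum>i<n. \<bar>((c i - c' i) / sqrt (real n)) * path i \<omega> x\<bar>)"
        by (rule sum_abs)
      also have "\<dots> \<le> (\<Sum>i<n. \<bar>c i - c' i\<bar> * \<bar>path i \<omega> x\<bar>)"
      proof (intro sum_mono)
        fix i assume "i \<in> {..<n}"
        then have "1 \<le> sqrt (real n)" by simp
        then have "\<bar>c i - c' i\<bar> / sqrt (real n) \<le> \<bar>c i - c' i\<bar>"
          by (simp add: divide_le_eq mult_le_cancel_left1 mult_left_le)
        then show "\<bar>((c i - c' i) / sqrt (real n)) * path i \<omega> x\<bar> \<le> \<bar>c i - c' i\<bar> * \<bar>path i \<omega> x\<bar>"
          by (simp add: abs_mult abs_divide mult_right_mono del: times_divide_eq_left)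
      qed
      finally show ?thesis .
    qed
    have sup: "\<bar>path i \<omega> x\<bar> \<le> L_dist m (path i \<omega>) (\<lambda>_. 0)" for i x
      using L_dist_abs_le[OF p L_space_zero, of i x] by simp
    have int: "(\<integral>x. \<bar>path i \<omega> x\<bar> \<partial>m) \<le> L_dist m (path i \<omega>) (\<lambda>_. 0)" for i
      unfolding L_dist_def L_norm_def by simp
    have "L_dist m (?z c) (?z c') \<le> (\<Sum>i<n. \<bar>c i - c' i\<bar> * P)"
    proof (rule L_dist_le[where c = "\<Sum>i<n. \<bar>c i - c' i\<bar> * P" and d = "\<Sum>i<n. \<bar>c i - c' i\<bar> * P"])
      show "\<bar>?z c x - ?z c' x\<bar> \<le> (\<Sum>i<n. \<bar>c i - c' i\<bar> * P)" for x
      proof (rule order_trans[OF diff], intro sum_mono mult_left_mono)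
        fix i assume "i \<in> {..<n}"
        then show "\<bar>path i \<omega> x\<bar> \<le> P"
          using order_trans[OF sup P(2)] by simp
      qed simp
      have "(\<integral>x. \<bar>?z c x - ?z c' x\<bar> \<partial>m) \<le> (\<integral>x. (\<Sum>i<n. \<bar>c i - c' i\<bar> * \<bar>path i \<omega> x\<bar>) \<partial>m)"
        using L_space_diff[OF in_L in_L, of c c'] p by (intro integral_mono diff) (auto simp: L_space_def)
      also have "\<dots> = (\<Sum>i<n. \<bar>c i - c' i\<bar> * (\<integral>x. \<bar>path i \<omega> x\<bar> \<partial>m))"
        using p by (subst Bochner_Integration.integral_sum) (auto simp: L_space_def)
      also have "\<dots> \<le> (\<Sum>i<n. \<bar>c i - c' i\<bar> * P)"
        using order_trans[OF int P(2)] by (intro sum_mono mult_left_mono) auto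
      finally show "(\<integral>x. \<bar>?z c x - ?z c' x\<bar> \<partial>m) \<le> (\<Sum>i<n. \<bar>c i - c' i\<bar> * P)" .
    qed auto
    then have "K * L_dist m (?z c) (?z c') \<le> K * (\<Sum>i<n. \<bar>c i - c' i\<bar> * P)"
      by (rule mult_left_mono) fact
    moreover have "K * (\<Sum>i<n. \<bar>c i - c' i\<bar> * P) = (K * P) * (\<Sum>i<n. \<bar>c i - c' i\<bar>)"
      unfolding sum_distrib_right[symmetric] by (simp only: mult_ac)
    ultimately show ?thesis
      using lipschitz_L_D(2)[OF h in_L in_L, of c c'] unfolding G_def by linarith
  qed
  then have "(\<lambda>\<omega>'. G (\<lambda>i. \<xi> i \<omega>')) \<in> borel_measurable M"
    using P(1) \<open>0 \<le> K\<close>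
    by (intro lipschitz_borel_measurable[where T = "{..<n}" and K = "K * P" and g = G and V = "\<lambda>\<omega>' i. \<xi> i \<omega>'"]) auto
  then show ?thesis
    unfolding G_def W_path .
qed

end

section \<open>Outer expectations and measurability\<close>

text \<open>Integrable envelopes on both sides make the two sets of integrals nonempty and bounded
  by one another, so neither \<open>Inf\<close> nor \<open>Sup\<close> takes an arbitrary
  value.\<close>

lemma (in prob_space) outer_minus_inner_expectation:
  assumes f: "\<And>\<omega>. \<omega> \<in> space M \<Longrightarrow> \<bar>f \<omega>\<bar> \<le> (B :: real)"
    and U: "integrable M U" "\<And>\<omega>. \<omega> \<in> space M \<Longrightarrow> f \<omega> \<le> U \<omega>"
    and L: "integrable M L" "\<And>\<omega>. \<omega> \<in> space M \<Longrightarrow> L \<omega> \<le> f \<omega>"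
  shows "0 \<le> outer_expectation M f - inner_expectation M f"
    and "outer_expectation M f - inner_expectation M f \<le> expectation U - expectation L"
proof -
  let ?O = "{(\<integral>\<omega>. V \<omega> \<partial>M) |V. integrable M V \<and> (\<forall>\<omega>\<in>space M. f \<omega> \<le> V \<omega>)}"
  let ?I = "{(\<integral>\<omega>. V \<omega> \<partial>M) |V. integrable M V \<and> (\<forall>\<omega>\<in>space M. V \<omega> \<le> f \<omega>)}"
  have le: "b \<le> a" if "a \<in> ?O" "b \<in> ?I" for a b
  proof -
    from that obtain V V' where V: "a = expectation V" "integrable M V" "\<forall>\<omega>\<in>space M. f \<omega> \<le> V \<omega>"
      and V': "b = expectation V'" "integrable M V'" "\<forall>\<omega>\<in>space M. V' \<omega> \<le> f \<omega>"
      by blast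
    then show ?thesis
      by (auto intro!: integral_mono intro: order_trans)
  qed
  have O: "expectation U \<in> ?O" and I: "expectation L \<in> ?I"
    using U L by auto
  have "Sup ?I \<le> Inf ?O"
    using O I le by (intro cSup_least cInf_greatest) (auto simp only: empty_iff)
  then show "0 \<le> outer_expectation M f - inner_expectation M f"
    by (simp add: outer_expectation_def inner_expectation_def)
  have "Inf ?O \<le> expectation U"
    using le[OF _ I] by (intro cInf_lower O bdd_belowI)
  moreover have "expectation L \<le> Sup ?I"
    using le[OF O] by (intro cSup_upper I bdd_aboveI)
  ultimately show "outer_expectation M f - inner_expectation M f \<le> expectation U - expectation L"
    by (simp add: outer_expectation_def inner_expectation_def)
qed

lemma outer_expectation_zero: "outer_expectation M (\<lambda>_. 0) = 0"
  unfolding outer_expectation_def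
proof (rule cInf_eq_minimum)
  show "(0::real) \<in> {(\<integral>\<omega>. U \<omega> \<partial>M) |U. integrable M U \<and> (\<forall>\<omega>\<in>space M. 0 \<le> U \<omega>)}"
    by (intro CollectI exI[of _ "\<lambda>_. 0 :: real"]) simp
qed (auto intro!: Bochner_Integration.integral_nonneg)

lemma space_L_borel [simp]: "space (L_borel m) = L_space m"
  by (simp add: L_borel_def space_measure_of_conv)

lemma continuous_L_measurable:
  assumes "continuous_map (L_topology m) euclideanreal h"
  shows "h \<in> borel_measurable (L_borel m)"
proof (rule borel_measurableI)
  fix S :: "real set" assume "open S"
  then have "openin (L_topology m) {z \<in> topspace (L_topology m). h z \<in> S}"
    by (intro openin_continuous_map_preimage[OF assms]) simp
  moreover have "{z \<in> topspace (L_topology m). h z \<in> S} = h -` S \<inter> space (L_borel m)"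
    by auto
  moreover have "{U. openin (L_topology m) U} \<subseteq> Pow (L_space m)"
    using openin_subset[of "L_topology m"] by auto
  ultimately show "h -` S \<inter> space (L_borel m) \<in> sets (L_borel m)"
    unfolding L_borel_def by (simp add: sets_measure_of sigma_sets.Basic)
qed

lemma ennreal_tendsto_zeroI:
  fixes f :: "nat \<Rightarrow> ennreal"
  assumes "\<And>e::real. 0 < e \<Longrightarrow> \<forall>\<^sub>F n in sequentially. f n \<le> ennreal e"
  shows "f \<longlonglongrightarrow> 0"
proof (rule order_tendstoI)
  fix a :: ennreal assume "0 < a"
  then obtain e where "0 < e" "ennreal e < a"
  proof (cases a)
    case (real r)
    then show thesis
      using \<open>0 < a\<close> by (intro that[of "r / 2"]) (auto simp: ennreal_less_iff)
  qed (use that[of 1] in auto)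
  then show "\<forall>\<^sub>F n in sequentially. f n < a"
    using assms[of e] by (auto elim!: eventually_mono)
qed simp

section \<open>The limit process\<close>

locale multiplier_main = multiplier_L M \<xi> X D F m + multiplier_limit M \<xi> X D F N Z
  for M :: "'a measure" and \<xi> X D F m and N :: "'b measure" and Z +
  assumes Z_limit: "weak_limit m M (\<lambda>n \<omega>. empirical_process F (\<lambda>i. X i \<omega>) n) N Z"
    and X_xi_indep: "indep_var (\<Pi>\<^sub>M i\<in>UNIV. borel) (\<lambda>\<omega> i. X i \<omega>) (\<Pi>\<^sub>M i\<in>UNIV. borel) (\<lambda>\<omega> i. \<xi> i \<omega>)"
begin

sublocale Nm: pair_sigma_finite N m
  by standard

lemma Z_L_measurable: "Z \<in> measurable N (L_borel m)"
  using Z_limit by (simp add: weak_limit_def)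

lemma Z_in_L_space: "\<omega> \<in> space N \<Longrightarrow> Z \<omega> \<in> L_space m"
  using measurable_space[OF Z_L_measurable] by simp

lemma continuous_Z_measurable:
  "continuous_map (L_topology m) euclideanreal h \<Longrightarrow> (\<lambda>\<omega>. h (Z \<omega>)) \<in> borel_measurable N"
  by (rule measurable_compose[OF Z_L_measurable continuous_L_measurable])

text \<open>
  The empirical processes have right continuous paths, and these form a closed set, so the weak limit
  lives on it.
\<close>

lemma AE_Z_right_continuous: "AE \<omega> in N. \<forall>x. continuous (at_right x) (Z \<omega>)"
proof -
  define RC where "RC w \<longleftrightarrow> (\<forall>x. continuous (at_right x) w)" for w :: "real \<Rightarrow> real"
  \<comment> \<open>Inf-convolution of the indicator of the complement gives the distance to the
    right continuous elements of the space, capped at 1.\<close>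
  define f where "f w = (if RC w then 0 else 1 :: real)" for w
  define h where "h = lip_minorant m 1 f"
  have fb: "\<bar>f z\<bar> \<le> 1" for z
    by (simp add: f_def)
  have lip: "lipschitz_L m 1 1 h"
    unfolding h_def by (rule lipschitz_lip_minorant[OF fb]) simp
  have cont: "continuous_map (L_topology m) euclideanreal h"
    by (rule lipschitz_L_continuous[OF lip]) simp
  have h0: "0 \<le> h z" for z
  proof (cases "z \<in> L_space m")
    case True
    show ?thesis
      unfolding h_def by (rule lip_minorant_greatest[OF fb _ True]) (auto simp: f_def L_dist_nonneg)
  qed (simp add: h_def lip_minorant_def)
  have hRC: "h z = 0" if "RC z" for z
  proof (cases "z \<in> L_space m")
    case True
    have "h z \<le> f z"
      unfolding h_def by (rule lip_minorant_le[OF fb _ True]) simp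
    then show ?thesis using h0[of z] that by (simp add: f_def)
  qed (simp add: h_def lip_minorant_def)
  have "h \<in> Cb_L m"
    unfolding Cb_L_def using cont lipschitz_L_D(1)[OF lip]
    by (auto simp: bounded_iff h_def lip_minorant_def)
  then have "(\<lambda>n. outer_expectation M (\<lambda>\<omega>. h (empirical_process F (\<lambda>i. X i \<omega>) n))) \<longlonglongrightarrow> (\<integral>\<omega>. h (Z \<omega>) \<partial>N)"
    using Z_limit by (simp add: weak_limit_def)
  \<comment> \<open>This includes samples whose empirical process lies outside the space, where
    \<open>h\<close> is 0 by convention.\<close>
  moreover have "h (empirical_process F (\<lambda>i. X i \<omega>) n) = 0" for n \<omega>
    by (rule hRC) (simp add: RC_def empirical_process_right_continuous)
  ultimately have "(\<lambda>n::nat. 0) \<longlonglongrightarrow> (\<integral>\<omega>. h (Z \<omega>) \<partial>N)"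
    by (simp add: outer_expectation_zero)
  then have int0: "(\<integral>\<omega>. h (Z \<omega>) \<partial>N) = 0"
    by (simp add: LIMSEQ_const_iff)
  have "integrable N (\<lambda>\<omega>. h (Z \<omega>))"
    using lipschitz_L_D(1)[OF lip Z_in_L_space]
    by (intro N.integrable_const_bound[where B = 1] continuous_Z_measurable cont AE_I2) auto
  then have "AE \<omega> in N. h (Z \<omega>) = 0"
    using int0 h0 by (subst (asm) integral_nonneg_eq_0_iff_AE) auto
  then show ?thesis
    using AE_space
  proof eventually_elim
    case (elim \<omega>)
    note z = Z_in_L_space[OF elim(2)]
    show ?case
    proof
      fix x
      show "continuous (at_right x) (Z \<omega>)"
        unfolding continuous_within
      proof (rule tendstoI)
        fix e :: real assume "0 < e"
        define d where "d = min 1 (e / 3)"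
        have d: "0 < d" "d \<le> 1" "3 * d \<le> e" using \<open>0 < e\<close> by (auto simp: d_def)
        \<comment> \<open>A near minimiser of value below \<open>d \<le> 1\<close> cannot have paid
          the penalty 1, so it is right continuous.\<close>
        have "\<exists>w\<in>L_space m. f w + 1 * L_dist m (Z \<omega>) w < d"
        proof (rule ccontr)
          assume "\<not> ?thesis"
          then have "d \<le> h (Z \<omega>)"
            unfolding h_def by (intro lip_minorant_greatest[OF fb _ z]) (auto simp: not_less)
          then show False using elim(1) d by simp
        qed
        then obtain w where w: "w \<in> L_space m" "f w + L_dist m (Z \<omega>) w < d" by auto
        then have rc: "RC w"
          using d L_dist_nonneg[of m "Z \<omega>" w] by (auto simp: f_def split: if_splits)
        then have close: "\<bar>Z \<omega> y - w y\<bar> < d" for y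
          using L_dist_abs_le[OF z w(1), of y] w(2) by (simp add: f_def)
        have "(w \<longlongrightarrow> w x) (at_right x)"
          using rc by (simp add: RC_def continuous_within)
        then have "\<forall>\<^sub>F y in at_right x. dist (w y) (w x) < d"
          using d by (intro tendstoD)
        then show "\<forall>\<^sub>F y in at_right x. dist (Z \<omega> y) (Z \<omega> x) < e"
        proof eventually_elim
          case (elim y)
          then show ?case
            using close[of x] close[of y] d unfolding dist_real_def by linarith
        qed
      qed
    qed
  qed
qed

lemma proj_Z_measurable [measurable]: "(\<lambda>\<omega>. proj k (Z \<omega>) x) \<in> borel_measurable N"
  unfolding proj_def by measurable

lemma oscillation_Z_measurable [measurable]: "(\<lambda>\<omega>. oscillation k (Z \<omega>)) \<in> borel_measurable N"
  unfolding oscillation_def by (intro borel_measurable_SUP countable_rat) measurable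

text \<open>One large \<open>n\<close> gives the bound up to \<open>e\<close>: the mean under the
  limit exceeds the mean under the process by at most the mean of \<open>R n\<close>.\<close>

lemma finite_dimensional_limit_le:
  assumes T: "finite T" and "0 \<le> K" and g: "\<And>y. 0 \<le> g y" "\<And>y. g y \<le> B"
    and gL: "\<And>y y'. \<bar>g y - g y'\<bar> \<le> K * (\<Sum>x\<in>T. \<bar>y x - y' x\<bar>)"
    and le: "\<forall>\<^sub>F n in sequentially. (\<integral>\<^sup>+\<omega>. \<integral>\<^sup>+\<omega>'. ennreal (g (W n \<omega> \<omega>')) \<partial>M \<partial>M) \<le> ennreal \<epsilon>" and "0 \<le> \<epsilon>"
  shows "N.expectation (\<lambda>\<omega>. g (Z \<omega>)) \<le> \<epsilon>"
proof (rule field_le_epsilon)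
  fix e :: real assume e: "0 < e"
  have gB: "\<bar>g y\<bar> \<le> B" for y using g[of y] by simp
  have B: "0 \<le> B" using gB[of undefined] by linarith
  obtain R where R: "\<And>n. integrable M (R n)" "\<forall>\<^sub>F n in sequentially. expectation (R n) \<le> e"
    "\<And>g n \<omega>. (\<And>y. \<bar>g y\<bar> \<le> B) \<Longrightarrow> (\<And>y y'. \<bar>g y - g y'\<bar> \<le> K * (\<Sum>x\<in>T. \<bar>y x - y' x\<bar>)) \<Longrightarrow>
      \<bar>cond g n \<omega> - N.expectation (\<lambda>\<omega>. g (Z \<omega>))\<bar> \<le> R n \<omega>"
    by (rule finite_dimensional_uniform[OF T \<open>0 \<le> K\<close> B e]) blast
  have "\<forall>\<^sub>F n in sequentially. (\<integral>\<^sup>+\<omega>. \<integral>\<^sup>+\<omega>'. ennreal (g (W n \<omega> \<omega>')) \<partial>M \<partial>M) \<le> ennreal \<epsilon> \<and> expectation (R n) \<le> e"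
    using le R(2) by eventually_elim simp
  then obtain n where n: "(\<integral>\<^sup>+\<omega>. \<integral>\<^sup>+\<omega>'. ennreal (g (W n \<omega> \<omega>')) \<partial>M \<partial>M) \<le> ennreal \<epsilon>" "expectation (R n) \<le> e"
    unfolding eventually_sequentially by blast
  have R': "\<bar>cond g n \<omega> - N.expectation (\<lambda>\<omega>. g (Z \<omega>))\<bar> \<le> R n \<omega>" for \<omega>
    by (rule R(3)[OF gB gL])
  have [measurable]: "(\<lambda>p. g (W n (fst p) (snd p))) \<in> borel_measurable (M \<Otimes>\<^sub>M M)"
    by (rule lipschitz_borel_measurable[OF T \<open>0 \<le> K\<close> gL]) measurable
  have "ennreal (N.expectation (\<lambda>\<omega>. g (Z \<omega>))) = (\<integral>\<^sup>+\<omega>. ennreal (N.expectation (\<lambda>\<omega>. g (Z \<omega>))) \<partial>M)"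
    by (simp add: emeasure_space_1)
  also have "\<dots> \<le> (\<integral>\<^sup>+\<omega>. (\<integral>\<^sup>+\<omega>'. ennreal (g (W n \<omega> \<omega>')) \<partial>M) + ennreal (R n \<omega>) \<partial>M)"
  proof (rule nn_integral_mono)
    fix \<omega>
    have "ennreal (N.expectation (\<lambda>\<omega>. g (Z \<omega>))) \<le> ennreal (cond g n \<omega> + R n \<omega>)"
      using R'[of \<omega>] by (intro ennreal_leI) linarith
    also have "\<dots> = ennreal (cond g n \<omega>) + ennreal (R n \<omega>)"
      using R'[of \<omega>] g(1) unfolding cond_def by (intro ennreal_plus Bochner_Integration.integral_nonneg) auto
    also have "ennreal (cond g n \<omega>) = (\<integral>\<^sup>+\<omega>'. ennreal (g (W n \<omega> \<omega>')) \<partial>M)"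
      unfolding cond_def using g(1) lipschitz_W_integrable(1)[OF T \<open>0 \<le> K\<close> gB gL]
      by (intro nn_integral_eq_integral[symmetric]) auto
    finally show "ennreal (N.expectation (\<lambda>\<omega>. g (Z \<omega>))) \<le> (\<integral>\<^sup>+\<omega>'. ennreal (g (W n \<omega> \<omega>')) \<partial>M) + ennreal (R n \<omega>)" .
  qed
  also have "\<dots> = (\<integral>\<^sup>+\<omega>. \<integral>\<^sup>+\<omega>'. ennreal (g (W n \<omega> \<omega>')) \<partial>M \<partial>M) + (\<integral>\<^sup>+\<omega>. ennreal (R n \<omega>) \<partial>M)"
    using borel_measurable_integrable[OF R(1)[of n]] by (intro nn_integral_add) measurable
  also have "(\<integral>\<^sup>+\<omega>. ennreal (R n \<omega>) \<partial>M) = ennreal (expectation (R n))"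
  proof (rule nn_integral_eq_integral[OF R(1)])
    show "AE \<omega> in M. 0 \<le> R n \<omega>"
      using order_trans[OF abs_ge_zero R'] by simp
  qed
  also have "(\<integral>\<^sup>+\<omega>. \<integral>\<^sup>+\<omega>'. ennreal (g (W n \<omega> \<omega>')) \<partial>M \<partial>M) + ennreal (expectation (R n)) \<le> ennreal \<epsilon> + ennreal e"
    using n by (intro add_mono ennreal_leI)
  also have "\<dots> = ennreal (\<epsilon> + e)"
    using \<open>0 \<le> \<epsilon>\<close> e by (simp add: ennreal_plus)
  finally show "N.expectation (\<lambda>\<omega>. g (Z \<omega>)) \<le> \<epsilon> + e"
    using \<open>0 \<le> \<epsilon>\<close> e by (simp add: ennreal_le_iff del: ennreal_plus)
qed

section \<open>Oscillation of the limit process\<close>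

definition rat :: "nat \<Rightarrow> real" where
  "rat = from_nat_into \<rat>"

lemma range_rat: "range rat = \<rat>"
  unfolding rat_def by (rule range_from_nat_into[OF _ countable_rat]) auto

text \<open>Over the first \<open>j\<close> rationals the supremum is a Lipschitz function of
  finitely many coordinates, to which finite-dimensional limits apply; the full oscillation is its
  increasing limit.\<close>

primrec partial_oscillation :: "nat \<Rightarrow> nat \<Rightarrow> (real \<Rightarrow> real) \<Rightarrow> real" where
  "partial_oscillation k 0 z = 0"
| "partial_oscillation k (Suc j) z = max (partial_oscillation k j z) \<bar>z (rat j) - proj k z (rat j)\<bar>"

lemma partial_oscillation_nonneg: "0 \<le> partial_oscillation k j z"
  by (induction j) auto

lemma partial_oscillation_le: "ennreal (partial_oscillation k j z) \<le> oscillation k z"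
proof (induction j)
  case (Suc j)
  have "rat j \<in> \<rat>"
    using range_rat by blast
  then have "ennreal \<bar>z (rat j) - proj k z (rat j)\<bar> \<le> oscillation k z"
    unfolding oscillation_def by (rule SUP_upper)
  with Suc show ?case
    by (simp add: max_def)
qed simp

lemma oscillation_eq_SUP: "oscillation k z = (SUP j. ennreal (partial_oscillation k j z))"
proof (rule antisym)
  show "oscillation k z \<le> (SUP j. ennreal (partial_oscillation k j z))"
    unfolding oscillation_def
  proof (rule SUP_least)
    fix q :: real assume "q \<in> \<rat>"
    then obtain j where "q = rat j"
      using range_rat by blast
    then have "ennreal \<bar>z q - proj k z q\<bar> \<le> ennreal (partial_oscillation k (Suc j) z)"
      by (intro ennreal_leI) simp
    then show "ennreal \<bar>z q - proj k z q\<bar> \<le> (SUP j. ennreal (partial_oscillation k j z))"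
      by (rule order_trans) (rule SUP_upper, simp)
  qed
qed (intro SUP_least partial_oscillation_le)

text \<open>Each rational brings in its own coordinate and at most one knot, hence the 2. The growth
  with \<open>j\<close> is harmless, as \<open>j\<close> is fixed when \<open>n\<close> tends to
  infinity.\<close>

lemma partial_oscillation_lipschitz:
  assumes "finite T" "rat ` {..<j} \<subseteq> T" "knots k \<subseteq> T"
  shows "\<bar>partial_oscillation k j y - partial_oscillation k j y'\<bar> \<le> (2 * real j) * (\<Sum>x\<in>T. \<bar>y x - y' x\<bar>)"
  using assms(2)
proof (induction j)
  case (Suc j)
  let ?S = "\<Sum>x\<in>T. \<bar>y x - y' x\<bar>"
  have 1: "\<bar>y (rat j) - y' (rat j)\<bar> \<le> ?S"
    using Suc.prems by (intro member_le_sum[of "rat j" T "\<lambda>x. \<bar>y x - y' x\<bar>"] assms(1)) auto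
  have "\<bar>proj k y (rat j) - proj k y' (rat j)\<bar> \<le> indicator {x. inner_cell k x} (rat j) * (\<Sum>a\<in>knots k. \<bar>y a - y' a\<bar>)"
    by (rule proj_diff_le)
  also have "\<dots> \<le> 1 * ?S"
    using assms by (intro mult_mono sum_mono2) (auto simp: indicator_def sum_nonneg)
  finally have 2: "\<bar>proj k y (rat j) - proj k y' (rat j)\<bar> \<le> ?S"
    by simp
  have max: "\<bar>max a b - max a' b'\<bar> \<le> \<bar>a - a'\<bar> + \<bar>b - b'\<bar>" for a b a' b' :: real
    by linarith
  have "\<bar>\<bar>u - v\<bar> - \<bar>u' - v'\<bar>\<bar> \<le> \<bar>u - u'\<bar> + \<bar>v - v'\<bar>" for u v u' v' :: real
    by linarith
  then have "\<bar>\<bar>y (rat j) - proj k y (rat j)\<bar> - \<bar>y' (rat j) - proj k y' (rat j)\<bar>\<bar> \<le> 2 * ?S"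
    using 1 2 by (smt (verit))
  moreover have "\<bar>partial_oscillation k j y - partial_oscillation k j y'\<bar> \<le> (2 * real j) * ?S"
    using Suc.prems by (intro Suc.IH) (auto simp: lessThan_Suc)
  ultimately show ?case
    using max[of "partial_oscillation k j y" "\<bar>y (rat j) - proj k y (rat j)\<bar>" "partial_oscillation k j y'"
        "\<bar>y' (rat j) - proj k y' (rat j)\<bar>"]
    by (simp add: algebra_simps)
qed simp

text \<open>The bound passes to each capped partial oscillation by finite-dimensional convergence,
  and to the oscillation itself by monotone convergence.\<close>

lemma Z_oscillation:
  assumes le: "\<forall>\<^sub>F n in sequentially. (\<integral>\<^sup>+\<omega>. \<integral>\<^sup>+\<omega>'. min 1 (oscillation k (W n \<omega> \<omega>')) \<partial>M \<partial>M) \<le> ennreal \<epsilon>"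
    and "0 \<le> \<epsilon>"
  shows "(\<integral>\<^sup>+\<omega>. min 1 (oscillation k (Z \<omega>)) \<partial>N) \<le> ennreal \<epsilon>"
proof -
  define g where "g j z = min 1 (partial_oscillation k j z)" for j z
  have ge: "ennreal (g j z) = min 1 (ennreal (partial_oscillation k j z))" for j z
    unfolding g_def using partial_oscillation_nonneg[of k j z] by (auto simp: min_def ennreal_1[symmetric] simp del: ennreal_1)
  have g01: "0 \<le> g j z" "g j z \<le> 1" for j z
    using partial_oscillation_nonneg[of k j z] by (auto simp: g_def)
  have gL: "\<bar>g j y - g j y'\<bar> \<le> (2 * real j) * (\<Sum>x\<in>rat ` {..<j} \<union> knots k. \<bar>y x - y' x\<bar>)" for j y y'
  proof -
    have "\<bar>g j y - g j y'\<bar> \<le> \<bar>partial_oscillation k j y - partial_oscillation k j y'\<bar>"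
      unfolding g_def by linarith
    then show ?thesis
      using partial_oscillation_lipschitz[of "rat ` {..<j} \<union> knots k" j k y y'] by simp
  qed
  have gi: "integrable N (\<lambda>\<omega>. g j (Z \<omega>))" for j
    by (rule lipschitz_W_integrable(2)[OF _ _ _ gL, where B = 1]) (use g01[of j] in auto)
  have bound: "(\<integral>\<^sup>+\<omega>. ennreal (g j (Z \<omega>)) \<partial>N) \<le> ennreal \<epsilon>" for j
  proof -
    have "N.expectation (\<lambda>\<omega>. g j (Z \<omega>)) \<le> \<epsilon>"
    proof (rule finite_dimensional_limit_le[OF _ _ g01 gL _ \<open>0 \<le> \<epsilon>\<close>])
      show "\<forall>\<^sub>F n in sequentially. (\<integral>\<^sup>+\<omega>. \<integral>\<^sup>+\<omega>'. ennreal (g j (W n \<omega> \<omega>')) \<partial>M \<partial>M) \<le> ennreal \<epsilon>"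
        using le
      proof eventually_elim
        case (elim n)
        have "(\<integral>\<^sup>+\<omega>. \<integral>\<^sup>+\<omega>'. ennreal (g j (W n \<omega> \<omega>')) \<partial>M \<partial>M) \<le> (\<integral>\<^sup>+\<omega>. \<integral>\<^sup>+\<omega>'. min 1 (oscillation k (W n \<omega> \<omega>')) \<partial>M \<partial>M)"
          unfolding ge by (intro nn_integral_mono min.mono order_refl partial_oscillation_le)
        then show ?case using elim by (rule order_trans)
      qed
    qed auto
    then show ?thesis
      using gi[of j]
      using g01 by (subst nn_integral_eq_integral) (auto intro: ennreal_leI)
  qed
  have "min 1 (oscillation k z) = (SUP j. ennreal (g j z))" for z
    unfolding ge oscillation_eq_SUP inf_min[symmetric] by (rule inf_SUP)
  then have "(\<integral>\<^sup>+\<omega>. min 1 (oscillation k (Z \<omega>)) \<partial>N) = (\<integral>\<^sup>+\<omega>. (SUP j. ennreal (g j (Z \<omega>))) \<partial>N)"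
    by simp
  also have "\<dots> = (SUP j. \<integral>\<^sup>+\<omega>. ennreal (g j (Z \<omega>)) \<partial>N)"
  proof (rule nn_integral_monotone_convergence_SUP)
    show "incseq (\<lambda>j \<omega>. ennreal (g j (Z \<omega>)))"
      by (intro incseq_SucI le_funI ennreal_leI) (auto simp: g_def)
    show "(\<lambda>\<omega>. ennreal (g j (Z \<omega>))) \<in> borel_measurable N" for j
      using borel_measurable_integrable[OF gi] by measurable
  qed
  also have "\<dots> \<le> ennreal \<epsilon>"
    by (intro SUP_least bound)
  finally show ?thesis .
qed

lemma Z_abs_expectation_le:
  assumes "finite T"
  shows "(\<integral>\<^sup>+\<omega>. ennreal \<bar>\<Sum>x\<in>T. s x * Z \<omega> x\<bar> \<partial>N) \<le> ennreal (sqrt (variance_form T s))"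
proof -
  note * = N.expectation_abs_le_sqrt[OF _ Z_combination_square_integrable[OF assms, of s]]
  have "(\<integral>\<^sup>+\<omega>. ennreal \<bar>\<Sum>x\<in>T. s x * Z \<omega> x\<bar> \<partial>N) = ennreal (N.expectation (\<lambda>\<omega>. \<bar>\<Sum>x\<in>T. s x * Z \<omega> x\<bar>))"
    using *(1) by (intro nn_integral_eq_integral) auto
  also have "\<dots> \<le> ennreal (sqrt (variance_form T s))"
    using *(2) unfolding Z_combination_second_moment[OF assms] by (intro ennreal_leI) simp
  finally show ?thesis .
qed

text \<open>The modulus is the same as for the multiplier process, because only variances enter and
  these agree.\<close>

lemma Z_proj_expectation:
  "(\<integral>\<^sup>+\<omega>. ennreal \<bar>Z \<omega> x - proj k (Z \<omega>) x\<bar> \<partial>N) \<le> ennreal (L1_modulus k x)"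
proof (cases "inner_cell k x")
  case True
  let ?a = "knot k (cell k x)" and ?s = "\<lambda>y. if y = x then 1 else - 1 :: real"
  note a = inner_cell_knot(1)[OF True]
  show ?thesis
  proof (cases "?a = x")
    case False
    have "(\<integral>\<^sup>+\<omega>. ennreal \<bar>Z \<omega> x - proj k (Z \<omega>) x\<bar> \<partial>N) = (\<integral>\<^sup>+\<omega>. ennreal \<bar>\<Sum>y\<in>{?a, x}. ?s y * Z \<omega> y\<bar> \<partial>N)"
      using True False by (simp add: proj_def)
    also have "\<dots> \<le> ennreal (sqrt (variance_form {?a, x} ?s))"
      by (rule Z_abs_expectation_le) simp
    also have "\<dots> \<le> ennreal (L1_modulus k x)"
      using True False a variance_form_difference[of ?a x] by (simp add: L1_modulus_def ennreal_leI)
    finally show ?thesis .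
  qed (use True in \<open>simp add: proj_def\<close>)
next
  case False
  then show ?thesis
    using Z_abs_expectation_le[where T = "{x}" and s = "\<lambda>_. 1"] by (simp add: proj_def L1_modulus_def variance_form_singleton)
qed

text \<open>
  Right continuity of the paths gives a version of the integral in \<open>residual\<close> that is measurable in \<open>\<omega>\<close>:
  approximate \<open>x\<close> from the right by points of countably many grids.
\<close>

definition grid :: "nat \<Rightarrow> real \<Rightarrow> real" where
  "grid j x = (of_int \<lfloor>real (Suc j) * x\<rfloor> + 1) / real (Suc j)"

lemma grid_tendsto: "filterlim (\<lambda>j. grid j x) (at_right x) sequentially"
proof -
  have lo: "x < grid j x" and hi: "grid j x \<le> x + 1 / real (Suc j)" for j
  proof -
    have "real (Suc j) * x < of_int \<lfloor>real (Suc j) * x\<rfloor> + 1" "of_int \<lfloor>real (Suc j) * x\<rfloor> \<le> real (Suc j) * x"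
      by linarith+
    then show "x < grid j x" "grid j x \<le> x + 1 / real (Suc j)"
      unfolding grid_def by (simp_all add: field_simps del: of_nat_Suc)
  qed
  have lim: "(\<lambda>j. x + 1 / real (Suc j)) \<longlonglongrightarrow> x"
    using tendsto_add[OF tendsto_const LIMSEQ_Suc[OF lim_const_over_n[of 1]], of x] by simp
  have "(\<lambda>j. grid j x) \<longlonglongrightarrow> x"
    by (rule tendsto_sandwich[OF _ _ tendsto_const lim]) (use lo hi in \<open>auto intro!: always_eventually intro: less_imp_le\<close>)
  then show ?thesis
    using lo less_imp_neq[OF lo, symmetric] unfolding filterlim_at by (auto intro!: always_eventually)
qed

text \<open>Joint measurability of \<open>Z\<close> in \<open>\<omega>\<close> and \<open>x\<close>
  is not given. The lower limit along the grids is jointly measurable, and it is the absolute error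
  wherever the path is right continuous.\<close>

definition gap :: "nat \<Rightarrow> 'b \<Rightarrow> real \<Rightarrow> ennreal" where
  "gap k \<omega> x = liminf (\<lambda>j. ennreal \<bar>Z \<omega> (grid j x) - proj k (Z \<omega>) (grid j x)\<bar>)"

lemma gap_measurable [measurable]: "(\<lambda>p. gap k (fst p) (snd p)) \<in> borel_measurable (N \<Otimes>\<^sub>M m)"
proof -
  have "(\<lambda>p. ennreal \<bar>Z (fst p) (grid j (snd p)) - proj k (Z (fst p)) (grid j (snd p))\<bar>) \<in> borel_measurable (N \<Otimes>\<^sub>M m)" for j
  proof -
    \<comment> \<open>For a fixed \<open>j\<close> the grid has countably many points, indexed by
      the integer part; at each of them the function is measurable in
      \<open>\<omega>\<close>.\<close>
    define G where "G i p = ennreal \<bar>Z (fst p) ((of_int i + 1) / real (Suc j)) - proj k (Z (fst p)) ((of_int i + 1) / real (Suc j))\<bar>"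
      for i :: int and p :: "'b \<times> real"
    have 1: "G i \<in> borel_measurable (N \<Otimes>\<^sub>M m)" for i
      unfolding G_def by measurable
    have 2: "(\<lambda>p. \<lfloor>real (Suc j) * snd p\<rfloor>) \<in> measurable (N \<Otimes>\<^sub>M m) (count_space UNIV)"
      by measurable
    have "(\<lambda>p. G \<lfloor>real (Suc j) * snd p\<rfloor> p) \<in> borel_measurable (N \<Otimes>\<^sub>M m)"
      by (rule measurable_compose_countable[OF 1 2])
    then show ?thesis
      by (simp add: G_def grid_def)
  qed
  then show ?thesis
    unfolding gap_def by (intro borel_measurable_liminf)
qed

lemma AE_gap: "AE \<omega> in N. \<forall>x. gap k \<omega> x = ennreal \<bar>Z \<omega> x - proj k (Z \<omega>) x\<bar>"
  using AE_Z_right_continuous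
proof eventually_elim
  case (elim \<omega>)
  show ?case
  proof
    fix x
    have "continuous (at_right x) (\<lambda>x. Z \<omega> x - proj k (Z \<omega>) x)"
      using elim by (intro continuous_diff proj_right_continuous) auto
    then have "((\<lambda>x. Z \<omega> x - proj k (Z \<omega>) x) \<longlongrightarrow> Z \<omega> x - proj k (Z \<omega>) x) (at_right x)"
      by (simp add: continuous_within)
    from filterlim_compose[OF this grid_tendsto]
    have "(\<lambda>j. ennreal \<bar>Z \<omega> (grid j x) - proj k (Z \<omega>) (grid j x)\<bar>) \<longlonglongrightarrow> ennreal \<bar>Z \<omega> x - proj k (Z \<omega>) x\<bar>"
      by (intro tendsto_ennrealI tendsto_rabs)
    then show "gap k \<omega> x = ennreal \<bar>Z \<omega> x - proj k (Z \<omega>) x\<bar>"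
      unfolding gap_def by (rule lim_imp_Liminf[OF sequentially_bot])
  qed
qed

definition Z_residual :: "nat \<Rightarrow> 'b \<Rightarrow> ennreal" where
  "Z_residual k \<omega> = oscillation k (Z \<omega>) + (\<integral>\<^sup>+x. gap k \<omega> x \<partial>m)"

lemma Z_residual_measurable [measurable]: "Z_residual k \<in> borel_measurable N"
  unfolding Z_residual_def[abs_def] by measurable

lemma AE_Z_residual: "AE \<omega> in N. Z_residual k \<omega> = residual k (Z \<omega>)"
  using AE_gap[of k] by eventually_elim (simp add: Z_residual_def residual_def)

lemma gap_expectation: "(\<integral>\<^sup>+\<omega>. \<integral>\<^sup>+x. gap k \<omega> x \<partial>m \<partial>N) \<le> (\<integral>\<^sup>+x. ennreal (L1_modulus k x) \<partial>m)"
proof -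
  have "(\<integral>\<^sup>+\<omega>. \<integral>\<^sup>+x. gap k \<omega> x \<partial>m \<partial>N) = (\<integral>\<^sup>+x. \<integral>\<^sup>+\<omega>. gap k \<omega> x \<partial>N \<partial>m)"
    by (rule Nm.Fubini'[symmetric]) (simp add: case_prod_beta' gap_measurable)
  also have "\<dots> = (\<integral>\<^sup>+x. \<integral>\<^sup>+\<omega>. ennreal \<bar>Z \<omega> x - proj k (Z \<omega>) x\<bar> \<partial>N \<partial>m)"
    by (intro nn_integral_cong nn_integral_cong_AE) (use AE_gap[of k] in \<open>auto elim: eventually_mono\<close>)
  also have "\<dots> \<le> (\<integral>\<^sup>+x. ennreal (L1_modulus k x) \<partial>m)"
    by (intro nn_integral_mono Z_proj_expectation)
  finally show ?thesis .
qed

text \<open>One \<open>k\<close> has to serve both processes, since they are compared through the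
  same projection.\<close>

lemma residual_small:
  assumes "0 < \<epsilon>"
  obtains k where "\<forall>\<^sub>F n in sequentially. (\<integral>\<^sup>+\<omega>. \<integral>\<^sup>+\<omega>'. min 1 (residual k (W n \<omega> \<omega>')) \<partial>M \<partial>M) \<le> ennreal \<epsilon>"
    and "(\<integral>\<^sup>+\<omega>. min 1 (Z_residual k \<omega>) \<partial>N) \<le> ennreal \<epsilon>"
proof -
  have e2: "0 < \<epsilon> / 2" using assms by simp
  obtain k1 where k1: "\<And>k. k1 \<le> k \<Longrightarrow>
    \<forall>\<^sub>F n in sequentially. (\<integral>\<^sup>+\<omega>. \<integral>\<^sup>+\<omega>'. min 1 (residual k (W n \<omega> \<omega>')) \<partial>M \<partial>M) \<le> ennreal \<epsilon>"
    by (rule W_residual[OF assms]) blast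
  obtain k2 where k2: "\<And>k. k2 \<le> k \<Longrightarrow>
    \<forall>\<^sub>F n in sequentially. (\<integral>\<^sup>+\<omega>. \<integral>\<^sup>+\<omega>'. min 1 (oscillation k (W n \<omega> \<omega>')) \<partial>M \<partial>M) \<le> ennreal (\<epsilon> / 2)"
    by (rule W_oscillation[OF e2]) blast
  have "\<forall>\<^sub>F k in sequentially. (\<integral>\<^sup>+x. ennreal (L1_modulus k x) \<partial>m) < ennreal (\<epsilon> / 2)"
    by (rule order_tendstoD(2)[OF L1_modulus_tendsto]) (use assms in simp)
  then obtain k3 where k3: "\<And>k. k3 \<le> k \<Longrightarrow> (\<integral>\<^sup>+x. ennreal (L1_modulus k x) \<partial>m) < ennreal (\<epsilon> / 2)"
    unfolding eventually_sequentially by blast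
  define k where "k = max k1 (max k2 k3)"
  have k: "k1 \<le> k" "k2 \<le> k" "k3 \<le> k" by (auto simp: k_def)
  have "(\<integral>\<^sup>+\<omega>. min 1 (Z_residual k \<omega>) \<partial>N) \<le> (\<integral>\<^sup>+\<omega>. min 1 (oscillation k (Z \<omega>)) + (\<integral>\<^sup>+x. gap k \<omega> x \<partial>m) \<partial>N)"
    unfolding Z_residual_def by (intro nn_integral_mono min_add_le)
  also have "\<dots> = (\<integral>\<^sup>+\<omega>. min 1 (oscillation k (Z \<omega>)) \<partial>N) + (\<integral>\<^sup>+\<omega>. \<integral>\<^sup>+x. gap k \<omega> x \<partial>m \<partial>N)"
    by (intro nn_integral_add) measurable
  also have "\<dots> \<le> ennreal (\<epsilon> / 2) + ennreal (\<epsilon> / 2)"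
    using Z_oscillation[OF k2[OF k(2)]] e2 order_trans[OF gap_expectation less_imp_le[OF k3[OF k(3)]]]
    by (intro add_mono) auto
  also have "\<dots> = ennreal \<epsilon>"
    using assms by (simp flip: ennreal_plus)
  finally show ?thesis
    using that[of k] k1[OF k(1)] by blast
qed

section \<open>Convergence given the sample, and asymptotic measurability\<close>

text \<open>The residual agrees almost surely with its measurable version. Its capped integral is at
  most 1, so \<open>enn2real\<close> loses nothing.\<close>

lemma lipschitz_Z_residual:
  assumes h: "lipschitz_L m B K h" and K: "0 \<le> K" and B: "0 \<le> B"
  shows "\<bar>N.expectation (\<lambda>\<omega>. h (Z \<omega>)) - N.expectation (\<lambda>\<omega>. h (proj k (Z \<omega>)))\<bar>
      \<le> (K + 2 * B) * enn2real (\<integral>\<^sup>+\<omega>. min 1 (Z_residual k \<omega>) \<partial>N)"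
    and "integrable N (\<lambda>\<omega>. h (Z \<omega>))"
proof -
  show hZ: "integrable N (\<lambda>\<omega>. h (Z \<omega>))"
    using lipschitz_L_D(1)[OF h Z_in_L_space]
    by (intro N.integrable_const_bound[where B = B] continuous_Z_measurable lipschitz_L_continuous[OF h K] AE_I2) auto
  have pZ: "integrable N (\<lambda>\<omega>. h (proj k (Z \<omega>)))"
    by (rule lipschitz_W_integrable(2)[OF finite_knots _ lipschitz_proj[OF h K]]) (use K in \<open>simp add: mass_def\<close>)
  let ?d = "\<lambda>\<omega>. \<bar>h (Z \<omega>) - h (proj k (Z \<omega>))\<bar>"
  have "ennreal (N.expectation ?d) = (\<integral>\<^sup>+\<omega>. ennreal (?d \<omega>) \<partial>N)"
    using hZ pZ by (intro nn_integral_eq_integral[symmetric]) auto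
  also have "\<dots> \<le> (\<integral>\<^sup>+\<omega>. ennreal (K + 2 * B) * min 1 (Z_residual k \<omega>) \<partial>N)"
  proof (rule nn_integral_mono_AE)
    show "AE \<omega> in N. ennreal (?d \<omega>) \<le> ennreal (K + 2 * B) * min 1 (Z_residual k \<omega>)"
      using AE_Z_residual[of k] AE_Z_right_continuous AE_space
    proof eventually_elim
      case (elim \<omega>)
      then show ?case
        using lipschitz_residual[OF h K B Z_in_L_space, of \<omega> k] by simp
    qed
  qed
  also have "\<dots> = ennreal (K + 2 * B) * (\<integral>\<^sup>+\<omega>. min 1 (Z_residual k \<omega>) \<partial>N)"
    by (rule nn_integral_cmult) measurable
  finally have le: "ennreal (N.expectation ?d) \<le> ennreal (K + 2 * B) * (\<integral>\<^sup>+\<omega>. min 1 (Z_residual k \<omega>) \<partial>N)" .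
  have "(\<integral>\<^sup>+\<omega>. min 1 (Z_residual k \<omega>) \<partial>N) \<le> (\<integral>\<^sup>+\<omega>. 1 \<partial>N)"
    by (intro nn_integral_mono) simp
  then have fin: "(\<integral>\<^sup>+\<omega>. min 1 (Z_residual k \<omega>) \<partial>N) < \<infinity>"
    by (simp add: N.emeasure_space_1 le_less_trans)
  have "\<bar>N.expectation (\<lambda>\<omega>. h (Z \<omega>)) - N.expectation (\<lambda>\<omega>. h (proj k (Z \<omega>)))\<bar> \<le> N.expectation ?d"
    using hZ pZ integral_abs_bound[of N "\<lambda>\<omega>. h (Z \<omega>) - h (proj k (Z \<omega>))"] by simp
  also have "\<dots> \<le> enn2real (ennreal (K + 2 * B) * (\<integral>\<^sup>+\<omega>. min 1 (Z_residual k \<omega>) \<partial>N))"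
    using enn2real_mono[OF le] fin by (simp add: ennreal_mult_less_top)
  also have "\<dots> = (K + 2 * B) * enn2real (\<integral>\<^sup>+\<omega>. min 1 (Z_residual k \<omega>) \<partial>N)"
    using K B by (simp add: enn2real_mult del: ennreal_plus)
  finally show "\<bar>N.expectation (\<lambda>\<omega>. h (Z \<omega>)) - N.expectation (\<lambda>\<omega>. h (proj k (Z \<omega>)))\<bar>
      \<le> (K + 2 * B) * enn2real (\<integral>\<^sup>+\<omega>. min 1 (Z_residual k \<omega>) \<partial>N)" .
qed

lemma lipschitz_W_residual:
  assumes h: "lipschitz_L m B K h" and K: "0 \<le> K" and B: "0 \<le> B" and g: "good \<omega>" and \<omega>: "\<omega> \<in> space M"
  shows "ennreal \<bar>cond h n \<omega> - cond (\<lambda>z. h (proj k z)) n \<omega>\<bar>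
      \<le> ennreal (K + 2 * B) * (\<integral>\<^sup>+\<omega>'. min 1 (residual k (W n \<omega> \<omega>')) \<partial>M)"
proof -
  have hW: "integrable M (\<lambda>\<omega>'. h (W n \<omega> \<omega>'))"
    using lipschitz_L_D(1)[OF h W_in_L_space[OF g]]
    by (intro integrable_const_bound[where B = B] lipschitz_W_measurable[OF h K g] AE_I2) auto
  have pW: "integrable M (\<lambda>\<omega>'. h (proj k (W n \<omega> \<omega>')))"
    by (rule lipschitz_W_integrable(1)[OF finite_knots _ lipschitz_proj[OF h K]]) (use K in \<open>simp add: mass_def\<close>)
  let ?d = "\<lambda>\<omega>'. \<bar>h (W n \<omega> \<omega>') - h (proj k (W n \<omega> \<omega>'))\<bar>"
  have [measurable]: "(\<lambda>\<omega>'. residual k (W n \<omega> \<omega>')) \<in> borel_measurable M"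
    by (rule residual_W_measurable[where g = "\<lambda>_. \<omega>" and h = "\<lambda>\<omega>'. \<omega>'"]) (use \<omega> in simp_all)
  have "ennreal \<bar>cond h n \<omega> - cond (\<lambda>z. h (proj k z)) n \<omega>\<bar> \<le> ennreal (expectation ?d)"
    using hW pW integral_abs_bound[of M "\<lambda>\<omega>'. h (W n \<omega> \<omega>') - h (proj k (W n \<omega> \<omega>'))"]
    unfolding cond_def by (intro ennreal_leI) simp
  also have "\<dots> = (\<integral>\<^sup>+\<omega>'. ennreal (?d \<omega>') \<partial>M)"
    using hW pW by (intro nn_integral_eq_integral[symmetric]) auto
  also have "\<dots> \<le> (\<integral>\<^sup>+\<omega>'. ennreal (K + 2 * B) * min 1 (residual k (W n \<omega> \<omega>')) \<partial>M)"
    by (intro nn_integral_mono lipschitz_residual[OF h K B W_in_L_space[OF g] W_right_continuous])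
  also have "\<dots> = ennreal (K + 2 * B) * (\<integral>\<^sup>+\<omega>'. min 1 (residual k (W n \<omega> \<omega>')) \<partial>M)"
    by (rule nn_integral_cmult) measurable
  finally show ?thesis .
qed

end

context multiplier_main
begin

lemma BL1_lipschitz: "h \<in> BL1_L m \<Longrightarrow> lipschitz_L m 1 1 h"
  by (simp add: BL1_L_def lipschitz_L_def)

text \<open>For good samples every term of the supremum is at most the measurable
  \<open>S n \<omega>\<close>. Markov's inequality for \<open>S n\<close>, and a null set for the
  other samples, bound the outer probability.\<close>

lemma conditional_limit:
  "tendsto_zero_in_outer_probability M
    (\<lambda>n \<omega>. SUP h\<in>BL1_L m. \<bar>cond h n \<omega> - N.expectation (\<lambda>\<omega>'. h (Z \<omega>'))\<bar>)"
  unfolding tendsto_zero_in_outer_probability_def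
proof (intro allI impI, rule ennreal_tendsto_zeroI)
  fix \<eta> e :: real assume \<eta>: "0 < \<eta>" and e: "0 < e"
  \<comment> \<open>Seven shares: three from the residual of the process and three from that of the
    limit, as \<open>K + 2 * B = 3\<close>, and one from the finite-dimensional remainder.\<close>
  define \<epsilon> where "\<epsilon> = \<eta> * e / 7"
  have \<epsilon>: "0 < \<epsilon>" using \<eta> e by (simp add: \<epsilon>_def)
  obtain k where kW: "\<forall>\<^sub>F n in sequentially. (\<integral>\<^sup>+\<omega>. \<integral>\<^sup>+\<omega>'. min 1 (residual k (W n \<omega> \<omega>')) \<partial>M \<partial>M) \<le> ennreal \<epsilon>"
    and kZ: "(\<integral>\<^sup>+\<omega>. min 1 (Z_residual k \<omega>) \<partial>N) \<le> ennreal \<epsilon>"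
    by (rule residual_small[OF \<epsilon>])
  define z where "z = enn2real (\<integral>\<^sup>+\<omega>. min 1 (Z_residual k \<omega>) \<partial>N)"
  have z: "0 \<le> z" "z \<le> \<epsilon>"
    unfolding z_def using enn2real_mono[OF kZ] \<epsilon> by auto
  have m0: "0 \<le> 1 * (1 + mass k)"
    by (simp add: mass_def)
  obtain R where R: "\<And>n. integrable M (R n)" "\<forall>\<^sub>F n in sequentially. expectation (R n) \<le> \<epsilon>"
    "\<And>g n \<omega>. (\<And>y. \<bar>g y\<bar> \<le> 1) \<Longrightarrow> (\<And>y y'. \<bar>g y - g y'\<bar> \<le> (1 * (1 + mass k)) * (\<Sum>x\<in>knots k. \<bar>y x - y' x\<bar>)) \<Longrightarrow>
      \<bar>cond g n \<omega> - N.expectation (\<lambda>\<omega>. g (Z \<omega>))\<bar> \<le> R n \<omega>"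
    by (rule finite_dimensional_uniform[OF finite_knots m0 _ \<epsilon>, of 1 k]) auto
  have R0: "0 \<le> R n \<omega>" for n \<omega>
    using order_trans[OF abs_ge_zero R(3)[of "\<lambda>_. 0" n \<omega>]] m0 by (simp add: sum_nonneg)
  have [measurable]: "R n \<in> borel_measurable M" for n
    using R(1) by auto
  define S where "S n \<omega> = 3 * (\<integral>\<^sup>+\<omega>'. min 1 (residual k (W n \<omega> \<omega>')) \<partial>M) + ennreal (R n \<omega> + 3 * z)" for n \<omega>
  have [measurable]: "S n \<in> borel_measurable M" for n
    unfolding S_def by measurable
  let ?Y = "\<lambda>n \<omega>. SUP h\<in>BL1_L m. \<bar>cond h n \<omega> - N.expectation (\<lambda>\<omega>'. h (Z \<omega>'))\<bar>"
  have term_le: "ennreal \<bar>cond h n \<omega> - N.expectation (\<lambda>\<omega>'. h (Z \<omega>'))\<bar> \<le> S n \<omega>"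
    if "h \<in> BL1_L m" "good \<omega>" "\<omega> \<in> space M" for h n \<omega>
  proof -
    note h = BL1_lipschitz[OF that(1)]
    let ?g = "\<lambda>z. h (proj k z)"
    have "\<bar>cond ?g n \<omega> - N.expectation (\<lambda>\<omega>'. ?g (Z \<omega>'))\<bar> \<le> R n \<omega>"
      by (rule R(3)) (use lipschitz_proj[OF h] in auto)
    moreover have "\<bar>N.expectation (\<lambda>\<omega>. h (Z \<omega>)) - N.expectation (\<lambda>\<omega>. ?g (Z \<omega>))\<bar> \<le> 3 * z"
      using lipschitz_Z_residual(1)[OF h, of k] by (simp add: z_def)
    ultimately have "\<bar>cond h n \<omega> - N.expectation (\<lambda>\<omega>'. h (Z \<omega>'))\<bar> \<le> \<bar>cond h n \<omega> - cond ?g n \<omega>\<bar> + (R n \<omega> + 3 * z)"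
      by linarith
    then have "ennreal \<bar>cond h n \<omega> - N.expectation (\<lambda>\<omega>'. h (Z \<omega>'))\<bar>
        \<le> ennreal (\<bar>cond h n \<omega> - cond ?g n \<omega>\<bar> + (R n \<omega> + 3 * z))"
      by (rule ennreal_leI)
    also have "\<dots> = ennreal \<bar>cond h n \<omega> - cond ?g n \<omega>\<bar> + ennreal (R n \<omega> + 3 * z)"
      using R0[of n \<omega>] z(1) by (intro ennreal_plus) auto
    also have "\<dots> \<le> S n \<omega>"
      unfolding S_def using lipschitz_W_residual[OF h _ _ that(2,3), of n k] by (intro add_right_mono) simp
    finally show ?thesis .
  qed
  have zero: "(\<lambda>_. 0) \<in> BL1_L m"
    by (simp add: BL1_L_def L_dist_nonneg)
  have Y_le: "ennreal \<bar>?Y n \<omega>\<bar> \<le> S n \<omega>" if "good \<omega>" "\<omega> \<in> space M" for n \<omega>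
  proof (cases "S n \<omega>")
    case (real s)
    have le: "\<bar>cond h n \<omega> - N.expectation (\<lambda>\<omega>'. h (Z \<omega>'))\<bar> \<le> s" if "h \<in> BL1_L m" for h
      using term_le[OF that \<open>good \<omega>\<close> \<open>\<omega> \<in> space M\<close>, of n] real by simp
    have "?Y n \<omega> \<le> s"
      using zero le by (intro cSUP_least) auto
    moreover have "0 \<le> ?Y n \<omega>"
      by (rule order_trans[OF abs_ge_zero cSUP_upper[OF zero]]) (use le in \<open>auto intro!: bdd_aboveI2\<close>)
    ultimately show ?thesis
      unfolding real(2) by (intro ennreal_leI) linarith
  qed simp
  obtain N0 where N0: "{\<omega>\<in>space M. \<not> good \<omega>} \<subseteq> N0" "N0 \<in> null_sets M"
    using AE_good by (auto simp: eventually_ae_filter)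
  show "\<forall>\<^sub>F n in sequentially. outer_measure_of M {\<omega>\<in>space M. \<eta> < \<bar>?Y n \<omega>\<bar>} \<le> ennreal e"
    using kW R(2)
  proof eventually_elim
    case (elim n)
    let ?A = "{\<omega>\<in>space M. 1 \<le> ennreal (1 / \<eta>) * S n \<omega>}"
    have "{\<omega>\<in>space M. \<eta> < \<bar>?Y n \<omega>\<bar>} \<subseteq> ?A \<union> N0"
    proof
      fix \<omega> assume \<omega>: "\<omega> \<in> {\<omega>\<in>space M. \<eta> < \<bar>?Y n \<omega>\<bar>}"
      show "\<omega> \<in> ?A \<union> N0"
      proof (cases "good \<omega>")
        case True
        have "1 = ennreal (1 / \<eta>) * ennreal \<eta>"
          using \<eta> by (simp flip: ennreal_mult)
        also have "ennreal \<eta> \<le> ennreal \<bar>?Y n \<omega>\<bar>"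
          using \<omega> by (intro ennreal_leI) simp
        also have "\<dots> \<le> S n \<omega>"
          using Y_le[OF True] \<omega> by simp
        finally show ?thesis
          using \<omega> by (simp add: mult_left_mono)
      next
        case False
        then show ?thesis using \<omega> N0 by blast
      qed
    qed
    then have "outer_measure_of M {\<omega>\<in>space M. \<eta> < \<bar>?Y n \<omega>\<bar>} \<le> outer_measure_of M (?A \<union> N0)"
      by (rule outer_measure_of_mono)
    also have "\<dots> = emeasure M (?A \<union> N0)"
      using N0 by (intro outer_measure_of_eq) auto
    also have "\<dots> = emeasure M ?A"
      using N0 by (intro emeasure_Un_null_set) auto
    also have "\<dots> \<le> ennreal (1 / \<eta>) * (\<integral>\<^sup>+\<omega>. S n \<omega> * indicator (space M) \<omega> \<partial>M)"
      by (intro nn_integral_Markov_inequality) auto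
    also have "(\<integral>\<^sup>+\<omega>. S n \<omega> * indicator (space M) \<omega> \<partial>M) = (\<integral>\<^sup>+\<omega>. S n \<omega> \<partial>M)"
      by (intro nn_integral_cong) simp
    also have "\<dots> = 3 * (\<integral>\<^sup>+\<omega>. \<integral>\<^sup>+\<omega>'. min 1 (residual k (W n \<omega> \<omega>')) \<partial>M \<partial>M) + (\<integral>\<^sup>+\<omega>. ennreal (R n \<omega> + 3 * z) \<partial>M)"
      unfolding S_def by (subst nn_integral_add) (measurable, simp add: nn_integral_cmult)
    also have "(\<integral>\<^sup>+\<omega>. ennreal (R n \<omega> + 3 * z) \<partial>M) = ennreal (expectation (R n) + 3 * z)"
      using R(1)[of n] R0[of n] z by (subst nn_integral_eq_integral) (auto simp: prob_space)
    also have "ennreal (1 / \<eta>) * (3 * (\<integral>\<^sup>+\<omega>. \<integral>\<^sup>+\<omega>'. min 1 (residual k (W n \<omega> \<omega>')) \<partial>M \<partial>M) + ennreal (expectation (R n) + 3 * z))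
        \<le> ennreal (1 / \<eta>) * (3 * ennreal \<epsilon> + ennreal (4 * \<epsilon>))"
      using elim z by (intro mult_left_mono add_mono ennreal_leI) auto
    also have "3 * ennreal \<epsilon> = ennreal (3 * \<epsilon>)"
      using \<epsilon> by (simp add: ennreal_mult)
    also have "ennreal (1 / \<eta>) * (ennreal (3 * \<epsilon>) + ennreal (4 * \<epsilon>)) = ennreal (1 / \<eta> * (3 * \<epsilon> + 4 * \<epsilon>))"
      using \<epsilon> \<eta> by (simp only: ennreal_plus[symmetric] ennreal_mult[symmetric] mult_nonneg_nonneg divide_nonneg_nonneg
          less_imp_le zero_le_numeral zero_le_one add_nonneg_nonneg)
    also have "1 / \<eta> * (3 * \<epsilon> + 4 * \<epsilon>) = e"
      using \<eta> by (simp add: \<epsilon>_def)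
    finally show ?case .
  qed
qed

section \<open>From two sample points to the diagonal\<close>

text \<open>Independence makes the joint law of the two sequences a product, and Fubini on the
  sequence spaces splits the sample point in two.\<close>

lemma nn_integral_diagonal:
  assumes [measurable]: "G \<in> borel_measurable ((\<Pi>\<^sub>M i\<in>UNIV. borel) \<Otimes>\<^sub>M (\<Pi>\<^sub>M i\<in>UNIV. borel))"
  shows "(\<integral>\<^sup>+\<omega>. G (\<lambda>i. X i \<omega>, \<lambda>i. \<xi> i \<omega>) \<partial>M) = (\<integral>\<^sup>+\<omega>. \<integral>\<^sup>+\<omega>'. G (\<lambda>i. X i \<omega>, \<lambda>i. \<xi> i \<omega>') \<partial>M \<partial>M)"
proof -
  let ?S = "\<Pi>\<^sub>M i\<in>(UNIV :: nat set). (borel :: real measure)"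
  let ?X = "\<lambda>\<omega> i. X i \<omega>" and ?\<xi> = "\<lambda>\<omega> i. \<xi> i \<omega>"
  have rv [measurable]: "?X \<in> measurable M ?S" "?\<xi> \<in> measurable M ?S"
    and eq: "distr M ?S ?X \<Otimes>\<^sub>M distr M ?S ?\<xi> = distr M (?S \<Otimes>\<^sub>M ?S) (\<lambda>\<omega>. (?X \<omega>, ?\<xi> \<omega>))"
    using X_xi_indep unfolding indep_var_distribution_eq by auto
  interpret PX: prob_space "distr M ?S ?X" by (rule prob_space_distr[OF rv(1)])
  interpret P\<xi>: prob_space "distr M ?S ?\<xi>" by (rule prob_space_distr[OF rv(2)])
  have "(\<integral>\<^sup>+\<omega>. G (?X \<omega>, ?\<xi> \<omega>) \<partial>M) = (\<integral>\<^sup>+p. G p \<partial>distr M (?S \<Otimes>\<^sub>M ?S) (\<lambda>\<omega>. (?X \<omega>, ?\<xi> \<omega>)))"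
    by (subst nn_integral_distr) auto
  also have "\<dots> = (\<integral>\<^sup>+x. \<integral>\<^sup>+c. G (x, c) \<partial>distr M ?S ?\<xi> \<partial>distr M ?S ?X)"
    unfolding eq[symmetric] by (subst P\<xi>.nn_integral_fst) (auto cong: measurable_cong_sets)
  also have "\<dots> = (\<integral>\<^sup>+x. \<integral>\<^sup>+\<omega>'. G (x, ?\<xi> \<omega>') \<partial>M \<partial>distr M ?S ?X)"
    by (intro nn_integral_cong nn_integral_distr) (auto simp: space_PiM)
  also have "\<dots> = (\<integral>\<^sup>+\<omega>. \<integral>\<^sup>+\<omega>'. G (?X \<omega>, ?\<xi> \<omega>') \<partial>M \<partial>M)"
    by (subst nn_integral_distr) measurable
  finally show ?thesis .
qed

text \<open>The process as a function of a pair of sequences, the form to which independence of the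
  two sequences applies.\<close>

definition sample_process :: "nat \<Rightarrow> (nat \<Rightarrow> real) \<times> (nat \<Rightarrow> real) \<Rightarrow> real \<Rightarrow> real" where
  "sample_process n p = multiplier_process F (fst p) (snd p) n"

lemma sample_process_W: "sample_process n (\<lambda>i. X i \<omega>, \<lambda>i. \<xi> i \<omega>') = W n \<omega> \<omega>'"
  by (simp add: sample_process_def W_def)

lemma sample_process_measurable [measurable]:
  assumes [measurable]: "f \<in> borel_measurable Q" "g \<in> measurable Q ((\<Pi>\<^sub>M i\<in>UNIV. borel) \<Otimes>\<^sub>M (\<Pi>\<^sub>M i\<in>UNIV. borel))"
  shows "(\<lambda>q. sample_process n (g q) (f q)) \<in> borel_measurable Q"
proof -
  have 1: "(\<lambda>q. fst (g q)) \<in> measurable Q (\<Pi>\<^sub>M i\<in>UNIV. borel)" and 2: "(\<lambda>q. snd (g q)) \<in> measurable Q (\<Pi>\<^sub>M i\<in>UNIV. borel)"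
    by (rule measurable_compose[OF assms(2)], simp)+
  have [measurable]: "(\<lambda>q. fst (g q) i) \<in> borel_measurable Q" "(\<lambda>q. snd (g q) i) \<in> borel_measurable Q" for i
    using measurable_compose[OF 1 measurable_component_singleton[of i UNIV]]
      measurable_compose[OF 2 measurable_component_singleton[of i UNIV]] by simp_all
  have "sample_process n (g q) (f q) = (1 / sqrt (real n)) * (\<Sum>i<n. snd (g q) i * ((if fst (g q) i \<le> f q then 1 else 0) - F (f q)))" for q
    unfolding sample_process_def multiplier_process_def by (auto intro!: sum.cong)
  then show ?thesis
    by simp
qed

lemma residual_sample_process_measurable [measurable]:
  "(\<lambda>p. residual k (sample_process n p)) \<in> borel_measurable ((\<Pi>\<^sub>M i\<in>UNIV. borel) \<Otimes>\<^sub>M (\<Pi>\<^sub>M i\<in>UNIV. borel))"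
proof -
  have [measurable]: "(\<lambda>x. knot k (cell k x)) \<in> borel_measurable borel"
    by (rule measurable_compose[OF cell_measurable]) simp
  have [measurable]: "(\<lambda>p. oscillation k (sample_process n p)) \<in> borel_measurable ((\<Pi>\<^sub>M i\<in>UNIV. borel) \<Otimes>\<^sub>M (\<Pi>\<^sub>M i\<in>UNIV. borel))"
    unfolding oscillation_def proj_def by (intro borel_measurable_SUP countable_rat) measurable
  show ?thesis
    unfolding residual_def proj_def by measurable
qed

lemma diagonal_residual:
  "(\<integral>\<^sup>+\<omega>. min 1 (residual k (W n \<omega> \<omega>)) \<partial>M) = (\<integral>\<^sup>+\<omega>. \<integral>\<^sup>+\<omega>'. min 1 (residual k (W n \<omega> \<omega>')) \<partial>M \<partial>M)"
  using nn_integral_diagonal[of "\<lambda>p. min 1 (residual k (sample_process n p))"] by (simp add: sample_process_W)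

lemma diagonal_lipschitz:
  assumes "finite T" "0 \<le> K" "\<And>y y'. \<bar>g y - g y'\<bar> \<le> K * (\<Sum>x\<in>T. \<bar>y x - y' x\<bar>)"
  shows "(\<integral>\<^sup>+\<omega>. ennreal (g (W n \<omega> \<omega>)) \<partial>M) = (\<integral>\<^sup>+\<omega>. \<integral>\<^sup>+\<omega>'. ennreal (g (W n \<omega> \<omega>')) \<partial>M \<partial>M)"
proof -
  have [measurable]: "(\<lambda>p. g (sample_process n p)) \<in> borel_measurable ((\<Pi>\<^sub>M i\<in>UNIV. borel) \<Otimes>\<^sub>M (\<Pi>\<^sub>M i\<in>UNIV. borel))"
    by (rule lipschitz_borel_measurable[OF assms]) measurable
  show ?thesis
    using nn_integral_diagonal[of "\<lambda>p. ennreal (g (sample_process n p))"] by (simp add: sample_process_W)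
qed

lemma lip_majorant_tendsto:
  assumes "\<And>z. z \<in> L_space m \<Longrightarrow> \<bar>h z\<bar> \<le> B" "continuous_map (L_topology m) euclideanreal h" "z \<in> L_space m"
  shows "(\<lambda>j. - lip_minorant m (real j) (\<lambda>w. - h w) z) \<longlonglongrightarrow> h z"
proof -
  have "continuous_map (L_topology m) euclideanreal (\<lambda>w. - h w)"
    using assms(2) by (rule continuous_map_minus)
  then have "(\<lambda>j. lip_minorant m (real j) (\<lambda>w. - h w) z) \<longlonglongrightarrow> - h z"
    using assms by (intro lip_minorant_tendsto[where B = B]) auto
  then show ?thesis
    using tendsto_minus[of _ "- h z"] by simp
qed

text \<open>A continuous \<open>h\<close> is enclosed between \<open>lo j\<close> and
  \<open>hi j\<close>. Their gap \<open>\<Delta> j\<close> is Lipschitz, so its mean under the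
  process is nearly that under the limit, which is small by dominated convergence. The envelopes are
  evaluated at the projection to make them measurable.\<close>

lemma diagonal_asymptotically_measurable: "asymptotically_measurable m M (\<lambda>n \<omega>. W n \<omega> \<omega>)"
  unfolding asymptotically_measurable_def
proof (intro ballI LIMSEQ_I)
  fix h and e :: real assume h: "h \<in> Cb_L m" and e: "0 < e"
  let ?D = "\<lambda>n. outer_expectation M (\<lambda>\<omega>. h (W n \<omega> \<omega>)) - inner_expectation M (\<lambda>\<omega>. h (W n \<omega> \<omega>))"
  have cont: "continuous_map (L_topology m) euclideanreal h" and h0: "\<And>z. z \<notin> L_space m \<Longrightarrow> h z = 0"
    and "bounded (h ` L_space m)"
    using h by (auto simp: Cb_L_def)
  then obtain B where "\<forall>y\<in>h ` L_space m. norm y \<le> B"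
    unfolding bounded_iff by blast
  then have B: "\<And>z. z \<in> L_space m \<Longrightarrow> \<bar>h z\<bar> \<le> B"
    by auto
  have B0: "0 \<le> B"
    using B[OF L_space_zero] by linarith
  \<comment> \<open>The extension by 0 lets the bound hold also for samples whose process is outside
    the space.\<close>
  have Bh: "\<bar>h z\<bar> \<le> B" for z
    using B[of z] h0[of z] B0 by (cases "z \<in> L_space m") auto
  define lo hi where "lo j = lip_minorant m (real j) h" and "hi j z = - lip_minorant m (real j) (\<lambda>w. - h w) z" for j :: nat and z
  have lo: "lipschitz_L m B (real j) (lo j)" for j
    unfolding lo_def by (rule lipschitz_lip_minorant[OF B]) auto
  have hi: "lipschitz_L m B (real j) (hi j)" for j
    using lipschitz_lip_minorant[of m "\<lambda>w. - h w" B "real j"] B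
    unfolding hi_def lipschitz_L_def by (auto simp: abs_minus_commute)
  have lo_le: "lo j z \<le> h z" and hi_ge: "h z \<le> hi j z" if "z \<in> L_space m" for j z
  proof -
    show "lo j z \<le> h z"
      unfolding lo_def by (rule lip_minorant_le[OF B _ that]) auto
    have "lip_minorant m (real j) (\<lambda>w. - h w) z \<le> - h z"
      by (rule lip_minorant_le[OF _ _ that, of "\<lambda>w. - h w" B]) (use B in auto)
    then show "h z \<le> hi j z"
      unfolding hi_def by simp
  qed
  define \<Delta> where "\<Delta> j z = hi j z - lo j z" for j z
  have \<Delta>: "lipschitz_L m (2 * B) (2 * real j) (\<Delta> j)" for j
    unfolding lipschitz_L_def
  proof (intro conjI ballI)
    fix z assume "z \<in> L_space m"
    then show "\<bar>\<Delta> j z\<bar> \<le> 2 * B"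
      using lipschitz_L_D(1)[OF lo, of z j] lipschitz_L_D(1)[OF hi, of z j] unfolding \<Delta>_def by simp
  next
    fix z w assume "z \<in> L_space m" "w \<in> L_space m"
    then show "\<bar>\<Delta> j z - \<Delta> j w\<bar> \<le> 2 * real j * L_dist m z w"
      using lipschitz_L_D(2)[OF lo, of z w j] lipschitz_L_D(2)[OF hi, of z w j] unfolding \<Delta>_def by linarith
  qed
  have \<Delta>0: "0 \<le> \<Delta> j z" if "z \<in> L_space m" for j z
    using lo_le[OF that, of j] hi_ge[OF that, of j] by (simp add: \<Delta>_def)
  have "(\<lambda>j. N.expectation (\<lambda>\<omega>. \<Delta> j (Z \<omega>))) \<longlonglongrightarrow> N.expectation (\<lambda>_. 0)"
  proof (rule integral_dominated_convergence)
    show "(\<lambda>\<omega>. \<Delta> j (Z \<omega>)) \<in> borel_measurable N" for j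
      by (intro continuous_Z_measurable lipschitz_L_continuous[OF \<Delta>]) simp
    show "AE \<omega> in N. (\<lambda>j. \<Delta> j (Z \<omega>)) \<longlonglongrightarrow> 0"
    proof (rule AE_I2)
      fix \<omega> assume "\<omega> \<in> space N"
      note z = Z_in_L_space[OF this]
      show "(\<lambda>j. \<Delta> j (Z \<omega>)) \<longlonglongrightarrow> 0"
        using tendsto_diff[OF lip_majorant_tendsto[OF B cont z] lip_minorant_tendsto[OF B cont z]]
        by (simp add: \<Delta>_def hi_def lo_def)
    qed
    show "AE \<omega> in N. norm (\<Delta> j (Z \<omega>)) \<le> 2 * B" for j
      using lipschitz_L_D(1)[OF \<Delta> Z_in_L_space] by (intro AE_I2) simp
  qed auto
  then have "\<forall>\<^sub>F j in sequentially. N.expectation (\<lambda>\<omega>. \<Delta> j (Z \<omega>)) < e / 4"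
    using e by (intro order_tendstoD(2)) auto
  then obtain j where j: "N.expectation (\<lambda>\<omega>. \<Delta> j (Z \<omega>)) < e / 4"
    unfolding eventually_sequentially by blast
  \<comment> \<open>The residual constant of \<open>\<Delta> j\<close>, with Lipschitz constant
    \<open>2 * j\<close> and bound \<open>2 * B\<close>; it is at least that of \<open>lo j\<close>
    and \<open>hi j\<close>.\<close>
  define c where "c = 2 * real j + 2 * (2 * B)"
  have c: "0 \<le> c" using B0 by (simp add: c_def)
  \<comment> \<open>Apart from \<open>e / 4\<close> for the gap under the limit, the error is
    \<open>(3 * c + 1) * \<epsilon>\<close>: \<open>c\<close> for the residual of the limit, 1 for
    the finite-dimensional remainder and \<open>2 * c\<close> for the two envelopes.\<close>
  define \<epsilon> where "\<epsilon> = e / (4 * (3 * c + 1))"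
  have \<epsilon>: "0 < \<epsilon>" using e c by (simp add: \<epsilon>_def)
  have \<epsilon>e: "(3 * c + 1) * \<epsilon> = e / 4"
  proof -
    have "d * (e / (4 * d)) = e / 4" if "d \<noteq> 0" for d
      using that by simp
    from this[of "3 * c + 1"] show ?thesis
      using c by (simp add: \<epsilon>_def)
  qed
  obtain k where kW: "\<forall>\<^sub>F n in sequentially. (\<integral>\<^sup>+\<omega>. \<integral>\<^sup>+\<omega>'. min 1 (residual k (W n \<omega> \<omega>')) \<partial>M \<partial>M) \<le> ennreal \<epsilon>"
    and kZ: "(\<integral>\<^sup>+\<omega>. min 1 (Z_residual k \<omega>) \<partial>N) \<le> ennreal \<epsilon>"
    by (rule residual_small[OF \<epsilon>])
  define g where "g z = \<Delta> j (proj k z)" for z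
  define K where "K = 2 * real j * (1 + mass k)"
  have K: "0 \<le> K" by (simp add: K_def mass_def)
  have gB: "\<bar>g y\<bar> \<le> 2 * B" and gL: "\<bar>g y - g y'\<bar> \<le> K * (\<Sum>a\<in>knots k. \<bar>y a - y' a\<bar>)" for y y'
    unfolding g_def K_def using lipschitz_proj[OF \<Delta>, of j k] by auto
  have g0: "0 \<le> g y" for y
    unfolding g_def by (rule \<Delta>0[OF proj_in_L_space])
  obtain R where R: "\<And>n. integrable M (R n)" "\<forall>\<^sub>F n in sequentially. expectation (R n) \<le> \<epsilon>"
    "\<And>g n \<omega>. (\<And>y. \<bar>g y\<bar> \<le> 2 * B) \<Longrightarrow> (\<And>y y'. \<bar>g y - g y'\<bar> \<le> K * (\<Sum>x\<in>knots k. \<bar>y x - y' x\<bar>)) \<Longrightarrow>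
      \<bar>cond g n \<omega> - N.expectation (\<lambda>\<omega>. g (Z \<omega>))\<bar> \<le> R n \<omega>"
    using B0 by (rule_tac finite_dimensional_uniform[OF finite_knots K _ \<epsilon>, of "2 * B" k]) auto
  have gR: "\<bar>cond g n \<omega> - N.expectation (\<lambda>\<omega>. g (Z \<omega>))\<bar> \<le> R n \<omega>" for n \<omega>
    by (rule R(3)[OF gB gL])
  have gZ: "N.expectation (\<lambda>\<omega>. g (Z \<omega>)) \<le> e / 4 + c * \<epsilon>"
  proof -
    have "enn2real (\<integral>\<^sup>+\<omega>. min 1 (Z_residual k \<omega>) \<partial>N) \<le> \<epsilon>"
      using enn2real_mono[OF kZ] \<epsilon> by simp
    then have "c * enn2real (\<integral>\<^sup>+\<omega>. min 1 (Z_residual k \<omega>) \<partial>N) \<le> c * \<epsilon>"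
      using c by (intro mult_left_mono)
    moreover have "\<bar>N.expectation (\<lambda>\<omega>. \<Delta> j (Z \<omega>)) - N.expectation (\<lambda>\<omega>. g (Z \<omega>))\<bar>
        \<le> c * enn2real (\<integral>\<^sup>+\<omega>. min 1 (Z_residual k \<omega>) \<partial>N)"
      unfolding g_def c_def by (rule lipschitz_Z_residual(1)[OF \<Delta>]) (use B0 in auto)
    ultimately show ?thesis using j by linarith
  qed
  obtain N0 where N0: "{\<omega>\<in>space M. \<not> good \<omega>} \<subseteq> N0" "N0 \<in> null_sets M"
    using AE_good by (auto simp: eventually_ae_filter)
  have N0m [measurable]: "N0 \<in> sets M" and N0p: "prob N0 = 0"
    using N0(2) by (auto simp: measure_eq_0_null_sets)
  have "\<forall>\<^sub>F n in sequentially. norm (?D n - 0) < e"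
    using kW R(2)
  proof eventually_elim
    case (elim n)
    define r where "r \<omega> = enn2real (min 1 (residual k (W n \<omega> \<omega>)))" for \<omega>
    have r_eq: "ennreal (r \<omega>) = min 1 (residual k (W n \<omega> \<omega>))" for \<omega>
      unfolding r_def by (rule ennreal_enn2real) (simp add: min_less_iff_disj)
    have r01: "0 \<le> r \<omega>" "r \<omega> \<le> 1" for \<omega>
      using r_eq[of \<omega>] enn2real_mono[of "min 1 (residual k (W n \<omega> \<omega>))" 1] by (auto simp: r_def)
    have [measurable]: "r \<in> borel_measurable M"
      unfolding r_def by measurable
    have ri: "integrable M r"
      using r01 by (intro integrable_const_bound[where B = 1]) auto
    have Er: "expectation r \<le> \<epsilon>"
    proof -
      have "ennreal (expectation r) = (\<integral>\<^sup>+\<omega>. ennreal (r \<omega>) \<partial>M)"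
        using ri r01 by (intro nn_integral_eq_integral[symmetric]) auto
      also have "\<dots> \<le> ennreal \<epsilon>"
        unfolding r_eq diagonal_residual by (rule elim(1))
      finally show ?thesis
        using \<epsilon> by (simp add: ennreal_le_iff)
    qed
    have pi: "integrable M (\<lambda>\<omega>. f (proj k (W n \<omega> \<omega>)))" if f: "lipschitz_L m B (real j) f" for f
    proof -
      have "(\<lambda>\<omega>. f (proj k (W n \<omega> \<omega>))) \<in> borel_measurable M"
        by (rule lipschitz_borel_measurable[OF finite_knots _ lipschitz_proj(2)[OF f]]) (simp add: mass_def, simp, measurable)
      then show ?thesis
        using lipschitz_proj(1)[OF f] by (intro integrable_const_bound[where B = B]) auto
    qed
    have close: "\<bar>f (W n \<omega> \<omega>) - f (proj k (W n \<omega> \<omega>))\<bar> \<le> c * r \<omega>"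
      if f: "lipschitz_L m B (real j) f" and "good \<omega>" for f \<omega>
    proof -
      have "ennreal \<bar>f (W n \<omega> \<omega>) - f (proj k (W n \<omega> \<omega>))\<bar> \<le> ennreal (real j + 2 * B) * min 1 (residual k (W n \<omega> \<omega>))"
        by (rule lipschitz_residual[OF f _ B0 W_in_L_space[OF \<open>good \<omega>\<close>] W_right_continuous]) simp
      also have "\<dots> = ennreal ((real j + 2 * B) * r \<omega>)"
        using B0 r01[of \<omega>] by (simp add: r_eq[symmetric] ennreal_mult del: ennreal_plus)
      finally have "\<bar>f (W n \<omega> \<omega>) - f (proj k (W n \<omega> \<omega>))\<bar> \<le> (real j + 2 * B) * r \<omega>"
        using B0 r01[of \<omega>] by (subst (asm) ennreal_le_iff) auto
      also have "\<dots> \<le> c * r \<omega>"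
        unfolding c_def using B0 r01[of \<omega>] by (intro mult_right_mono) auto
      finally show ?thesis .
    qed
    \<comment> \<open>On the null set the last summand matters: \<open>hi j\<close> at the
      projection is at least \<open>- B\<close>, so adding \<open>2 * B\<close> puts it above every
      value of \<open>h\<close>.\<close>
    define U where "U \<omega> = hi j (proj k (W n \<omega> \<omega>)) + c * r \<omega> + 2 * B * indicator N0 \<omega>" for \<omega>
    define L where "L \<omega> = lo j (proj k (W n \<omega> \<omega>)) - c * r \<omega> - 2 * B * indicator N0 \<omega>" for \<omega>
    have N0i: "integrable M (indicat_real N0)"
      by (rule integrable_const_bound[where B = 1]) auto
    have Ui: "integrable M U" and Li: "integrable M L"
      unfolding U_def L_def using pi[OF hi] pi[OF lo] ri N0i by auto
    have hU: "h (W n \<omega> \<omega>) \<le> U \<omega>" and hL: "L \<omega> \<le> h (W n \<omega> \<omega>)" if \<omega>: "\<omega> \<in> space M" for \<omega>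
    proof -
      note p = lipschitz_L_D(1)[OF hi proj_in_L_space[of k "W n \<omega> \<omega>"], of j]
        lipschitz_L_D(1)[OF lo proj_in_L_space[of k "W n \<omega> \<omega>"], of j]
      have cr: "0 \<le> c * r \<omega>" using c r01[of \<omega>] by simp
      have "h (W n \<omega> \<omega>) \<le> U \<omega> \<and> L \<omega> \<le> h (W n \<omega> \<omega>)"
      proof (cases "\<omega> \<in> N0")
        case True
        then show ?thesis
          using p cr Bh[of "W n \<omega> \<omega>"] unfolding U_def L_def by (simp add: abs_le_iff)
      next
        case False
        then have gd: "good \<omega>" using \<omega> N0(1) by blast
        show ?thesis
          using False close[OF hi gd] close[OF lo gd] lo_le[OF W_in_L_space[OF gd], of j n \<omega>] hi_ge[OF W_in_L_space[OF gd], of n \<omega> j]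
          unfolding U_def L_def by (simp add: abs_le_iff)
      qed
      then show "h (W n \<omega> \<omega>) \<le> U \<omega>" "L \<omega> \<le> h (W n \<omega> \<omega>)" by auto
    qed
    note D = outer_minus_inner_expectation[OF Bh Ui hU Li hL]
    have gi: "integrable M (\<lambda>\<omega>. g (W n \<omega> \<omega>))"
      unfolding g_def \<Delta>_def using pi[OF hi] pi[OF lo] by auto
    have "expectation U - expectation L = expectation (\<lambda>\<omega>. g (W n \<omega> \<omega>)) + 2 * c * expectation r"
      unfolding U_def L_def g_def \<Delta>_def using pi[OF hi] pi[OF lo] ri N0i N0p by simp
    also have "expectation (\<lambda>\<omega>. g (W n \<omega> \<omega>)) \<le> N.expectation (\<lambda>\<omega>. g (Z \<omega>)) + \<epsilon>"
    proof -
      have EZ: "0 \<le> N.expectation (\<lambda>\<omega>. g (Z \<omega>))"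
        using g0 by (intro Bochner_Integration.integral_nonneg)
      have R0: "0 \<le> R n \<omega>" for \<omega>
        using order_trans[OF abs_ge_zero gR] .
      have "ennreal (expectation (\<lambda>\<omega>. g (W n \<omega> \<omega>))) = (\<integral>\<^sup>+\<omega>. ennreal (g (W n \<omega> \<omega>)) \<partial>M)"
        using gi g0 by (intro nn_integral_eq_integral[symmetric]) auto
      also have "\<dots> = (\<integral>\<^sup>+\<omega>. \<integral>\<^sup>+\<omega>'. ennreal (g (W n \<omega> \<omega>')) \<partial>M \<partial>M)"
        by (rule diagonal_lipschitz[OF finite_knots K gL])
      also have "\<dots> = (\<integral>\<^sup>+\<omega>. ennreal (cond g n \<omega>) \<partial>M)"
        unfolding cond_def using g0 lipschitz_W_integrable(1)[OF finite_knots K gB gL]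
        by (intro nn_integral_cong nn_integral_eq_integral) auto
      also have "\<dots> \<le> (\<integral>\<^sup>+\<omega>. ennreal (N.expectation (\<lambda>\<omega>. g (Z \<omega>)) + R n \<omega>) \<partial>M)"
      proof (intro nn_integral_mono ennreal_leI)
        fix \<omega>
        show "cond g n \<omega> \<le> N.expectation (\<lambda>\<omega>. g (Z \<omega>)) + R n \<omega>"
          using gR[of n \<omega>] by linarith
      qed
      also have "\<dots> = ennreal (N.expectation (\<lambda>\<omega>. g (Z \<omega>)) + expectation (R n))"
        using R(1)[of n] R0 EZ by (subst nn_integral_eq_integral) (auto simp: prob_space)
      finally have "ennreal (expectation (\<lambda>\<omega>. g (W n \<omega> \<omega>))) \<le> ennreal (N.expectation (\<lambda>\<omega>. g (Z \<omega>)) + expectation (R n))" .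
      moreover have "0 \<le> expectation (R n)"
        using R0 by (intro Bochner_Integration.integral_nonneg)
      ultimately show ?thesis
        using EZ elim(2) by (subst (asm) ennreal_le_iff) auto
    qed
    also have "2 * c * expectation r \<le> 2 * c * \<epsilon>"
      using Er c by (intro mult_left_mono) auto
    finally have "expectation U - expectation L \<le> e / 4 + (3 * c + 1) * \<epsilon>"
      using gZ by (simp add: algebra_simps)
    then show ?case
      using D \<epsilon>e e by simp
  qed
  then show "\<exists>n0. \<forall>n\<ge>n0. norm (?D n - 0) < e"
    unfolding eventually_sequentially .
qed

end

theorem lemma6p1:
  fixes \<mu> :: "real set \<Rightarrow> ereal"
    and D :: "real measure"
    and F :: "real \<Rightarrow> real"
    and M :: "'a measure"
    and X \<xi> :: "nat \<Rightarrow> 'a \<Rightarrow> real"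
    and N :: "'b measure"
    and Z :: "'b \<Rightarrow> real \<Rightarrow> real"
  assumes "signed_borel_measure \<mu>"
    and "sigma_finite_measure (total_variation \<mu>)"
    and "real_distribution D"
    and "F = cdf D"
    and "(\<integral>\<^sup>+x. ennreal (sqrt (F x * (1 - F x))) \<partial>total_variation \<mu>) < \<infinity>"
    and "prob_space M"
    and "prob_space.indep_vars M (\<lambda>_. borel) X UNIV"
    and "\<And>i. distr M borel (X i) = D"
    and "prob_space.indep_vars M (\<lambda>_. borel) \<xi> UNIV"
    and "\<And>i j. distr M borel (\<xi> i) = distr M borel (\<xi> j)"
    and "\<And>i. integrable M (\<xi> i)"
    and "\<And>i. prob_space.expectation M (\<xi> i) = 0"
    and "\<And>i. integrable M (\<lambda>\<omega>. (\<xi> i \<omega>)\<^sup>2)"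
    and "\<And>i. prob_space.variance M (\<xi> i) = 1"
    and "\<And>i. norm_2_1 M (\<xi> i) < \<infinity>"
    and "prob_space.indep_var M (\<Pi>\<^sub>M i\<in>UNIV. borel) (\<lambda>\<omega> i. X i \<omega>) (\<Pi>\<^sub>M i\<in>UNIV. borel) (\<lambda>\<omega> i. \<xi> i \<omega>)"
    and "prob_space N"
    and "weak_limit (total_variation \<mu>) M (\<lambda>n \<omega>. empirical_process F (\<lambda>i. X i \<omega>) n) N Z"
    and "mean_zero_gaussian_process N Z (\<lambda>x y. F (min x y) - F x * F y)"
  shows "tendsto_zero_in_outer_probability M
           (\<lambda>n \<omega>. SUP h\<in>BL1_L (total_variation \<mu>).
              \<bar>(\<integral>\<omega>'. h (multiplier_process F (\<lambda>i. X i \<omega>) (\<lambda>i. \<xi> i \<omega>') n) \<partial>M) - (\<integral>\<omega>'. h (Z \<omega>') \<partial>N)\<bar>)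
       \<and> asymptotically_measurable (total_variation \<mu>) M
           (\<lambda>n \<omega>. multiplier_process F (\<lambda>i. X i \<omega>) (\<lambda>i. \<xi> i \<omega>) n)"
proof -
  interpret prob_space M by fact
  have second: "expectation (\<lambda>\<omega>. (\<xi> i \<omega>)\<^sup>2) = 1" for i
    using assms(12,14)[of i] by simp
  interpret multipliers M \<xi>
    by (intro multipliers.intro multipliers_axioms.intro assms second)
  interpret multiplier_sample M \<xi> X D F
    by (intro multiplier_sample.intro multiplier_sample_axioms.intro multipliers_axioms assms)
  have "mean_zero_gaussian_process N Z covariance"
    using assms(19) unfolding covariance_def[abs_def] .
  then interpret multiplier_main M \<xi> X D F "total_variation \<mu>" N Z
    by (intro multiplier_main.intro multiplier_L.intro multiplier_L_axioms.intro multiplier_limit.intro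
        multiplier_limit_axioms.intro multiplier_main_axioms.intro multiplier_sample_axioms assms sets_total_variation)
  show ?thesis
    using conditional_limit diagonal_asymptotically_measurable unfolding cond_def W_def by simp
qed

end
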